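(* Let $\Omega\subset\mathbb{R}^{d_\Omega}$, $\zeta\in L^\infty(\Omega)$, $\kappa>0$, and the spaces $X=U\times E\times S$ and $Y=L\times M$ be as in the context. For $q\in L^2(\Omega)$, $\tilde{\mathbf e}\in[L^2(\Omega)]^{d_\Omega}$ and $\tilde{\mathbf s}\in[L^2(\Omega)]^{d_\Omega}$, consider the problem P2: find $(x,y)=(u,\mathbf e,\mathbf s,\lambda,\boldsymbol\mu)\in X\times Y$ such that $$(x,y)=\arg\Big\{\inf_{\bar x\in X}\ \sup_{\bar y\in Y}\ \mathcal L(\bar x,\bar y)\Big\},$$ where, for $\bar x=(\bar u,\bar{\mathbf e},\bar{\mathbf s})\in X$ and $\bar y=(\bar\lambda,\bar{\boldsymbol\mu})\in Y$, $$\mathcal L(\bar x,\bar y)=\tfrac12\|\bar{\mathbf e}-\tilde{\mathbf e}\|^2+\tfrac{\kappa}{2}\|\bar{\mathbf s}-\tilde{\mathbf s}\|^2-(\bar{\mathbf s},\nabla\bar\lambda)+(\zeta\bar u-q,\bar\lambda)+(\bar{\mathbf e}-\nabla\bar u,\bar{\boldsymbol\mu}).$$ Then problem P2 is well posed.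
   Context: $\Omega\subset\mathbb{R}^{d_\Omega}$ is a regular domain (bounded, connected, with Lipschitz boundary). Its boundary $\partial\Omega$ is divided into a Dirichlet part $\partial\Omega_D$ (of positive surface measure) and a Neumann part $\partial\Omega_N$; boundary conditions are homogeneous. $\|\cdot\|$ and $(\cdot,\cdot)$ denote the norm and scalar product of $L^2(\Omega)$ and of $[L^2(\Omega)]^{d_\Omega}$. The reaction coefficient $\zeta\in L^\infty(\Omega)$ is a given, possibly position-dependent function (no sign condition), and $\kappa>0$ is a constant. Function spaces: $U=\{\bar u\in H^1(\Omega):\bar u=0\text{ on }\partial\Omega_D\}$, $E=S=M=[L^2(\Omega)]^{d_\Omega}$, $L=\{g\in H^1(\Omega): g=0\text{ on }\partial\Omega_D\}$, $X=U\times E\times S$, $Y=L\times M$, with norms $$\|(u,\mathbf e,\mathbf s)\|_X=\sqrt{\|\nabla u\|^2+\|\mathbf e\|^2+\kappa\|\mathbf s\|^2},\qquad \|(\lambda,\boldsymbol\mu)\|_Y=\sqrt{\tfrac1\kappa\|\nabla\lambda\|^2+\|\boldsymbol\mu\|^2}.$$ A solution of P2 means a saddle point of $\mathcal L$ on $X\times Y$, i.e. $\mathcal L(x,\bar y)\le\mathcal L(x,y)\le\mathcal L(\bar x,y)$ for all $\bar x\in X,\ \bar y\in Y$; equivalently, a solution of the optimality conditions: for all $\delta u\in U$, $\delta\mathbf e\in E$, $\delta\mathbf s\in S$, $\delta\lambda\in L$, $\delta\boldsymbol\mu\in M$, $$(\lambda,\zeta\,\delta u)-(\boldsymbol\mu,\nabla\delta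 u)=0,\quad (\mathbf e,\delta\mathbf e)+(\boldsymbol\mu,\delta\mathbf e)=(\tilde{\mathbf e},\delta\mathbf e),\quad \kappa(\mathbf s,\delta\mathbf s)-(\nabla\lambda,\delta\mathbf s)=\kappa(\tilde{\mathbf s},\delta\mathbf s),$$ $$(\zeta u,\delta\lambda)-(\mathbf s,\nabla\delta\lambda)=(q,\delta\lambda),\quad -(\nabla u,\delta\boldsymbol\mu)+(\mathbf e,\delta\boldsymbol\mu)=0.$$ "Well posed" means: for every $q\in L^2(\Omega)$, $\tilde{\mathbf e},\tilde{\mathbf s}\in[L^2(\Omega)]^{d_\Omega}$ there is a unique solution $(x,y)\in X\times Y$, and it depends continuously (in the norm of $X\times Y$) on $(q,\tilde{\mathbf e},\tilde{\mathbf s})$. *)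

theory Defs
  imports "HOL-Analysis.Analysis"
begin

subsection \<open>Hausdorff measure and surface measure\<close>

text \<open>The empty set is treated separately since \<open>0 ^ 0 = 1\<close>; the value \<open>\<infinity>\<close> excludes sets of
  diameter greater than \<open>\<delta>\<close> from the coverings (\<^const>\<open>diameter\<close> is junk on unbounded sets).
  The factor is the usual normalisation making the \<open>DIM('a)\<close>-dimensional measure agree with
  Lebesgue measure.\<close>

definition hausdorff_gauge :: "nat \<Rightarrow> real \<Rightarrow> 'a::metric_space set \<Rightarrow> ennreal" where
  "hausdorff_gauge s \<delta> C =
     (if C = {} then 0
      else if bounded C \<and> diameter C \<le> \<delta> then ennreal (unit_ball_vol (real s) * (diameter C / 2) ^ s)
      else \<infinity>)"

text \<open>\<^const>\<open>outer_measure\<close> takes infima over countable disjoint coverings; since the gauge is monotone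
  and defined on all sets, disjointness does not change the infimum.\<close>

definition hausdorff_outer :: "nat \<Rightarrow> 'a::metric_space set \<Rightarrow> ennreal" where
  "hausdorff_outer s A = (SUP \<delta>\<in>{0<..}. outer_measure UNIV (hausdorff_gauge s \<delta>) A)"

definition hausdorff_measure :: "nat \<Rightarrow> 'a::metric_space measure" where
  "hausdorff_measure s = measure_of UNIV (sets borel) (hausdorff_outer s)"

definition surface_measure :: "'a::euclidean_space set \<Rightarrow> 'a measure" where
  "surface_measure \<Omega> = completion (restrict_space (hausdorff_measure (DIM('a) - 1)) (frontier \<Omega>))"

text \<open>\<^const>\<open>measure_of\<close> silently returns the zero measure if its last argument is not countably additive.
  By Caratheodory's criterion for metric outer measures this does not happen here; see
  \<open>emeasure_hausdorff_measure\<close> at the end of this theory.\<close>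

subsection \<open>Regular domains\<close>

text \<open>Near every boundary point, in the coordinates given by a unit vector \<open>n\<close> and its orthogonal
  complement, \<open>\<Omega>\<close> is the strict epigraph of a Lipschitz function.\<close>

definition lipschitz_boundary :: "'a::euclidean_space set \<Rightarrow> bool" where
  "lipschitz_boundary \<Omega> \<longleftrightarrow>
     (\<forall>x0\<in>frontier \<Omega>. \<exists>r>0. \<exists>n (\<gamma> :: 'a \<Rightarrow> real) C.
        norm n = 1 \<and> C-lipschitz_on {y. y \<bullet> n = 0} \<gamma> \<and>
        \<Omega> \<inter> ball x0 r = {x \<in> ball x0 r. \<gamma> (x - (x \<bullet> n) *\<^sub>R n) < x \<bullet> n})"

definition regular_domain :: "'a::euclidean_space set \<Rightarrow> bool" where
  "regular_domain \<Omega> \<longleftrightarrow>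
     open \<Omega> \<and> connected \<Omega> \<and> \<Omega> \<noteq> {} \<and> bounded \<Omega> \<and> lipschitz_boundary \<Omega>"

subsection \<open>Lebesgue spaces\<close>

text \<open>Elements of \<open>L\<^sup>2\<close>, \<open>L\<^sup>\<infinity>\<close> and \<open>H\<^sup>1\<close> are represented by functions; two functions represent the
  same element iff they agree almost everywhere.\<close>

definition L2 :: "'a measure \<Rightarrow> ('a \<Rightarrow> 'b::euclidean_space) set" where
  "L2 M = {f. f \<in> borel_measurable M \<and> integrable M (\<lambda>x. (norm (f x))\<^sup>2)}"

definition l2_inner :: "'a measure \<Rightarrow> ('a \<Rightarrow> 'b::euclidean_space) \<Rightarrow> ('a \<Rightarrow> 'b) \<Rightarrow> real" where
  "l2_inner M f g = (\<integral>x. f x \<bullet> g x \<partial>M)"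

definition l2_norm :: "'a measure \<Rightarrow> ('a \<Rightarrow> 'b::euclidean_space) \<Rightarrow> real" where
  "l2_norm M f = sqrt (l2_inner M f f)"

definition Linfty :: "'a measure \<Rightarrow> ('a \<Rightarrow> real) set" where
  "Linfty M = {f. f \<in> borel_measurable M \<and> (\<exists>C. AE x in M. \<bar>f x\<bar> \<le> C)}"

subsection \<open>The Sobolev space \<open>H\<^sup>1\<close>\<close>

primrec Ck :: "nat \<Rightarrow> ('a::euclidean_space \<Rightarrow> real) \<Rightarrow> bool" where
  "Ck 0 f \<longleftrightarrow> continuous_on UNIV f"
| "Ck (Suc k) f \<longleftrightarrow> (\<forall>x. f differentiable (at x)) \<and>
     (\<forall>b\<in>Basis. Ck k (\<lambda>x. frechet_derivative f (at x) b))"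

definition smooth :: "('a::euclidean_space \<Rightarrow> real) \<Rightarrow> bool" where
  "smooth f \<longleftrightarrow> (\<forall>k. Ck k f)"

text \<open>\<open>C\<^sub>c\<^sup>\<infinity>(\<Omega>)\<close>, its elements being extended by zero to the whole space.\<close>

definition test_functions :: "'a::euclidean_space set \<Rightarrow> ('a \<Rightarrow> real) set" where
  "test_functions \<Omega> =
     {\<phi>. smooth \<phi> \<and> compact (closure {x. \<phi> x \<noteq> 0}) \<and> closure {x. \<phi> x \<noteq> 0} \<subseteq> \<Omega>}"

definition weak_gradient :: "'a::euclidean_space set \<Rightarrow> ('a \<Rightarrow> real) \<Rightarrow> ('a \<Rightarrow> 'a) \<Rightarrow> bool" where
  "weak_gradient \<Omega> u g \<longleftrightarrow>
     (\<forall>\<phi>\<in>test_functions \<Omega>. \<forall>b\<in>Basis.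
        (\<integral>x. u x * frechet_derivative \<phi> (at x) b \<partial>lebesgue_on \<Omega>) =
        - (\<integral>x. (g x \<bullet> b) * \<phi> x \<partial>lebesgue_on \<Omega>))"

definition H1 :: "'a::euclidean_space set \<Rightarrow> ('a \<Rightarrow> real) set" where
  "H1 \<Omega> = {u \<in> L2 (lebesgue_on \<Omega>). \<exists>g\<in>L2 (lebesgue_on \<Omega>). weak_gradient \<Omega> u g}"

text \<open>For \<open>u \<in> H\<^sup>1(\<Omega>)\<close> this picks a representative of \<open>\<nabla>u\<close>, which is determined almost everywhere.\<close>

definition grad :: "'a::euclidean_space set \<Rightarrow> ('a \<Rightarrow> real) \<Rightarrow> 'a \<Rightarrow> 'a" where
  "grad \<Omega> u = (SOME g. g \<in> L2 (lebesgue_on \<Omega>) \<and> weak_gradient \<Omega> u g)"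

definition h1_norm :: "'a::euclidean_space set \<Rightarrow> ('a \<Rightarrow> real) \<Rightarrow> real" where
  "h1_norm \<Omega> u =
     sqrt ((l2_norm (lebesgue_on \<Omega>) u)\<^sup>2 + (l2_norm (lebesgue_on \<Omega>) (grad \<Omega> u))\<^sup>2)"

text \<open>The trace operator \<open>H\<^sup>1(\<Omega>) \<rightarrow> L\<^sup>2(\<Gamma>)\<close> on a part \<open>\<Gamma>\<close> of the boundary, given by its graph: it is the
  closure of the restriction map \<open>\<phi> \<mapsto> \<phi>|\<Gamma>\<close> on the functions that are smooth up to the boundary, which
  for a bounded Lipschitz domain is the continuous extension of that map to \<open>H\<^sup>1(\<Omega>)\<close>.\<close>

definition has_trace ::
    "'a::euclidean_space set \<Rightarrow> 'a set \<Rightarrow> ('a \<Rightarrow> real) \<Rightarrow> ('a \<Rightarrow> real) \<Rightarrow> bool" where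
  "has_trace \<Omega> \<Gamma> u g \<longleftrightarrow>
     (let \<sigma> = restrict_space (surface_measure \<Omega>) \<Gamma> in
      u \<in> H1 \<Omega> \<and> g \<in> L2 \<sigma> \<and>
      (\<exists>\<phi> :: nat \<Rightarrow> 'a \<Rightarrow> real.
         (\<forall>n. smooth (\<phi> n) \<and> \<phi> n \<in> H1 \<Omega> \<and> \<phi> n \<in> L2 \<sigma>) \<and>
         (\<lambda>n. h1_norm \<Omega> (\<phi> n - u)) \<longlonglongrightarrow> 0 \<and>
         (\<lambda>n. l2_norm \<sigma> (\<phi> n - g)) \<longlonglongrightarrow> 0))"

definition H1_zero_on :: "'a::euclidean_space set \<Rightarrow> 'a set \<Rightarrow> ('a \<Rightarrow> real) set" where
  "H1_zero_on \<Omega> \<Gamma> = {u \<in> H1 \<Omega>. has_trace \<Omega> \<Gamma> u (\<lambda>x. 0)}"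

subsection \<open>Problem P2\<close>

type_synonym 'a primal = "('a \<Rightarrow> real) \<times> ('a \<Rightarrow> 'a) \<times> ('a \<Rightarrow> 'a)"
type_synonym 'a dual = "('a \<Rightarrow> real) \<times> ('a \<Rightarrow> 'a)"

text \<open>The data are triples \<open>(q, et, st)\<close>, where \<open>et\<close> and \<open>st\<close> are the given fields that \<open>e\<close> and \<open>s\<close>
  are fitted to.\<close>

type_synonym 'a data = "('a \<Rightarrow> real) \<times> ('a \<Rightarrow> 'a) \<times> ('a \<Rightarrow> 'a)"

definition space_X :: "'a::euclidean_space set \<Rightarrow> 'a set \<Rightarrow> 'a primal set" where
  "space_X \<Omega> \<Gamma>D = H1_zero_on \<Omega> \<Gamma>D \<times> L2 (lebesgue_on \<Omega>) \<times> L2 (lebesgue_on \<Omega>)"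

definition space_Y :: "'a::euclidean_space set \<Rightarrow> 'a set \<Rightarrow> 'a dual set" where
  "space_Y \<Omega> \<Gamma>D = H1_zero_on \<Omega> \<Gamma>D \<times> L2 (lebesgue_on \<Omega>)"

definition data_space :: "'a::euclidean_space set \<Rightarrow> 'a data set" where
  "data_space \<Omega> = L2 (lebesgue_on \<Omega>) \<times> L2 (lebesgue_on \<Omega>) \<times> L2 (lebesgue_on \<Omega>)"

fun norm_X :: "'a::euclidean_space set \<Rightarrow> real \<Rightarrow> 'a primal \<Rightarrow> real" where
  "norm_X \<Omega> \<kappa> (u, e, s) =
     sqrt ((l2_norm (lebesgue_on \<Omega>) (grad \<Omega> u))\<^sup>2 + (l2_norm (lebesgue_on \<Omega>) e)\<^sup>2
           + \<kappa> * (l2_norm (lebesgue_on \<Omega>) s)\<^sup>2)"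

fun norm_Y :: "'a::euclidean_space set \<Rightarrow> real \<Rightarrow> 'a dual \<Rightarrow> real" where
  "norm_Y \<Omega> \<kappa> (l, m) =
     sqrt (1 / \<kappa> * (l2_norm (lebesgue_on \<Omega>) (grad \<Omega> l))\<^sup>2 + (l2_norm (lebesgue_on \<Omega>) m)\<^sup>2)"

fun norm_XY :: "'a::euclidean_space set \<Rightarrow> real \<Rightarrow> 'a primal \<times> 'a dual \<Rightarrow> real" where
  "norm_XY \<Omega> \<kappa> (x, y) = sqrt ((norm_X \<Omega> \<kappa> x)\<^sup>2 + (norm_Y \<Omega> \<kappa> y)\<^sup>2)"

fun data_norm :: "'a::euclidean_space set \<Rightarrow> 'a data \<Rightarrow> real" where
  "data_norm \<Omega> (q, et, st) =
     sqrt ((l2_norm (lebesgue_on \<Omega>) q)\<^sup>2 + (l2_norm (lebesgue_on \<Omega>) et)\<^sup>2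
           + (l2_norm (lebesgue_on \<Omega>) st)\<^sup>2)"

fun lagrangian ::
    "'a::euclidean_space set \<Rightarrow> ('a \<Rightarrow> real) \<Rightarrow> real \<Rightarrow> 'a data \<Rightarrow> 'a primal \<Rightarrow> 'a dual \<Rightarrow> real" where
  "lagrangian \<Omega> \<zeta> \<kappa> (q, et, st) (u, e, s) (l, m) =
     1 / 2 * (l2_norm (lebesgue_on \<Omega>) (e - et))\<^sup>2 + \<kappa> / 2 * (l2_norm (lebesgue_on \<Omega>) (s - st))\<^sup>2
     - l2_inner (lebesgue_on \<Omega>) s (grad \<Omega> l)
     + l2_inner (lebesgue_on \<Omega>) (\<lambda>x. \<zeta> x * u x - q x) l
     + l2_inner (lebesgue_on \<Omega>) (e - grad \<Omega> u) m"

definition P2_solution ::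
    "'a::euclidean_space set \<Rightarrow> 'a set \<Rightarrow> ('a \<Rightarrow> real) \<Rightarrow> real \<Rightarrow> 'a data \<Rightarrow> 'a primal \<Rightarrow> 'a dual \<Rightarrow> bool" where
  "P2_solution \<Omega> \<Gamma>D \<zeta> \<kappa> d x y \<longleftrightarrow>
     x \<in> space_X \<Omega> \<Gamma>D \<and> y \<in> space_Y \<Omega> \<Gamma>D \<and>
     (\<forall>y'\<in>space_Y \<Omega> \<Gamma>D. lagrangian \<Omega> \<zeta> \<kappa> d x y' \<le> lagrangian \<Omega> \<zeta> \<kappa> d x y) \<and>
     (\<forall>x'\<in>space_X \<Omega> \<Gamma>D. lagrangian \<Omega> \<zeta> \<kappa> d x y \<le> lagrangian \<Omega> \<zeta> \<kappa> d x' y)"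

fun ae_equal :: "'a::euclidean_space set \<Rightarrow> 'a primal \<times> 'a dual \<Rightarrow> 'a primal \<times> 'a dual \<Rightarrow> bool" where
  "ae_equal \<Omega> ((u, e, s), (l, m)) ((u', e', s'), (l', m')) \<longleftrightarrow>
     (AE t in lebesgue_on \<Omega>. u t = u' t \<and> e t = e' t \<and> s t = s' t \<and> l t = l' t \<and> m t = m' t)"

text \<open>The second conjunct is continuity of the solution map at every \<open>d0\<close>; by the first one the
  solutions \<open>(x0, y0)\<close> and \<open>(x, y)\<close> exist and are unique up to null sets.\<close>

definition P2_well_posed ::
    "'a::euclidean_space set \<Rightarrow> 'a set \<Rightarrow> ('a \<Rightarrow> real) \<Rightarrow> real \<Rightarrow> bool" where
  "P2_well_posed \<Omega> \<Gamma>D \<zeta> \<kappa> \<longleftrightarrow>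
     (\<forall>d\<in>data_space \<Omega>. \<exists>x y. P2_solution \<Omega> \<Gamma>D \<zeta> \<kappa> d x y \<and>
        (\<forall>x' y'. P2_solution \<Omega> \<Gamma>D \<zeta> \<kappa> d x' y' \<longrightarrow> ae_equal \<Omega> (x', y') (x, y))) \<and>
     (\<forall>d0\<in>data_space \<Omega>. \<forall>x0 y0. P2_solution \<Omega> \<Gamma>D \<zeta> \<kappa> d0 x0 y0 \<longrightarrow>
        (\<forall>\<epsilon>>0. \<exists>\<delta>>0. \<forall>d\<in>data_space \<Omega>. \<forall>x y. P2_solution \<Omega> \<Gamma>D \<zeta> \<kappa> d x y \<longrightarrow>
           data_norm \<Omega> (d - d0) < \<delta> \<longrightarrow> norm_XY \<Omega> \<kappa> ((x, y) - (x0, y0)) < \<epsilon>))"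

subsection \<open>The Hausdorff outer measure is a measure on the Borel sets\<close>

lemma hausdorff_gauge_mono:
  assumes "A \<subseteq> B" shows "hausdorff_gauge s \<delta> A \<le> hausdorff_gauge s \<delta> B"
proof (cases "A = {} \<or> \<not> (bounded B \<and> diameter B \<le> \<delta>)")
  case True
  then show ?thesis using assms by (auto simp: hausdorff_gauge_def)
next
  case False
  then have b: "bounded B" "diameter B \<le> \<delta>" "A \<noteq> {}" "B \<noteq> {}" "bounded A"
    using assms bounded_subset by auto
  have d: "diameter A \<le> diameter B" using diameter_subset assms b(1) by blast
  have "0 \<le> diameter A" using diameter_ge_0 b by blast
  then have "(diameter A / 2) ^ s \<le> (diameter B / 2) ^ s"
    using d by (intro power_mono) auto
  then have "unit_ball_vol (real s) * (diameter A / 2) ^ s \<le> unit_ball_vol (real s) * (diameter B / 2) ^ s"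
    by (intro mult_left_mono) auto
  then show ?thesis using b d by (auto simp: hausdorff_gauge_def intro!: ennreal_leI)
qed

lemma hausdorff_gauge_positive: "positive UNIV (hausdorff_gauge s \<delta>)"
  by (simp add: positive_def hausdorff_gauge_def)

lemma hausdorff_gauge_increasing: "increasing UNIV (hausdorff_gauge s \<delta>)"
  by (simp add: increasing_def hausdorff_gauge_mono)

lemma ring_of_sets_UNIV: "ring_of_sets (UNIV :: 'a set) UNIV"
  using algebra_Pow[of "UNIV :: 'a set"] by (simp add: algebra_def)

lemma hausdorff_delta_outer:
  "outer_measure_space (UNIV :: 'a::metric_space set set) (outer_measure UNIV (hausdorff_gauge s \<delta>))"
  using ring_of_sets.outer_measure_space_outer_measure[OF ring_of_sets_UNIV
      hausdorff_gauge_positive hausdorff_gauge_increasing, of s \<delta>] by simp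

lemma hausdorff_delta_antimono:
  assumes "\<delta> \<le> \<delta>'"
  shows "outer_measure UNIV (hausdorff_gauge s \<delta>') A \<le> outer_measure UNIV (hausdorff_gauge s \<delta>) A"
proof -
  have g: "hausdorff_gauge s \<delta>' C \<le> hausdorff_gauge s \<delta> C" for C :: "'a set"
    using assms by (auto simp: hausdorff_gauge_def)
  show ?thesis unfolding outer_measure_def
    by (rule INF_mono) (use g in \<open>auto intro!: suminf_le\<close>)
qed

lemma hausdorff_outer_mono:
  fixes A B :: "'a::metric_space set"
  assumes "A \<subseteq> B" shows "hausdorff_outer s A \<le> hausdorff_outer s B"
proof -
  have "outer_measure UNIV (hausdorff_gauge s \<delta>) A \<le> outer_measure UNIV (hausdorff_gauge s \<delta>) B" for \<delta>
    using hausdorff_delta_outer[of s \<delta>, where 'a='a] assms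
    by (simp add: outer_measure_space_def increasing_def)
  then show ?thesis unfolding hausdorff_outer_def by (rule SUP_mono')
qed

lemma hausdorff_outer_empty [simp]: "hausdorff_outer s ({} :: 'a::metric_space set) = 0"
proof -
  have "outer_measure UNIV (hausdorff_gauge s \<delta>) ({} :: 'a set) = 0" for \<delta> :: real
    using hausdorff_delta_outer[of s \<delta>, where 'a='a] by (simp add: outer_measure_space_def positive_def)
  then show ?thesis by (simp add: hausdorff_outer_def)
qed

lemma outer_measure_UNIV_csub:
  fixes A :: "nat \<Rightarrow> 'a::metric_space set"
  shows "outer_measure UNIV (hausdorff_gauge s \<delta>) (\<Union>i. A i)
       \<le> (\<Sum>i. outer_measure UNIV (hausdorff_gauge s \<delta>) (A i))"
proof -
  let ?O = "outer_measure UNIV (hausdorff_gauge s \<delta>) :: 'a set \<Rightarrow> ennreal"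
  have O: "countably_subadditive UNIV ?O" "increasing UNIV ?O"
    using hausdorff_delta_outer[of s \<delta>, where 'a='a] by (auto simp: outer_measure_space_def)
  have "?O (\<Union>i. A i) = ?O (\<Union>i. disjointed A i)" by (simp add: UN_disjointed_eq)
  also have "\<dots> \<le> (\<Sum>i. ?O (disjointed A i))"
    using O(1) disjoint_family_disjointed[of A] by (auto simp: countably_subadditive_def)
  also have "\<dots> \<le> (\<Sum>i. ?O (A i))"
    using O(2) disjointed_subset by (intro suminf_le) (auto simp: increasing_def)
  finally show ?thesis .
qed

lemma hausdorff_outer_csub:
  fixes A :: "nat \<Rightarrow> 'a::metric_space set"
  shows "hausdorff_outer s (\<Union>i. A i) \<le> (\<Sum>i. hausdorff_outer s (A i))"
proof -
  have "outer_measure UNIV (hausdorff_gauge s \<delta>) (\<Union>i. A i) \<le> (\<Sum>i. hausdorff_outer s (A i))"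
    if "\<delta> > 0" for \<delta>
  proof -
    have "outer_measure UNIV (hausdorff_gauge s \<delta>) (A i) \<le> hausdorff_outer s (A i)" for i
      unfolding hausdorff_outer_def using that by (intro SUP_upper) auto
    then show ?thesis
      by (intro order_trans[OF outer_measure_UNIV_csub] suminf_le) auto
  qed
  then show ?thesis unfolding hausdorff_outer_def[of s "\<Union>i. A i"] by (intro SUP_least) auto
qed

lemma hausdorff_outer_Un: "hausdorff_outer s (A \<union> B) \<le> hausdorff_outer s A + hausdorff_outer s B"
proof -
  have "hausdorff_outer s (\<Union>i. binaryset A B i) \<le> (\<Sum>i. hausdorff_outer s (binaryset A B i))"
    by (rule hausdorff_outer_csub)
  also have "\<dots> = hausdorff_outer s A + hausdorff_outer s B"
    by (rule suminf_binaryset_eq) simp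
  finally show ?thesis by (simp add: UN_binaryset_eq)
qed

lemma outer_measure_space_hausdorff_outer:
  "outer_measure_space (UNIV :: 'a::metric_space set set) (hausdorff_outer s)"
  by (auto simp: outer_measure_space_def positive_def increasing_def countably_subadditive_def
      hausdorff_outer_mono intro: hausdorff_outer_csub)

lemma hausdorff_outer_separated:
  fixes A B :: "'a::metric_space set"
  assumes "\<epsilon> > 0" and sep: "\<And>x y. x \<in> A \<Longrightarrow> y \<in> B \<Longrightarrow> \<epsilon> \<le> dist x y"
  shows "hausdorff_outer s A + hausdorff_outer s B \<le> hausdorff_outer s (A \<union> B)"
proof -
  let ?O = "\<lambda>\<delta>. outer_measure UNIV (hausdorff_gauge s \<delta>)"
  have less: "?O \<delta> A + ?O \<delta> B \<le> ?O \<delta> (A \<union> B)" if \<delta>: "0 < \<delta>" "\<delta> < \<epsilon>" for \<delta>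
    unfolding outer_measure_def[of _ _ "A \<union> B"]
  proof (rule INF_greatest)
    fix C :: "nat \<Rightarrow> 'a set"
    assume "C \<in> {C. range C \<subseteq> UNIV \<and> disjoint_family C \<and> A \<union> B \<subseteq> (\<Union>i. C i)}"
    then have C: "A \<union> B \<subseteq> (\<Union>i. C i)" by auto
    have split: "hausdorff_gauge s \<delta> (C i \<inter> A) + hausdorff_gauge s \<delta> (C i \<inter> B)
        \<le> hausdorff_gauge s \<delta> (C i)" for i
    proof (cases "C i \<inter> A = {} \<or> C i \<inter> B = {}")
      case True
      then show ?thesis
        using hausdorff_gauge_mono[of "C i \<inter> A" "C i" s \<delta>] hausdorff_gauge_mono[of "C i \<inter> B" "C i" s \<delta>]
        by (auto simp: hausdorff_gauge_def[of _ _ "{}"])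
    next
      case False
      then obtain x y where xy: "x \<in> C i" "x \<in> A" "y \<in> C i" "y \<in> B" by auto
      have "\<not> (bounded (C i) \<and> diameter (C i) \<le> \<delta>)"
        using diameter_bounded_bound[of "C i" x y] sep[of x y] xy \<delta> by force
      then show ?thesis using xy by (auto simp: hausdorff_gauge_def[of _ _ "C i"])
    qed
    have le: "?O \<delta> D \<le> (\<Sum>i. hausdorff_gauge s \<delta> (C i \<inter> D))" if "D \<subseteq> (\<Union>i. C i)" for D
      using that
      by (intro ring_of_sets.outer_measure_le[OF ring_of_sets_UNIV
            hausdorff_gauge_positive hausdorff_gauge_increasing]) auto
    have "?O \<delta> A + ?O \<delta> B
        \<le> (\<Sum>i. hausdorff_gauge s \<delta> (C i \<inter> A)) + (\<Sum>i. hausdorff_gauge s \<delta> (C i \<inter> B))"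
      using C by (intro add_mono le) auto
    also have "\<dots> = (\<Sum>i. hausdorff_gauge s \<delta> (C i \<inter> A) + hausdorff_gauge s \<delta> (C i \<inter> B))"
      by (intro suminf_add) auto
    also have "\<dots> \<le> (\<Sum>i. hausdorff_gauge s \<delta> (C i))"
      by (intro suminf_le split) auto
    finally show "?O \<delta> A + ?O \<delta> B \<le> (\<Sum>i. hausdorff_gauge s \<delta> (C i))" .
  qed
  have "?O \<delta> A + ?O \<delta>' B \<le> hausdorff_outer s (A \<union> B)" if "\<delta> > 0" "\<delta>' > 0" for \<delta> \<delta>'
  proof -
    define d where "d = min (\<epsilon> / 2) (min \<delta> \<delta>')"
    have d: "0 < d" "d < \<epsilon>" "d \<le> \<delta>" "d \<le> \<delta>'" using that assms(1) by (auto simp: d_def min_def)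
    have "?O \<delta> A + ?O \<delta>' B \<le> ?O d A + ?O d B"
      using d by (intro add_mono hausdorff_delta_antimono) auto
    also have "\<dots> \<le> ?O d (A \<union> B)" using less d by auto
    also have "\<dots> \<le> hausdorff_outer s (A \<union> B)"
      unfolding hausdorff_outer_def using d by (intro SUP_upper) auto
    finally show ?thesis .
  qed
  then have *: "?O \<delta> A + ?O \<delta>' B \<le> hausdorff_outer s (A \<union> B)" if "\<delta> \<in> {0<..}" "\<delta>' \<in> {0<..}" for \<delta> \<delta>'
    using that by simp
  have ne: "{0::real<..} \<noteq> {}" by (metis greaterThan_iff empty_iff zero_less_one)
  show ?thesis
    unfolding hausdorff_outer_def[of s A] hausdorff_outer_def[of s B]
      ennreal_SUP_add_left[OF ne, symmetric]
  proof (rule SUP_least)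
    fix \<delta> :: real assume \<delta>: "\<delta> \<in> {0<..}"
    show "?O \<delta> A + (SUP \<delta>\<in>{0<..}. ?O \<delta> B) \<le> hausdorff_outer s (A \<union> B)"
      by (subst ennreal_SUP_add_right[OF ne]) (intro SUP_least * \<delta>)
  qed
qed

lemma hausdorff_outer_closed_split:
  fixes F A :: "'a::metric_space set"
  assumes "closed F"
  shows "hausdorff_outer s (A \<inter> F) + hausdorff_outer s (A - F) \<le> hausdorff_outer s A"
proof (cases "F = {} \<or> hausdorff_outer s A = \<infinity>")
  case True
  then show ?thesis by auto
next
  case False
  let ?H = "hausdorff_outer s"
  define D where "D n = {x \<in> A. 1 / real (Suc n) \<le> infdist x F}" for n
  define R where "R n = D (Suc n) - D n" for n
  have fin: "?H A < \<infinity>" using False by (simp add: less_top)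
  have Dmono: "D i \<subseteq> D j" if "i \<le> j" for i j
  proof
    fix x assume x: "x \<in> D i"
    have "1 / real (Suc j) \<le> 1 / real (Suc i)" using that by (intro divide_left_mono) auto
    then show "x \<in> D j" using x by (auto simp: D_def)
  qed
  have sum_le: "(\<Sum>i<n. ?H (R (Suc (2 * i + c)))) \<le> ?H (D (2 * n + c))" for n c
  proof (induction n)
    case (Suc n)
    let ?m = "2 * n + c"
    have pos: "1 / real (Suc (Suc ?m)) < 1 / real (Suc ?m)"
      by (intro divide_strict_left_mono) (auto simp del: of_nat_Suc)
    have sep: "1 / real (Suc ?m) - 1 / real (Suc (Suc ?m)) \<le> dist x y"
      if "x \<in> D ?m" "y \<in> R (Suc ?m)" for x y
    proof -
      have "1 / real (Suc ?m) \<le> infdist x F" "infdist y F \<le> 1 / real (Suc (Suc ?m))"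
        using that by (auto simp: D_def R_def)
      then show ?thesis using infdist_triangle[of x F y] by linarith
    qed
    have "(\<Sum>i<Suc n. ?H (R (Suc (2 * i + c)))) \<le> ?H (D ?m) + ?H (R (Suc ?m))"
      using Suc.IH by (simp add: add_mono)
    also have "\<dots> \<le> ?H (D ?m \<union> R (Suc ?m))"
      using pos sep by (intro hausdorff_outer_separated[of "1 / real (Suc ?m) - 1 / real (Suc (Suc ?m))"]) auto
    also have "\<dots> \<le> ?H (D (2 * Suc n + c))"
      using Dmono[of ?m "2 * Suc n + c"] by (intro hausdorff_outer_mono) (auto simp: R_def)
    finally show ?case .
  qed simp
  define a where "a k = ?H (R (Suc k))" for k
  have part: "(\<Sum>k<n. a k) \<le> 2 * ?H A" for n
  proof -
    have "(\<Sum>k<n. a k) \<le> (\<Sum>k<2*n. a k)" by (intro sum_mono2) auto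
    also have "\<dots> = (\<Sum>i<n. a (2 * i + 0)) + (\<Sum>i<n. a (2 * i + 1))"
      by (induction n) (auto simp: algebra_simps)
    also have "\<dots> \<le> ?H (D (2 * n + 0)) + ?H (D (2 * n + 1))"
      unfolding a_def by (intro add_mono sum_le)
    also have "\<dots> \<le> ?H A + ?H A"
      by (intro add_mono hausdorff_outer_mono) (auto simp: D_def)
    finally show ?thesis by (simp add: mult_2)
  qed
  have "suminf a \<le> 2 * ?H A"
    using part by (intro suminf_le_const) auto
  also have "\<dots> < \<infinity>" using fin by (simp add: ennreal_mult_less_top)
  finally have S: "suminf a < \<infinity>" .
  have "?H (A \<inter> F) + ?H (A - F) + (\<Sum>k<n. a k) \<le> ?H A + suminf a" for n
  proof -
    have cover: "A - F \<subseteq> D (Suc n) \<union> (\<Union>k. R (Suc (k + n)))"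
    proof
      fix x assume x: "x \<in> A - F"
      then have "infdist x F > 0"
        using assms False infdist_pos_not_in_closed by blast
      then obtain m where "1 / real (Suc m) < infdist x F" by (metis nat_approx_posE)
      then have m: "x \<in> D m" using x by (auto simp: D_def)
      define l where "l = (LEAST m. x \<in> D m)"
      have l: "x \<in> D l" "\<And>j. j < l \<Longrightarrow> x \<notin> D j"
        unfolding l_def using LeastI[of "\<lambda>m. x \<in> D m", OF m] not_less_Least by blast+
      show "x \<in> D (Suc n) \<union> (\<Union>k. R (Suc (k + n)))"
      proof (cases "l \<le> Suc n")
        case True
        then show ?thesis using Dmono l by blast
      next
        case False
        define k where "k = l - Suc (Suc n)"
        have "l = Suc (Suc (k + n))" using False by (simp add: k_def)
        then have "x \<in> R (Suc (k + n))" using l by (auto simp: R_def)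
        then show ?thesis by blast
      qed
    qed
    have "?H (A - F) \<le> ?H (D (Suc n)) + ?H (\<Union>k. R (Suc (k + n)))"
      using hausdorff_outer_mono[OF cover, of s] hausdorff_outer_Un order_trans by blast
    also have "\<dots> \<le> ?H (D (Suc n)) + (\<Sum>k. a (k + n))"
      unfolding a_def by (intro add_left_mono hausdorff_outer_csub)
    finally have "?H (A \<inter> F) + ?H (A - F) + (\<Sum>k<n. a k)
        \<le> ?H (A \<inter> F) + (?H (D (Suc n)) + (\<Sum>k. a (k + n))) + (\<Sum>k<n. a k)"
      by (intro add_mono) auto
    also have "\<dots> = (?H (A \<inter> F) + ?H (D (Suc n))) + ((\<Sum>k. a (k + n)) + (\<Sum>k<n. a k))"
      by (simp add: ac_simps)
    also have "(\<Sum>k. a (k + n)) + (\<Sum>k<n. a k) = suminf a"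
      by (rule suminf_offset[symmetric]) auto
    also have "?H (A \<inter> F) + ?H (D (Suc n)) \<le> ?H (A \<inter> F \<union> D (Suc n))"
    proof (rule hausdorff_outer_separated)
      fix x y assume "x \<in> A \<inter> F" "y \<in> D (Suc n)"
      then have "1 / real (Suc (Suc n)) \<le> infdist y F" "x \<in> F" by (auto simp: D_def)
      then show "1 / real (Suc (Suc n)) \<le> dist x y"
        using infdist_le[of x F y] by (simp add: dist_commute)
    qed simp
    also have "\<dots> \<le> ?H A" by (intro hausdorff_outer_mono) (auto simp: D_def)
    finally show ?thesis by (simp add: add_right_mono)
  qed
  then have "(SUP n. (?H (A \<inter> F) + ?H (A - F)) + (\<Sum>k<n. a k)) \<le> ?H A + suminf a"
    by (intro SUP_least)
  then have "?H (A \<inter> F) + ?H (A - F) + suminf a \<le> ?H A + suminf a"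
    by (simp add: ennreal_SUP_add_right suminf_eq_SUP)
  then show ?thesis using S by auto
qed

lemma measure_space_hausdorff: "measure_space UNIV (sets borel) (hausdorff_outer s)"
proof -
  interpret P: sigma_algebra "UNIV :: 'a set" UNIV
    using sigma_algebra_Pow[of "UNIV :: 'a set"] by simp
  let ?L = "lambda_system (UNIV :: 'a set) UNIV (hausdorff_outer s)"
  have L: "measure_space UNIV ?L (hausdorff_outer s)"
    by (rule P.caratheodory_lemma[OF outer_measure_space_hausdorff_outer])
  then have sa: "sigma_algebra UNIV ?L" by (simp add: measure_space_def)
  have "F \<in> ?L" if "closed F" for F
    unfolding P.lambda_system_eq
    using hausdorff_outer_closed_split[OF that] hausdorff_outer_Un[of s "A \<inter> F" "A - F" for A]
    by (auto simp: Int_Diff_Un intro!: antisym)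
  then have "sigma_sets UNIV (Collect closed) \<subseteq> ?L"
    by (intro sigma_algebra.sigma_sets_subset[OF sa]) auto
  then have "sets (borel :: 'a measure) \<subseteq> ?L"
    by (simp add: borel_eq_closed)
  then show ?thesis
    using measure_down[OF L, of "sets borel"] sets.sigma_algebra_axioms[of "borel :: 'a measure"] by simp
qed

lemma sets_hausdorff_measure [simp]: "sets (hausdorff_measure s) = sets borel"
  using sets.sigma_sets_eq[of "borel :: 'a measure"]
  by (simp add: hausdorff_measure_def)

lemma emeasure_hausdorff_measure:
  "A \<in> sets borel \<Longrightarrow> emeasure (hausdorff_measure s) A = hausdorff_outer s A"
  using measure_space_hausdorff[of s, where 'a='a]
  by (auto simp: hausdorff_measure_def measure_space_def intro!: emeasure_measure_of_sigma)

end

theory Submission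
  imports Defs "HOL-Real_Asymp.Real_Asymp"
begin

text \<open>Eliminating \<open>e = \<nabla>u\<close>, \<open>\<mu> = et - \<nabla>u\<close> and \<open>s = st + \<nabla>\<lambda> / \<kappa>\<close> from the optimality conditions leaves
  two coupled weak equations for \<open>u\<close> and \<open>\<lambda>\<close> in the space \<open>V\<close> of \<open>H\<^sup>1\<close> functions vanishing on the
  Dirichlet boundary:
  \<open>(\<nabla>u, \<nabla>v) + (\<zeta>\<lambda>, v) = (et, \<nabla>v)\<close> and \<open>(\<nabla>\<lambda>, \<nabla>w) / \<kappa> - (\<zeta>u, w) = - (q, w) - (st, \<nabla>w)\<close>.
  The two occurrences of \<open>\<zeta>\<close> are skew to each other: testing with \<open>v = u\<close> and \<open>w = \<lambda>\<close> they cancel,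
  whatever the sign of \<open>\<zeta>\<close>, and what remains bounds \<open>\<parallel>\<nabla>u\<parallel>\<^sup>2 + \<parallel>\<nabla>\<lambda>\<parallel>\<^sup>2 / \<kappa>\<close> by the data
  (\<open>optimal_bound\<close>). Applied to the difference of two solutions this gives uniqueness and Lipschitz
  dependence on the data.

  For existence, let \<open>lift u\<close> in \<open>V\<close> represent the functional \<open>v \<mapsto> (\<zeta>u, v)\<close> with respect to
  \<open>(\<nabla>\<cdot>, \<nabla>\<cdot>)\<close>. Eliminating \<open>\<lambda>\<close> turns the system into one equation for \<open>u\<close> whose form
  \<open>(\<nabla>u, \<nabla>v) + \<kappa> (\<nabla>(lift u), \<nabla>(lift v))\<close> is again symmetric and coercive, so that the Riesz theorem
  solves the two equations one after the other (\<open>reduced_system_solvable\<close>). The solutions of the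
  optimality conditions are exactly the saddle points, because the Lagrangian is affine in the dual
  and convex quadratic in the primal variable.

  All of this rests on the Friedrichs inequality \<open>\<parallel>u\<parallel> \<le> C \<parallel>\<nabla>u\<parallel>\<close> on \<open>V\<close> (\<open>friedrichs_inequality\<close>), for a
  Dirichlet part that is merely measurable and of positive surface measure. It is proved for smooth
  functions, without compactness of embeddings, by transporting a bound of the mean square from one
  set to another along segments inside the domain (\<open>increment_integral_le\<close>). The bound starts at a
  piece of the Dirichlet boundary lying in one Lipschitz chart and is swept inwards over a layer of
  positive volume (\<open>boundary_controls_domain\<close>); it passes from any set to every ball inside the
  domain that it meets in positive measure (\<open>controlled_ball\<close>), hence by connectedness to all compact subsets of the domain
  (\<open>controlled_compact\<close>); and it reaches the remaining boundary by a translation into the interior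
  (\<open>boundary_patch_controlled\<close>). Two comparisons of volume and surface measure enter: sweeping a set
  does not produce more volume than a constant times its surface measure
  (\<open>tube_measure_le_hausdorff\<close>), and a piece of a Lipschitz graph that sweeps out no volume has no
  surface measure (\<open>hausdorff_null_if_swept_null\<close>).

  The gradient of an \<open>H\<^sup>1\<close> function is a chosen weak gradient. That it is linear and agrees with the
  classical gradient, both almost everywhere, is a consequence of the fundamental lemma of the
  calculus of variations.\<close>

section \<open>The Riesz representation theorem in semi-inner product spaces\<close>

lemma quadratic_nonneg_imp_discriminant:
  fixes a b c :: real
  assumes "\<And>t. 0 \<le> a + 2 * t * b + t\<^sup>2 * c" and "0 \<le> c"
  shows "b\<^sup>2 \<le> a * c"
proof (cases "c = 0")
  case True
  have "b = 0"
  proof (rule ccontr)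
    assume "b \<noteq> 0"
    then show False using assms(1)[of "- (a + 1) / (2 * b)"] True by (simp add: field_simps)
  qed
  then show ?thesis using True by simp
next
  case False
  then show ?thesis using assms(1)[of "- b / c"] assms(2)
    by (simp add: field_simps power2_eq_square)
qed

lemma linear_term_zero:
  fixes b c :: real
  assumes "\<And>t. 0 \<le> 2 * t * b + t\<^sup>2 * c" and "0 \<le> c"
  shows "b = 0"
  using quadratic_nonneg_imp_discriminant[of 0 b c] assms by simp

text \<open>The vector space structure is abstracted to the operation \<open>lc a u b v\<close>, standing for \<open>a u + b v\<close> and
  constrained only through the form \<open>p\<close>, so that the results apply to sets of functions carrying a
  semi-inner product.\<close>

locale semi_inner_space =
  fixes V :: "'v set" and lc :: "real \<Rightarrow> 'v \<Rightarrow> real \<Rightarrow> 'v \<Rightarrow> 'v" and p :: "'v \<Rightarrow> 'v \<Rightarrow> real"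
  assumes lc_in: "u \<in> V \<Longrightarrow> v \<in> V \<Longrightarrow> lc a u b v \<in> V"
    and p_sym: "u \<in> V \<Longrightarrow> v \<in> V \<Longrightarrow> p u v = p v u"
    and p_lc: "u \<in> V \<Longrightarrow> v \<in> V \<Longrightarrow> w \<in> V \<Longrightarrow> p (lc a u b v) w = a * p u w + b * p v w"
    and p_nonneg: "u \<in> V \<Longrightarrow> 0 \<le> p u u"
begin

lemma p_lc_right: "u \<in> V \<Longrightarrow> v \<in> V \<Longrightarrow> w \<in> V \<Longrightarrow> p w (lc a u b v) = a * p w u + b * p w v"
  by (simp add: p_sym[of w] lc_in p_lc)

lemma p_lc_lc:
  "u \<in> V \<Longrightarrow> v \<in> V \<Longrightarrow> p (lc a u b v) (lc a u b v) = a\<^sup>2 * p u u + 2 * a * b * p u v + b\<^sup>2 * p v v"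
  by (simp add: p_lc p_lc_right lc_in p_sym[of v u] algebra_simps power2_eq_square)

lemma Cauchy_Schwarz_sq: assumes "u \<in> V" "v \<in> V" shows "(p u v)\<^sup>2 \<le> p u u * p v v"
proof (rule quadratic_nonneg_imp_discriminant)
  fix t show "0 \<le> p u u + 2 * t * p u v + t\<^sup>2 * p v v"
    using p_nonneg[of "lc 1 u t v"] assms by (simp add: p_lc_lc lc_in)
qed (use assms p_nonneg in auto)

lemma Cauchy_Schwarz: assumes "u \<in> V" "v \<in> V" shows "\<bar>p u v\<bar> \<le> sqrt (p u u) * sqrt (p v v)"
  using Cauchy_Schwarz_sq[OF assms] by (metis real_sqrt_abs real_sqrt_le_mono real_sqrt_mult)

lemma norm_lc_le:
  assumes "u \<in> V" "v \<in> V"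
  shows "sqrt (p (lc a u b v) (lc a u b v)) \<le> \<bar>a\<bar> * sqrt (p u u) + \<bar>b\<bar> * sqrt (p v v)"
proof (rule real_le_lsqrt)
  show "0 \<le> \<bar>a\<bar> * sqrt (p u u) + \<bar>b\<bar> * sqrt (p v v)"
    using assms p_nonneg by (intro add_nonneg_nonneg mult_nonneg_nonneg) auto
  have "a * b * p u v \<le> \<bar>a * b\<bar> * \<bar>p u v\<bar>" by (metis abs_ge_self abs_mult)
  also have "\<dots> \<le> \<bar>a * b\<bar> * (sqrt (p u u) * sqrt (p v v))"
    using Cauchy_Schwarz[OF assms] by (intro mult_left_mono) auto
  finally show "p (lc a u b v) (lc a u b v) \<le> (\<bar>a\<bar> * sqrt (p u u) + \<bar>b\<bar> * sqrt (p v v))\<^sup>2"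
    using assms p_nonneg[OF assms(1)] p_nonneg[OF assms(2)]
    by (simp add: p_lc_lc power2_sum power_mult_distrib abs_mult algebra_simps)
qed

text \<open>The representing element minimises \<open>p v v - 2 F v\<close>. Minimising sequences are Cauchy by the
  parallelogram law, and the equation is the vanishing of the first variation.\<close>

lemma riesz:
  assumes ne: "V \<noteq> {}"
    and complete: "\<And>U. (\<And>n. U n \<in> V) \<Longrightarrow>
        (\<And>e. e > 0 \<Longrightarrow> \<exists>N. \<forall>m\<ge>N. \<forall>n\<ge>N. p (lc 1 (U m) (-1) (U n)) (lc 1 (U m) (-1) (U n)) < e) \<Longrightarrow>
        \<exists>u\<in>V. (\<lambda>n. p (lc 1 (U n) (-1) u) (lc 1 (U n) (-1) u)) \<longlonglongrightarrow> 0"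
    and F_lc: "\<And>a b u v. u \<in> V \<Longrightarrow> v \<in> V \<Longrightarrow> F (lc a u b v) = a * F u + b * F v"
    and F_bd: "\<And>v. v \<in> V \<Longrightarrow> \<bar>F v\<bar> \<le> C * sqrt (p v v)"
  shows "\<exists>u\<in>V. \<forall>v\<in>V. p u v = F v"
proof -
  define J where "J v = p v v - 2 * F v" for v
  have J_lower: "- C\<^sup>2 \<le> J v" if "v \<in> V" for v
  proof -
    have "0 \<le> (sqrt (p v v) - C)\<^sup>2" by simp
    then show ?thesis using F_bd[OF that] p_nonneg[OF that]
      by (auto simp: J_def power2_diff algebra_simps abs_le_iff)
  qed
  then have bdd: "bdd_below (J ` V)" by (intro bdd_belowI2)
  define m where "m = (INF v\<in>V. J v)"
  have m_le: "m \<le> J v" if "v \<in> V" for v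
    unfolding m_def using bdd that by (rule cINF_lower)
  have "\<exists>v\<in>V. J v < m + 1 / real (Suc n)" for n
  proof -
    have "m < m + 1 / real (Suc n)" by simp
    then show ?thesis using cInf_lessD[of "J ` V" "m + 1 / real (Suc n)"] ne by (auto simp: m_def)
  qed
  then obtain U where U: "\<And>n. U n \<in> V" "\<And>n. J (U n) < m + 1 / real (Suc n)" by metis
  have para: "p (lc 1 u (-1) v) (lc 1 u (-1) v) = 2 * J u + 2 * J v - 4 * J (lc (1/2) u (1/2) v)"
    if "u \<in> V" "v \<in> V" for u v
    using that by (simp add: J_def p_lc_lc F_lc power2_eq_square algebra_simps)
  have "\<exists>N. \<forall>k\<ge>N. \<forall>n\<ge>N. p (lc 1 (U k) (-1) (U n)) (lc 1 (U k) (-1) (U n)) < e" if e: "e > 0" for e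
  proof -
    obtain N where N: "1 / real (Suc N) < e / 4" by (metis e nat_approx_posE zero_less_divide_iff zero_less_numeral)
    have "p (lc 1 (U k) (-1) (U n)) (lc 1 (U k) (-1) (U n)) < e" if "k \<ge> N" "n \<ge> N" for k n
    proof -
      have "1 / real (Suc k) \<le> 1 / real (Suc N)" "1 / real (Suc n) \<le> 1 / real (Suc N)"
        using that by (auto intro!: divide_left_mono)
      moreover have "m \<le> J (lc (1/2) (U k) (1/2) (U n))" by (intro m_le lc_in U)
      ultimately show ?thesis
        unfolding para[OF U(1) U(1)] using U(2)[of k] U(2)[of n] N by linarith
    qed
    then show ?thesis by blast
  qed
  from complete[OF U(1) this] obtain u where u: "u \<in> V"
    and lim: "(\<lambda>n. p (lc 1 (U n) (-1) u) (lc 1 (U n) (-1) u)) \<longlonglongrightarrow> 0" by blast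
  (* Near-minimality of U n in the direction v, in the limit, is the first variation inequality. *)
  have "p u v = F v" if v: "v \<in> V" for v
  proof -
    have "(\<lambda>n. p (U n) v - p u v) \<longlonglongrightarrow> 0"
    proof (rule Lim_null_comparison)
      show "eventually (\<lambda>n. norm (p (U n) v - p u v) \<le>
          sqrt (p (lc 1 (U n) (-1) u) (lc 1 (U n) (-1) u)) * sqrt (p v v)) sequentially"
        using Cauchy_Schwarz[OF lc_in[OF U(1) u] v, of 1 _ "-1"] by (simp add: p_lc U u v)
      show "(\<lambda>n. sqrt (p (lc 1 (U n) (-1) u) (lc 1 (U n) (-1) u)) * sqrt (p v v)) \<longlonglongrightarrow> 0"
        using tendsto_mult_left_zero[OF tendsto_real_sqrt[OF lim, simplified]] by simp
    qed
    then have pl: "(\<lambda>n. p (U n) v) \<longlonglongrightarrow> p u v" by (simp add: LIM_zero_iff)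
    have "0 \<le> 2 * t * (p u v - F v) + t\<^sup>2 * p v v" for t
    proof (rule LIMSEQ_le)
      show "(\<lambda>n. 2 * t * (p (U n) v - F v) + t\<^sup>2 * p v v) \<longlonglongrightarrow> 2 * t * (p u v - F v) + t\<^sup>2 * p v v"
        by (intro tendsto_intros pl)
      show "(\<lambda>n. - (1 / real (Suc n))) \<longlonglongrightarrow> 0"
        using tendsto_minus[OF lim_1_over_n[THEN LIMSEQ_Suc]] by simp
      have "- (1 / real (Suc n)) \<le> 2 * t * (p (U n) v - F v) + t\<^sup>2 * p v v" for n
      proof -
        have "m \<le> J (lc 1 (U n) t v)" by (intro m_le lc_in U v)
        also have "\<dots> = J (U n) + (2 * t * (p (U n) v - F v) + t\<^sup>2 * p v v)"
          using U v by (simp add: J_def p_lc_lc F_lc algebra_simps)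
        finally show ?thesis using U(2)[of n] by linarith
      qed
      then show "\<exists>N. \<forall>n\<ge>N. - (1 / real (Suc n)) \<le> 2 * t * (p (U n) v - F v) + t\<^sup>2 * p v v" by blast
    qed
    from linear_term_zero[OF this p_nonneg[OF v]] show ?thesis by simp
  qed
  then show ?thesis using u by blast
qed

end

section \<open>The space \<open>L\<^sup>2\<close>\<close>

lemma L2_D: "f \<in> L2 M \<Longrightarrow> f \<in> borel_measurable M" "f \<in> L2 M \<Longrightarrow> integrable M (\<lambda>x. (norm (f x))\<^sup>2)"
  by (auto simp: L2_def)

lemma L2_inner_integrable:
  assumes "f \<in> L2 M" "g \<in> L2 M" shows "integrable M (\<lambda>x. f x \<bullet> g x)"
proof (rule Bochner_Integration.integrable_bound)
  note [measurable] = assms[THEN L2_D(1)]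
  show "integrable M (\<lambda>x. (norm (f x))\<^sup>2 + (norm (g x))\<^sup>2)"
    by (intro Bochner_Integration.integrable_add L2_D assms)
  show "(\<lambda>x. f x \<bullet> g x) \<in> borel_measurable M" by measurable
  show "AE x in M. norm (f x \<bullet> g x) \<le> norm ((norm (f x))\<^sup>2 + (norm (g x))\<^sup>2)"
  proof (rule AE_I2)
    fix x
    have "\<bar>f x \<bullet> g x\<bar> \<le> norm (f x) * norm (g x)" by (rule Cauchy_Schwarz_ineq2)
    moreover have "2 * (norm (f x) * norm (g x)) \<le> (norm (f x))\<^sup>2 + (norm (g x))\<^sup>2"
      using sum_squares_bound[of "norm (f x)" "norm (g x)"] by simp
    moreover have "0 \<le> norm (f x) * norm (g x)" by simp
    ultimately show "norm (f x \<bullet> g x) \<le> norm ((norm (f x))\<^sup>2 + (norm (g x))\<^sup>2)"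
      by simp
  qed
qed

lemma L2_lincomb:
  assumes "f \<in> L2 M" "g \<in> L2 M" shows "(\<lambda>x. a *\<^sub>R f x + b *\<^sub>R g x) \<in> L2 M"
proof -
  note [measurable] = assms[THEN L2_D(1)]
  have eq: "(norm (a *\<^sub>R f x + b *\<^sub>R g x))\<^sup>2 = a\<^sup>2 * (norm (f x))\<^sup>2 + 2 * a * b * (f x \<bullet> g x) + b\<^sup>2 * (norm (g x))\<^sup>2" for x
    unfolding power2_norm_eq_inner
    by (simp add: inner_add_left inner_add_right inner_commute algebra_simps power2_eq_square[of a] power2_eq_square[of b])
  have "(\<lambda>x. a *\<^sub>R f x + b *\<^sub>R g x) \<in> borel_measurable M" by measurable
  moreover have "integrable M (\<lambda>x. (norm (a *\<^sub>R f x + b *\<^sub>R g x))\<^sup>2)"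
    unfolding eq
    by (intro Bochner_Integration.integrable_add integrable_mult_right L2_D L2_inner_integrable assms)
  ultimately show ?thesis by (simp add: L2_def)
qed

lemma L2_zero [simp]: "(\<lambda>x. 0) \<in> L2 M" by (simp add: L2_def)

interpretation L2: semi_inner_space "L2 M" "\<lambda>a f b g x. a *\<^sub>R f x + b *\<^sub>R g x" "l2_inner M"
  for M :: "'a measure"
proof
  fix f g h :: "'a \<Rightarrow> 'b" and a b :: real
  assume *: "f \<in> L2 M" "g \<in> L2 M"
  show "(\<lambda>x. a *\<^sub>R f x + b *\<^sub>R g x) \<in> L2 M" using * by (rule L2_lincomb)
  show "l2_inner M f g = l2_inner M g f" by (simp add: l2_inner_def inner_commute)
  assume h: "h \<in> L2 M"
  show "l2_inner M (\<lambda>x. a *\<^sub>R f x + b *\<^sub>R g x) h = a * l2_inner M f h + b * l2_inner M g h"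
    unfolding l2_inner_def inner_add_left inner_scaleR_left
    by (subst Bochner_Integration.integral_add) (auto intro!: integrable_mult_right L2_inner_integrable * h)
next
  fix f :: "'a \<Rightarrow> 'b" assume "f \<in> L2 M"
  show "0 \<le> l2_inner M f f" by (simp add: l2_inner_def)
qed

lemma l2_inner_self: "l2_inner M f f = (\<integral>x. (norm (f x))\<^sup>2 \<partial>M)"
  by (simp add: l2_inner_def power2_norm_eq_inner)

lemma l2_inner_self_nonneg: "0 \<le> l2_inner M f f"
  by (simp add: l2_inner_self)

lemma l2_norm_nonneg: "0 \<le> l2_norm M f"
  by (simp add: l2_norm_def l2_inner_self_nonneg)

lemma l2_norm_sq: "(l2_norm M f)\<^sup>2 = l2_inner M f f"
  by (simp add: l2_norm_def l2_inner_self_nonneg)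

lemma l2_Cauchy_Schwarz:
  "f \<in> L2 M \<Longrightarrow> g \<in> L2 M \<Longrightarrow> \<bar>l2_inner M f g\<bar> \<le> l2_norm M f * l2_norm M g"
  unfolding l2_norm_def by (rule L2.Cauchy_Schwarz)

lemma l2_norm_lincomb:
  "f \<in> L2 M \<Longrightarrow> g \<in> L2 M \<Longrightarrow> l2_norm M (\<lambda>x. a *\<^sub>R f x + b *\<^sub>R g x) \<le> \<bar>a\<bar> * l2_norm M f + \<bar>b\<bar> * l2_norm M g"
  unfolding l2_norm_def by (rule L2.norm_lc_le)

lemma L2_diff: "f \<in> L2 M \<Longrightarrow> g \<in> L2 M \<Longrightarrow> f - g \<in> L2 M"
  using L2_lincomb[of f M g 1 "-1"] by (simp add: fun_diff_def)

lemma l2_norm_diff_commute: "l2_norm M (f - g) = l2_norm M (g - f)"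
  by (simp add: l2_norm_def l2_inner_self norm_minus_commute)

lemma l2_inner_commute: "l2_inner M f g = l2_inner M g f"
  by (simp add: l2_inner_def inner_commute)

lemma l2_inner_lincomb:
  "u \<in> L2 M \<Longrightarrow> v \<in> L2 M \<Longrightarrow> w \<in> L2 M \<Longrightarrow>
    l2_inner M (\<lambda>x. a * u x + b * v x) w = a * l2_inner M u w + b * l2_inner M v w"
  using L2.p_lc[of u M v w a b] by simp

lemma l2_inner_lincomb_right:
  "u \<in> L2 M \<Longrightarrow> v \<in> L2 M \<Longrightarrow> w \<in> L2 M \<Longrightarrow>
    l2_inner M w (\<lambda>x. a * u x + b * v x) = a * l2_inner M w u + b * l2_inner M w v"
  using L2.p_lc_right[of u M v w a b] by simp

lemma l2_inner_diff_left:
  fixes f g h :: "'a \<Rightarrow> 'b::euclidean_space"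
  assumes "f \<in> L2 M" "g \<in> L2 M" "h \<in> L2 M"
  shows "l2_inner M (f - g) h = l2_inner M f h - l2_inner M g h"
proof -
  have "f - g = (\<lambda>x. 1 *\<^sub>R f x + (- 1) *\<^sub>R g x)" by (auto simp: fun_eq_iff)
  then show ?thesis using L2.p_lc[OF assms, of 1 "- 1"] by simp
qed

lemma l2_norm_diff_sq:
  fixes f g :: "'a \<Rightarrow> 'b::euclidean_space"
  assumes "f \<in> L2 M" "g \<in> L2 M"
  shows "(l2_norm M (f - g))\<^sup>2 = l2_inner M f f - 2 * l2_inner M f g + l2_inner M g g"
proof -
  have "f - g = (\<lambda>x. 1 *\<^sub>R f x + (- 1) *\<^sub>R g x)" by (auto simp: fun_eq_iff)
  then show ?thesis unfolding l2_norm_sq using L2.p_lc_lc[OF assms, of 1 "- 1"] by simp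
qed

lemma l2_inner_cong_AE:
  assumes "f \<in> borel_measurable M" "g \<in> borel_measurable M" "f' \<in> borel_measurable M" "g' \<in> borel_measurable M"
    "AE x in M. f x = f' x" "AE x in M. g x = g' x"
  shows "l2_inner M f g = l2_inner M f' g'"
  unfolding l2_inner_def
  using assms by (intro integral_cong_AE) (measurable, auto)

lemma l2_norm_cong_AE:
  assumes "f \<in> borel_measurable M" "f' \<in> borel_measurable M" "AE x in M. f x = f' x"
  shows "l2_norm M f = l2_norm M f'"
  unfolding l2_norm_def by (simp add: l2_inner_cong_AE[of f M f f' f'] assms)

lemma l2_norm_eq_0_iff:
  assumes "f \<in> L2 M" shows "l2_norm M f = 0 \<longleftrightarrow> (AE x in M. f x = 0)"
proof -
  have "l2_norm M f = 0 \<longleftrightarrow> (\<integral>x. (norm (f x))\<^sup>2 \<partial>M) = 0"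
    by (simp add: l2_norm_def l2_inner_self)
  also have "\<dots> \<longleftrightarrow> (AE x in M. (norm (f x))\<^sup>2 = 0)"
    by (intro integral_nonneg_eq_0_iff_AE L2_D assms) auto
  finally show ?thesis by simp
qed

lemma nn_integral_L2:
  assumes "f \<in> L2 M" shows "(\<integral>\<^sup>+x. ennreal ((norm (f x))\<^sup>2) \<partial>M) = ennreal ((l2_norm M f)\<^sup>2)"
  unfolding l2_norm_sq l2_inner_self by (intro nn_integral_eq_integral L2_D assms) auto

lemma L2I_nn:
  assumes "f \<in> borel_measurable M" "(\<integral>\<^sup>+x. ennreal ((norm (f x))\<^sup>2) \<partial>M) \<le> ennreal (c\<^sup>2)" "0 \<le> c"
  shows "f \<in> L2 M" "l2_norm M f \<le> c"
proof -
  show f: "f \<in> L2 M"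
    unfolding L2_def using assms by (auto intro!: integrableI_bounded simp: le_less_trans[OF _ ennreal_less_top])
  show "l2_norm M f \<le> c"
  proof (rule power2_le_imp_le)
    have "ennreal ((l2_norm M f)\<^sup>2) \<le> ennreal (c\<^sup>2)" using assms(2) unfolding nn_integral_L2[OF f] .
    then show "(l2_norm M f)\<^sup>2 \<le> c\<^sup>2" by (subst (asm) ennreal_le_iff) auto
  qed (fact assms(3))
qed

text \<open>On a finite measure space an \<open>L\<^sup>2\<close> Cauchy sequence is an \<open>L\<^sup>1\<close> Cauchy sequence, so a subsequence
  converges almost everywhere; Fatou's lemma turns this into convergence of the whole sequence in
  \<open>L\<^sup>2\<close>.\<close>

lemma L2_complete:
  fixes f :: "nat \<Rightarrow> 'a \<Rightarrow> 'b::euclidean_space"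
  assumes "finite_measure M" and f: "\<And>n. f n \<in> L2 M"
    and Cauchy: "\<And>e. e > 0 \<Longrightarrow> \<exists>N. \<forall>m\<ge>N. \<forall>n\<ge>N. l2_norm M (f m - f n) < e"
  shows "\<exists>g\<in>L2 M. (\<lambda>n. l2_norm M (f n - g)) \<longlonglongrightarrow> 0"
proof -
  interpret finite_measure M by fact
  note [measurable] = L2_D(1)[OF f]
  have one: "(\<lambda>x. 1::real) \<in> L2 M" by (simp add: L2_def)
  have nrm: "(\<lambda>x. norm (h x)) \<in> L2 M" if "h \<in> L2 M" for h :: "'a \<Rightarrow> 'b"
    using that by (auto simp: L2_def)
  have int: "integrable M h" if "h \<in> L2 M" for h :: "'a \<Rightarrow> 'b"
    using L2_inner_integrable[OF nrm[OF that] one] L2_D(1)[OF that] by (simp add: integrable_norm_iff)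
  define c where "c = l2_norm M (\<lambda>x. 1::real) + 1"
  have c: "c > 0" using l2_norm_nonneg[of M "\<lambda>x. 1::real"] by (simp add: c_def)
  have L1: "(\<integral>x. norm (h x) \<partial>M) \<le> l2_norm M h * c" if "h \<in> L2 M" for h :: "'a \<Rightarrow> 'b"
  proof -
    have "(\<integral>x. norm (h x) \<partial>M) \<le> \<bar>l2_inner M (\<lambda>x. norm (h x)) (\<lambda>x. 1::real)\<bar>" by (simp add: l2_inner_def)
    also have "\<dots> \<le> l2_norm M (\<lambda>x. norm (h x)) * l2_norm M (\<lambda>x. 1::real)"
      by (intro l2_Cauchy_Schwarz nrm that one)
    also have "\<dots> \<le> l2_norm M h * c"
      using l2_norm_nonneg[of M h] by (simp add: c_def algebra_simps l2_norm_def l2_inner_self)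
    finally show ?thesis .
  qed
  have "\<exists>N. \<forall>i\<ge>N. \<forall>j\<ge>N. (\<integral>x. norm (f i x - f j x) \<partial>M) < e" if "e > 0" for e
  proof -
    have "e / c > 0" using c that by simp
    from Cauchy[OF this] obtain N where N: "\<forall>m\<ge>N. \<forall>n\<ge>N. l2_norm M (f m - f n) < e / c" by blast
    have "(\<integral>x. norm (f i x - f j x) \<partial>M) < e" if "i \<ge> N" "j \<ge> N" for i j
    proof -
      have "l2_norm M (f i - f j) < e / c" using N that by blast
      then have "l2_norm M (f i - f j) * c < e" using c by (simp add: pos_less_divide_eq)
      then show ?thesis using L1[OF L2_diff[OF f f], of i j] by (simp add: fun_diff_def)
    qed
    then show ?thesis by blast
  qed
  from cauchy_L1_AE_cauchy_subseq[OF int[OF f] this] obtain r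
    where r: "strict_mono r" and AEc: "AE x in M. Cauchy (\<lambda>i. f (r i) x)" by blast
  define g where "g x = lim (\<lambda>i. f (r i) x)" for x
  have g[measurable]: "g \<in> borel_measurable M" unfolding g_def by measurable
  have AEl: "AE x in M. (\<lambda>i. f (r i) x) \<longlonglongrightarrow> g x"
    using AEc unfolding g_def by eventually_elim (simp add: Cauchy_convergent_iff convergent_LIMSEQ_iff)
  have key: "f n - g \<in> L2 M \<and> l2_norm M (f n - g) \<le> e"
    if N: "\<And>m. m \<ge> N \<Longrightarrow> l2_norm M (f n - f m) < e" and e: "e > 0" for e n N
  proof -
    have "(\<integral>\<^sup>+x. ennreal ((norm ((f n - g) x))\<^sup>2) \<partial>M)
        = (\<integral>\<^sup>+x. liminf (\<lambda>i. ennreal ((norm ((f n - f (r i)) x))\<^sup>2)) \<partial>M)"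
    proof (rule nn_integral_cong_AE, use AEl in eventually_elim)
      fix x assume "(\<lambda>i. f (r i) x) \<longlonglongrightarrow> g x"
      then have "(\<lambda>i. ennreal ((norm ((f n - f (r i)) x))\<^sup>2)) \<longlonglongrightarrow> ennreal ((norm ((f n - g) x))\<^sup>2)"
        unfolding fun_diff_def by (intro tendsto_intros tendsto_ennrealI)
      then show "ennreal ((norm ((f n - g) x))\<^sup>2) = liminf (\<lambda>i. ennreal ((norm ((f n - f (r i)) x))\<^sup>2))"
        by (rule lim_imp_Liminf[OF sequentially_bot, symmetric])
    qed
    also have "\<dots> \<le> liminf (\<lambda>i. \<integral>\<^sup>+x. ennreal ((norm ((f n - f (r i)) x))\<^sup>2) \<partial>M)"
      by (rule nn_integral_liminf) (simp add: fun_diff_def)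
    also have "\<dots> = liminf (\<lambda>i. ennreal ((l2_norm M (f n - f (r i)))\<^sup>2))"
      by (simp only: nn_integral_L2[OF L2_diff[OF f f]])
    also have "\<dots> \<le> ennreal (e\<^sup>2)"
    proof -
      have "ennreal ((l2_norm M (f n - f (r i)))\<^sup>2) \<le> ennreal (e\<^sup>2)" if "i \<ge> N" for i
        using N[of "r i"] seq_suble[OF r, of i] that l2_norm_nonneg[of M "f n - f (r i)"] e
        by (intro ennreal_leI power_mono) auto
      then have "eventually (\<lambda>i. ennreal ((l2_norm M (f n - f (r i)))\<^sup>2) \<le> ennreal (e\<^sup>2)) sequentially"
        using eventually_sequentially by blast
      then show ?thesis by (rule Liminf_le[OF sequentially_bot])
    qed
    finally show ?thesis using e L2I_nn[of "f n - g" M e] by (simp add: fun_diff_def)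
  qed
  from Cauchy[OF zero_less_one] obtain N where N: "\<forall>m\<ge>N. \<forall>n\<ge>N. l2_norm M (f m - f n) < 1" by blast
  then have "l2_norm M (f N - f m) < 1" if "m \<ge> N" for m using that by blast
  from key[OF this] have "f N - g \<in> L2 M" by simp
  from L2_diff[OF f[of N] this] have gL: "g \<in> L2 M" by (simp add: fun_diff_def)
  have "(\<lambda>n. l2_norm M (f n - g)) \<longlonglongrightarrow> 0"
  proof (rule LIMSEQ_I)
    fix e :: real assume e: "e > 0"
    then have e2: "e / 2 > 0" by simp
    from Cauchy[OF e2] obtain N where N: "\<forall>m\<ge>N. \<forall>n\<ge>N. l2_norm M (f m - f n) < e / 2" by blast
    have "norm (l2_norm M (f n - g) - 0) < e" if "n \<ge> N" for n
    proof -
      have "l2_norm M (f n - f m) < e / 2" if "m \<ge> N" for m using N that \<open>n \<ge> N\<close> by blast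
      from key[where N = N, OF this e2] have "l2_norm M (f n - g) \<le> e / 2" by simp
      then show ?thesis using e l2_norm_nonneg[of M "f n - g"] by simp
    qed
    then show "\<exists>N. \<forall>n\<ge>N. norm (l2_norm M (f n - g) - 0) < e" by blast
  qed
  with gL show ?thesis by blast
qed

section \<open>Test functions and the fundamental lemma of the calculus of variations\<close>

primrec times_differentiable :: "nat \<Rightarrow> (real \<Rightarrow> real) \<Rightarrow> bool" where
  "times_differentiable 0 f \<longleftrightarrow> True"
| "times_differentiable (Suc k) f \<longleftrightarrow>
     (\<exists>f'. (\<forall>t. (f has_real_derivative f' t) (at t)) \<and> times_differentiable k f')"

lemma times_differentiable_SucI:
  assumes "\<And>t. (f has_real_derivative f' t) (at t)" "times_differentiable k f'"
  shows "times_differentiable (Suc k) f"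
  using assms by auto

lemma times_differentiable_Suc_imp: "times_differentiable (Suc k) f \<Longrightarrow> times_differentiable k f"
proof (induction k arbitrary: f)
  case (Suc k)
  then obtain f' where "\<forall>t. (f has_real_derivative f' t) (at t)" "times_differentiable (Suc k) f'"
    by (metis times_differentiable.simps(2))
  with Suc.IH[of f'] show ?case by auto
qed simp

lemma times_differentiable_add:
  "times_differentiable k f \<Longrightarrow> times_differentiable k g \<Longrightarrow> times_differentiable k (\<lambda>t. f t + g t)"
proof (induction k arbitrary: f g)
  case (Suc k)
  then obtain f' g' where "\<forall>t. (f has_real_derivative f' t) (at t)" "times_differentiable k f'"
    "\<forall>t. (g has_real_derivative g' t) (at t)" "times_differentiable k g'" by auto
  with Suc.IH[of f' g'] show ?case
    by (auto intro!: exI[of _ "\<lambda>t. f' t + g' t"] derivative_eq_intros)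
qed simp

lemma times_differentiable_cmult:
  "times_differentiable k f \<Longrightarrow> times_differentiable k (\<lambda>t. c * f t)"
proof (induction k arbitrary: f)
  case (Suc k)
  then obtain f' where "\<forall>t. (f has_real_derivative f' t) (at t)" "times_differentiable k f'" by auto
  with Suc.IH[of f'] show ?case
    by (auto intro!: exI[of _ "\<lambda>t. c * f' t"] derivative_eq_intros)
qed simp

lemma times_differentiable_mult:
  "times_differentiable k f \<Longrightarrow> times_differentiable k g \<Longrightarrow> times_differentiable k (\<lambda>t. f t * g t)"
proof (induction k arbitrary: f g)
  case (Suc k)
  then obtain f' g' where *: "\<forall>t. (f has_real_derivative f' t) (at t)" "times_differentiable k f'"
    "\<forall>t. (g has_real_derivative g' t) (at t)" "times_differentiable k g'" by auto
  have "((\<lambda>t. f t * g t) has_real_derivative f' t * g t + f t * g' t) (at t)" for t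
    using * by (auto intro!: derivative_eq_intros)
  moreover have "times_differentiable k (\<lambda>t. f' t * g t + f t * g' t)"
    using times_differentiable_Suc_imp[OF Suc.prems(1)] times_differentiable_Suc_imp[OF Suc.prems(2)]
    by (intro times_differentiable_add Suc.IH *(2,4))
  ultimately show ?case by (rule times_differentiable_SucI)
qed simp

lemma times_differentiable_affine:
  "times_differentiable k f \<Longrightarrow> times_differentiable k (\<lambda>t. f (c * t + d))"
proof (induction k arbitrary: f)
  case (Suc k)
  then obtain f' where *: "\<forall>t. (f has_real_derivative f' t) (at t)" "times_differentiable k f'" by auto
  have "((\<lambda>t. f (c * t + d)) has_real_derivative c * f' (c * t + d)) (at t)" for t
  proof -
    have "((\<lambda>t. f (c * t + d)) has_real_derivative f' (c * t + d) * c) (at t)"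
      by (rule DERIV_chain2[of f "f' (c * t + d)"]) (use * in \<open>auto intro!: derivative_eq_intros\<close>)
    then show ?thesis by (simp add: mult.commute)
  qed
  moreover have "times_differentiable k (\<lambda>t. c * f' (c * t + d))"
    using Suc.IH[OF *(2)] by (rule times_differentiable_cmult)
  ultimately show ?case by (rule times_differentiable_SucI)
qed simp

text \<open>For \<open>k = 0\<close> this is the classical smooth function that is flat at \<open>0\<close>. The factors \<open>t ^ k\<close> make the
  family closed under differentiation up to linear combinations, which gives smoothness by induction.\<close>

definition flat :: "nat \<Rightarrow> real \<Rightarrow> real" where
  "flat k t = (if t > 0 then exp (- 1 / t) / t ^ k else 0)"

lemma power_le_fact_exp: "0 \<le> x \<Longrightarrow> x ^ n / fact n \<le> exp (x::real)"
proof -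
  assume x: "0 \<le> x"
  have "(\<Sum>k<Suc n. inverse (fact k) *\<^sub>R x ^ k) \<le> exp x"
    unfolding exp_def using x by (intro sum_le_suminf summable_exp_generic) auto
  moreover have "inverse (fact n) *\<^sub>R x ^ n \<le> (\<Sum>k<Suc n. inverse (fact k) *\<^sub>R x ^ k)"
    using x by (simp add: sum_nonneg)
  ultimately show ?thesis by (simp add: divide_inverse mult.commute)
qed

text \<open>The quadratic bound makes the difference quotient at \<open>0\<close> vanish in the limit. It comes from one
  term of the exponential series at \<open>1 / t\<close>.\<close>

lemma flat_le: "\<bar>flat k t\<bar> \<le> fact (k + 2) * t\<^sup>2"
proof (cases "t > 0")
  case True
  have "(1 / t) ^ (k + 2) / fact (k + 2) \<le> exp (1 / t)"
    using True by (intro power_le_fact_exp) auto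
  then have "1 \<le> exp (1 / t) * (fact (k + 2) * t ^ (k + 2))"
    using True by (simp add: power_one_over field_simps del: fact_Suc)
  then have "exp (- 1 / t) \<le> fact (k + 2) * t ^ (k + 2)"
    by (simp add: exp_minus field_simps)
  then have "exp (- 1 / t) / t ^ k \<le> fact (k + 2) * t\<^sup>2"
    using True by (simp add: pos_divide_le_eq power_add power2_eq_square mult_ac del: fact_Suc)
  then show ?thesis using True by (simp add: flat_def del: fact_Suc)
qed (simp add: flat_def)

lemma flat_deriv:
  "(flat k has_real_derivative - real k * flat (Suc k) t + flat (k + 2) t) (at t)"
proof -
  consider "t > 0" | "t < 0" | "t = 0" by linarith
  then show ?thesis
  proof cases
    case 1
    have "((\<lambda>t. exp (- 1 / t) / t ^ k) has_real_derivative
        ((exp (- 1 / t) * (1 / t\<^sup>2)) * t ^ k - exp (- 1 / t) * (real k * t ^ (k - 1))) / (t ^ k * t ^ k)) (at t)"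
      using 1 by (intro DERIV_divide) (auto intro!: derivative_eq_intros simp: power2_eq_square)
    moreover have "((exp (- 1 / t) * (1 / t\<^sup>2)) * t ^ k - exp (- 1 / t) * (real k * t ^ (k - 1))) / (t ^ k * t ^ k)
        = - real k * flat (Suc k) t + flat (k + 2) t"
      using 1 by (cases k) (auto simp: flat_def field_simps power2_eq_square)
    ultimately have "((\<lambda>t. exp (- 1 / t) / t ^ k) has_real_derivative - real k * flat (Suc k) t + flat (k + 2) t) (at t)"
      by simp
    then show ?thesis
      by (rule DERIV_cong_ev[THEN iffD1, OF refl _ refl, rotated])
        (use 1 eventually_nhds_in_open[of "{0<..}" t] in \<open>auto simp: flat_def elim!: eventually_mono\<close>)
  next
    case 2
    have "((\<lambda>t. 0::real) has_real_derivative 0) (at t)" by simp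
    then have "(flat k has_real_derivative 0) (at t)"
      by (rule DERIV_cong_ev[THEN iffD1, OF refl _ refl, rotated])
        (use 2 eventually_nhds_in_open[of "{..<0}" t] in \<open>auto simp: flat_def elim!: eventually_mono\<close>)
    then show ?thesis using 2 by (simp add: flat_def)
  next
    case 3
    have "(\<lambda>h. (flat k (0 + h) - flat k 0) / h) \<midarrow>0\<rightarrow> 0"
    proof (rule Lim_null_comparison)
      show "eventually (\<lambda>h. norm ((flat k (0 + h) - flat k 0) / h) \<le> fact (k + 2) * \<bar>h\<bar>) (at 0)"
      proof (rule always_eventually, rule allI)
        fix h :: real
        have "\<bar>flat k h\<bar> / \<bar>h\<bar> \<le> fact (k + 2) * h\<^sup>2 / \<bar>h\<bar>"
          by (intro divide_right_mono flat_le) auto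
        also have "\<dots> = fact (k + 2) * \<bar>h\<bar>" by (cases "h = 0") (auto simp: power2_eq_square abs_if)
        finally show "norm ((flat k (0 + h) - flat k 0) / h) \<le> fact (k + 2) * \<bar>h\<bar>"
          by (simp add: flat_def)
      qed
      show "(\<lambda>h. fact (k + 2) * \<bar>h\<bar> :: real) \<midarrow>0\<rightarrow> 0"
        by (intro tendsto_mult_right_zero tendsto_rabs_zero tendsto_ident_at)
    qed
    then show ?thesis using 3 by (simp add: DERIV_def flat_def)
  qed
qed

lemma times_differentiable_flat: "times_differentiable n (flat k)"
proof (induction n arbitrary: k)
  case (Suc n)
  have "times_differentiable n (\<lambda>t. - real k * flat (Suc k) t + flat (k + 2) t)"
    by (intro times_differentiable_add times_differentiable_cmult Suc.IH)
  with flat_deriv show ?case by (rule times_differentiable_SucI)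
qed simp

text \<open>The shift by \<open>- 1\<close> keeps the support at distance \<open>1 / n\<close> from the end points, so that it is a compact
  subset of the open interval; as \<open>n\<close> grows the functions converge to its indicator.\<close>

definition bump :: "nat \<Rightarrow> real \<Rightarrow> real \<Rightarrow> real \<Rightarrow> real" where
  "bump n a b t = flat 0 (real n * (t - a) - 1) * flat 0 (real n * (b - t) - 1)"

lemma times_differentiable_bump: "times_differentiable k (bump n a b)"
proof -
  have "times_differentiable k (\<lambda>t. flat 0 (real n * t + (- real n * a - 1)) * flat 0 (- real n * t + (real n * b - 1)))"
    by (intro times_differentiable_mult times_differentiable_affine times_differentiable_flat)
  moreover have "(\<lambda>t. flat 0 (real n * t + (- real n * a - 1)) * flat 0 (- real n * t + (real n * b - 1))) = bump n a b"
    by (auto simp: bump_def fun_eq_iff algebra_simps)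
  ultimately show ?thesis by simp
qed

lemma flat_0_bounds: "0 \<le> flat 0 t" "flat 0 t \<le> 1"
  by (auto simp: flat_def)

lemma bump_bounds: "0 \<le> bump n a b t" "bump n a b t \<le> 1"
  by (auto simp: bump_def flat_0_bounds intro!: mult_le_one)

lemma flat_nonzero: "flat k t \<noteq> 0 \<Longrightarrow> t > 0"
  by (rule ccontr) (simp add: flat_def)

lemma bump_nonzero:
  assumes "bump n a b t \<noteq> 0" shows "a + 1 / real n \<le> t" "t \<le> b - 1 / real n" "n > 0"
proof -
  have *: "real n * (t - a) - 1 > 0" "real n * (b - t) - 1 > 0"
    using assms flat_nonzero unfolding bump_def by (metis mult_eq_0_iff)+
  show n: "n > 0" using * by (cases n) auto
  have "1 / real n \<le> t - a" "1 / real n \<le> b - t"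
    using * n by (simp_all add: pos_divide_le_eq mult.commute)
  then show "a + 1 / real n \<le> t" "t \<le> b - 1 / real n" by linarith+
qed

lemma bump_tendsto: "(\<lambda>n. bump n a b t) \<longlonglongrightarrow> indicator {a<..<b} t"
proof (cases "a < t \<and> t < b")
  case True
  have lim: "(\<lambda>n. flat 0 (real n * c - 1)) \<longlonglongrightarrow> 1" if "c > 0" for c
  proof -
    have inf: "filterlim (\<lambda>n. real n * c - 1) at_top sequentially"
      using that by real_asymp
    have "(\<lambda>n. exp (- 1 / (real n * c - 1))) \<longlonglongrightarrow> 1" using that by real_asymp
    moreover have "eventually (\<lambda>n. flat 0 (real n * c - 1) = exp (- 1 / (real n * c - 1))) sequentially"
      using filterlim_at_top_dense[THEN iffD1, OF inf, rule_format, of 0]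
      by eventually_elim (simp add: flat_def)
    ultimately show ?thesis by (simp add: tendsto_cong)
  qed
  have "(\<lambda>n. bump n a b t) \<longlonglongrightarrow> 1 * 1"
    unfolding bump_def using True by (intro tendsto_mult lim) auto
  then show ?thesis using True by simp
next
  case False
  have "bump n a b t = 0" for n
  proof (rule ccontr)
    assume "bump n a b t \<noteq> 0"
    from bump_nonzero[OF this] have "a + 1 / real n \<le> t" "t \<le> b - 1 / real n" "1 / real n > 0" by auto
    with False show False by linarith
  qed
  then show ?thesis using False by simp
qed

text \<open>A partial derivative of a product of functions of the single coordinates is a product of the same
  kind, with one factor differentiated; so no sums have to be handled in the induction.\<close>

lemma Ck_prod_Basis:
  fixes h :: "'a::euclidean_space \<Rightarrow> real \<Rightarrow> real"
  assumes "\<And>i. i \<in> Basis \<Longrightarrow> times_differentiable (Suc k) (h i)"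
  shows "Ck k (\<lambda>x. \<Prod>i\<in>Basis. h i (x \<bullet> i))"
  using assms
proof (induction k arbitrary: h)
  case 0
  have "continuous_on UNIV (h i)" if i: "i \<in> Basis" for i
  proof -
    obtain h' where "\<forall>t. (h i has_real_derivative h' t) (at t)" using 0[OF i] by auto
    then show ?thesis by (auto intro!: continuous_at_imp_continuous_on DERIV_isCont)
  qed
  then have "continuous_on UNIV (\<lambda>x. h i (x \<bullet> i))" if "i \<in> Basis" for i
    by (rule continuous_on_compose2) (use that in \<open>auto intro: continuous_intros\<close>)
  then show ?case by (simp add: continuous_on_prod)
next
  case (Suc k)
  have "\<forall>i\<in>Basis. \<exists>h'. (\<forall>t. (h i has_real_derivative h' t) (at t)) \<and> times_differentiable (Suc k) h'"
    using Suc.prems unfolding times_differentiable.simps(2)[of "Suc k"] by blast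
  then obtain h' where h': "\<And>i t. i \<in> Basis \<Longrightarrow> (h i has_real_derivative h' i t) (at t)"
    "\<And>i. i \<in> Basis \<Longrightarrow> times_differentiable (Suc k) (h' i)" by metis
  let ?D = "\<lambda>x y. \<Sum>i\<in>Basis. (h' i (x \<bullet> i) * (y \<bullet> i)) * (\<Prod>j\<in>Basis - {i}. h j (x \<bullet> j))"
  have D: "((\<lambda>x. \<Prod>i\<in>Basis. h i (x \<bullet> i)) has_derivative ?D x) (at x)" for x
  proof (rule has_derivative_prod)
    fix i :: 'a assume "i \<in> Basis"
    from h'(1)[OF this, of "x \<bullet> i"] have "(h i has_derivative (*) (h' i (x \<bullet> i))) (at (x \<bullet> i))"
      by (simp add: has_field_derivative_def)
    with has_derivative_compose[where f = "\<lambda>x. x \<bullet> i" and f' = "\<lambda>y. y \<bullet> i" and g = "h i"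
        and g' = "(*) (h' i (x \<bullet> i))" and x = x and s = UNIV]
    show "((\<lambda>x. h i (x \<bullet> i)) has_derivative (\<lambda>y. h' i (x \<bullet> i) * (y \<bullet> i))) (at x)"
      by (simp add: bounded_linear_imp_has_derivative[OF bounded_linear_inner_left])
  qed
  have "Ck k (\<lambda>x. frechet_derivative (\<lambda>x. \<Prod>i\<in>Basis. h i (x \<bullet> i)) (at x) b)" if b: "b \<in> Basis" for b
  proof -
    let ?h = "\<lambda>i. if i = b then h' b else h i"
    have "frechet_derivative (\<lambda>x. \<Prod>i\<in>Basis. h i (x \<bullet> i)) (at x) b = (\<Prod>i\<in>Basis. ?h i (x \<bullet> i))" for x
    proof -
      have "frechet_derivative (\<lambda>x. \<Prod>i\<in>Basis. h i (x \<bullet> i)) (at x) b = ?D x b"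
        by (simp only: frechet_derivative_at[OF D[of x], symmetric])
      also have "\<dots> = (\<Sum>i\<in>Basis. if i = b then h' b (x \<bullet> b) * (\<Prod>j\<in>Basis - {b}. h j (x \<bullet> j)) else 0)"
        using b by (intro sum.cong) (auto simp: inner_Basis)
      also have "\<dots> = h' b (x \<bullet> b) * (\<Prod>j\<in>Basis - {b}. h j (x \<bullet> j))" using b by simp
      also have "\<dots> = (\<Prod>i\<in>Basis. ?h i (x \<bullet> i))"
        using b by (subst prod.remove[of Basis b]) (auto intro!: prod.cong)
      finally show ?thesis .
    qed
    moreover have "Ck k (\<lambda>x. \<Prod>i\<in>Basis. ?h i (x \<bullet> i))"
    proof (rule Suc.IH)
      fix i :: 'a assume i: "i \<in> Basis"
      show "times_differentiable (Suc k) (?h i)"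
        using h'(2)[OF b] times_differentiable_Suc_imp[OF Suc.prems[OF i]] by (cases "i = b") simp_all
    qed
    ultimately show ?thesis by simp
  qed
  moreover have "(\<lambda>x. \<Prod>i\<in>Basis. h i (x \<bullet> i)) differentiable (at x)" for x
    using D differentiable_def by blast
  ultimately show ?case by simp
qed

lemma box_bump_test_function:
  assumes "box a b \<subseteq> \<Omega>"
  shows "(\<lambda>x. \<Prod>i\<in>Basis. bump n (a \<bullet> i) (b \<bullet> i) (x \<bullet> i)) \<in> test_functions \<Omega>"
proof -
  let ?\<phi> = "\<lambda>x. \<Prod>i\<in>Basis. bump n (a \<bullet> i) (b \<bullet> i) (x \<bullet> i)"
  let ?K = "cbox (a + (1 / real n) *\<^sub>R One) (b - (1 / real n) *\<^sub>R One)"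
  have sm: "smooth ?\<phi>"
    unfolding smooth_def by (intro allI Ck_prod_Basis times_differentiable_bump)
  show ?thesis
  proof (cases "n = 0")
    case True
    then have "?\<phi> = (\<lambda>x. 0)" using bump_nonzero(3)[of n] by fastforce
    then show ?thesis using sm by (simp add: test_functions_def)
  next
    case False
    have "{x. ?\<phi> x \<noteq> 0} \<subseteq> ?K"
    proof
      fix x assume "x \<in> {x. ?\<phi> x \<noteq> 0}"
      then have "bump n (a \<bullet> i) (b \<bullet> i) (x \<bullet> i) \<noteq> 0" if "i \<in> Basis" for i using that by auto
      from bump_nonzero[OF this] show "x \<in> ?K"
        by (auto simp: mem_box inner_add_left inner_diff_left)
    qed
    then have *: "closure {x. ?\<phi> x \<noteq> 0} \<subseteq> ?K" by (intro closure_minimal) auto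
    moreover have "?K \<subseteq> box a b"
      using False by (auto simp: mem_box inner_add_left inner_diff_left)
        (smt (verit) divide_pos_pos of_nat_0_less_iff)+
    moreover have "compact (closure {x. ?\<phi> x \<noteq> 0})"
      using * bounded_subset[OF bounded_cbox] by (auto simp: compact_eq_bounded_closed)
    ultimately show ?thesis using sm assms by (auto simp: test_functions_def)
  qed
qed

lemma indicator_box_eq_prod: "indicator (box a b) x = (\<Prod>i\<in>Basis. indicator {a \<bullet> i<..<b \<bullet> i} (x \<bullet> i) :: real)"
proof (cases "x \<in> box a b")
  case True
  then show ?thesis by (auto simp: mem_box intro!: prod.neutral[symmetric])
next
  case False
  then obtain i where "i \<in> Basis" "x \<bullet> i \<notin> {a \<bullet> i<..<b \<bullet> i}" by (auto simp: mem_box)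
  then have "(\<Prod>i\<in>Basis. indicator {a \<bullet> i<..<b \<bullet> i} (x \<bullet> i) :: real) = 0"
    by (intro prod_zero) (auto intro!: bexI[of _ i])
  then show ?thesis using False by simp
qed

text \<open>Boxes form an intersection-stable generator of the Borel sets, so the set function
  \<open>A \<mapsto> \<integral>x\<in>A. h x\<close> vanishes on all Borel subsets of the box \<open>box c d\<close>.\<close>

lemma AE_zero_if_box_integrals_zero:
  fixes h :: "'a::euclidean_space \<Rightarrow> real"
  assumes h: "integrable lborel h" and K: "\<And>a b. (\<integral>x. indicator (box a b \<inter> box c d) x * h x \<partial>lborel) = 0"
  shows "AE x in lborel. x \<in> box c d \<longrightarrow> h x = 0"
proof -
  define g where "g x = indicator (box c d) x * h x" for x
  have g: "integrable lborel g" unfolding g_def using integrable_mult_indicator[OF _ h, of "box c d"] by simp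
  have set_int: "set_integrable lborel A g" if "A \<in> sets borel" for A
    unfolding set_integrable_def using that by (intro integrable_mult_indicator g) auto
  let ?G = "range (\<lambda>(a, b). box a b :: 'a set)"
  have sets_G: "sigma_sets UNIV ?G = sets borel"
    by (subst borel_eq_box) (simp add: sets_measure_of)
  have UNIV0: "set_lebesgue_integral lborel UNIV g = 0"
    using K[of c d] by (simp add: set_lebesgue_integral_def g_def)
  have "set_lebesgue_integral lborel A g = 0" if "A \<in> sigma_sets UNIV ?G" for A
  proof -
    have st: "Int_stable ?G"
      by (auto simp: Int_stable_def box_Int_box)
    show ?thesis
      using st subset_UNIV[of ?G, unfolded Pow_UNIV[symmetric]] that
    proof (induction rule: sigma_sets_induct_disjoint)
      case (basic A)
      then show ?case using K by (auto simp: set_lebesgue_integral_def g_def indicator_inter_arith mult.assoc)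
    next
      case empty
      then show ?case by (simp add: set_lebesgue_integral_def)
    next
      case (compl A)
      then have A: "A \<in> sets borel" using sets_G by simp
      have "set_lebesgue_integral lborel UNIV g
          = set_lebesgue_integral lborel A g + set_lebesgue_integral lborel (UNIV - A) g"
        using set_integral_Un[of A "UNIV - A" lborel g] A set_int by auto
      then show ?case using compl UNIV0 by simp
    next
      case (union A)
      have "range A \<subseteq> sets borel" using union(2) unfolding sets_G .
      then have "set_lebesgue_integral lborel (\<Union>i. A i) g = (\<Sum>i. set_lebesgue_integral lborel (A i) g)"
        using union(1) by (intro lebesgue_integral_countable_add set_int) (auto simp: disjoint_family_on_def)
      then show ?case using union by simp
    qed
  qed
  then have "AE x in lborel. g x = 0"
    by (intro sigma_finite_measure.density_zero[OF sigma_finite_lborel] g) (simp add: sets_G)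
  then show ?thesis by eventually_elim (auto simp: g_def indicator_def split: if_splits)
qed

text \<open>Indicators of boxes inside \<open>\<Omega>\<close> are bounded limits of test functions, so the integral of \<open>g\<close> over each
  such box is zero; and \<open>\<Omega>\<close> is a countable union of such boxes.\<close>

lemma fundamental_lemma_variations:
  fixes g :: "'a::euclidean_space \<Rightarrow> real"
  assumes "open \<Omega>" and g: "integrable (lebesgue_on \<Omega>) g"
    and zero: "\<And>\<phi>. \<phi> \<in> test_functions \<Omega> \<Longrightarrow> (\<integral>x. g x * \<phi> x \<partial>lebesgue_on \<Omega>) = 0"
  shows "AE x in lebesgue_on \<Omega>. g x = 0"
proof -
  have \<Omega>: "\<Omega> \<in> sets borel" "\<Omega> \<inter> space lebesgue \<in> sets lebesgue" using assms(1) by auto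
  define g0 where "g0 x = indicator \<Omega> x * g x" for x
  have g0: "integrable lebesgue g0"
    using g \<Omega>(2) unfolding g0_def by (simp add: integrable_restrict_space)
  then obtain h where h[measurable]: "h \<in> borel_measurable lborel" and gh: "AE x in lborel. g0 x = h x"
    using completion_ex_borel_measurable_real[of g0 lborel] by auto
  have gh': "AE x in lebesgue. g0 x = h x" using gh by (rule AE_completion)
  have "integrable lebesgue h"
    by (rule Bochner_Integration.integrable_cong_AE_imp[OF g0 _ gh']) (use h in \<open>auto intro: measurable_completion\<close>)
  then have hint: "integrable lborel h" by (simp add: integrable_completion)
  have box0: "(\<integral>x. indicator (box a b) x * h x \<partial>lborel) = 0" if ab: "box a b \<subseteq> \<Omega>" for a b
  proof -
    let ?\<phi> = "\<lambda>n x. \<Prod>i\<in>Basis. bump n (a \<bullet> i) (b \<bullet> i) (x \<bullet> i)"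
    have sm: "smooth (?\<phi> n)" for n using box_bump_test_function[OF ab, of n] by (simp add: test_functions_def)
    then have "continuous_on UNIV (?\<phi> n)" for n using Ck.simps(1) unfolding smooth_def by blast
    then have [measurable]: "?\<phi> n \<in> borel_measurable borel" for n by (rule borel_measurable_continuous_onI)
    have "(\<lambda>n. \<integral>x. ?\<phi> n x * h x \<partial>lborel) \<longlonglongrightarrow> (\<integral>x. indicator (box a b) x * h x \<partial>lborel)"
    proof (rule integral_dominated_convergence[where w = "\<lambda>x. \<bar>h x\<bar>"])
      show "integrable lborel (\<lambda>x. \<bar>h x\<bar>)" using hint by simp
      show "AE x in lborel. (\<lambda>n. ?\<phi> n x * h x) \<longlonglongrightarrow> indicator (box a b) x * h x"
        unfolding indicator_box_eq_prod by (intro AE_I2 tendsto_intros bump_tendsto)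
      show "AE x in lborel. norm (?\<phi> n x * h x) \<le> \<bar>h x\<bar>" for n
      proof (rule AE_I2)
        fix x
        have "0 \<le> ?\<phi> n x" "?\<phi> n x \<le> 1" by (auto intro!: prod_nonneg prod_le_1 bump_bounds)
        then show "norm (?\<phi> n x * h x) \<le> \<bar>h x\<bar>"
          by (simp add: abs_mult mult_left_le_one_le del: abs_prod prod_nonneg)
      qed
    qed (measurable)
    moreover have "(\<integral>x. ?\<phi> n x * h x \<partial>lborel) = 0" for n
    proof -
      have "(\<integral>x. ?\<phi> n x * h x \<partial>lborel) = (\<integral>x. ?\<phi> n x * h x \<partial>lebesgue)"
        by (simp add: integral_completion)
      also have "\<dots> = (\<integral>x. ?\<phi> n x * g0 x \<partial>lebesgue)"
        using gh' by (intro integral_cong_AE borel_measurable_times measurable_completion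
            borel_measurable_integrable[OF g0]) auto
      also have "\<dots> = (\<integral>x. indicator \<Omega> x *\<^sub>R (g x * ?\<phi> n x) \<partial>lebesgue)"
        by (simp add: g0_def mult_ac)
      also have "\<dots> = (\<integral>x. g x * ?\<phi> n x \<partial>lebesgue_on \<Omega>)"
        using \<Omega>(2) by (simp add: integral_restrict_space)
      also have "\<dots> = 0" by (rule zero[OF box_bump_test_function[OF ab]])
      finally show ?thesis .
    qed
    ultimately show ?thesis by (simp add: LIMSEQ_const_iff)
  qed
  have "AE x in lborel. x \<in> box c d \<longrightarrow> h x = 0" if "box c d \<subseteq> \<Omega>" for c d
  proof (rule AE_zero_if_box_integrals_zero[OF hint])
    fix a b
    show "(\<integral>x. indicator (box a b \<inter> box c d) x * h x \<partial>lborel) = 0"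
      using that unfolding box_Int_box[of a b] by (intro box0) (auto simp flip: box_Int_box)
  qed
  moreover obtain D where D: "countable D" "D \<subseteq> Pow \<Omega>" "\<And>X. X \<in> D \<Longrightarrow> \<exists>a b. X = box a b" "\<Union>D = \<Omega>"
    using open_countable_Union_open_box[OF assms(1)] by metis
  ultimately have "\<And>X. X \<in> D \<Longrightarrow> AE x in lborel. x \<in> X \<longrightarrow> h x = 0" by blast
  then have "AE x in lborel. \<forall>X\<in>D. x \<in> X \<longrightarrow> h x = 0" by (subst AE_ball_countable[OF D(1)]) blast
  then have "AE x in lebesgue. \<forall>X\<in>D. x \<in> X \<longrightarrow> h x = 0" by (rule AE_completion)
  then have "AE x in lebesgue. x \<in> \<Omega> \<longrightarrow> g x = 0"
    using gh'
  proof eventually_elim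
    case (elim x)
    show ?case
    proof
      assume x: "x \<in> \<Omega>"
      then have "h x = 0" using elim(1) D(4) by blast
      then show "g x = 0" using elim(2) x by (simp add: g0_def)
    qed
  qed
  then show ?thesis using \<Omega>(2) by (simp add: AE_restrict_space_iff)
qed

section \<open>Weak gradients\<close>

lemma Ck_lincomb:
  fixes f g :: "'a::euclidean_space \<Rightarrow> real"
  shows "Ck k f \<Longrightarrow> Ck k g \<Longrightarrow> Ck k (\<lambda>x. a * f x + b * g x)"
proof (induction k arbitrary: f g)
  case 0
  then show ?case by (auto intro!: continuous_intros)
next
  case (Suc k)
  have D: "((\<lambda>x. a * f x + b * g x) has_derivative
      (\<lambda>h. a * frechet_derivative f (at x) h + b * frechet_derivative g (at x) h)) (at x)" for x
    using Suc.prems by (auto intro!: derivative_intros simp: frechet_derivative_works)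
  have "Ck k (\<lambda>x. a * frechet_derivative f (at x) i + b * frechet_derivative g (at x) i)" if "i \<in> Basis" for i
    using Suc.prems that by (intro Suc.IH) auto
  then show ?case
    using D by (auto simp: frechet_derivative_at[OF D, symmetric] differentiable_def)
qed

lemma smooth_lincomb: "smooth f \<Longrightarrow> smooth g \<Longrightarrow> smooth (\<lambda>x. a * f x + b * g x)"
  by (simp add: smooth_def Ck_lincomb)

lemma smooth_differentiable: "smooth f \<Longrightarrow> f differentiable (at x)"
  unfolding smooth_def using Ck.simps(2)[of 0 f] by blast

lemma smooth_continuous: "smooth f \<Longrightarrow> continuous_on UNIV f"
  unfolding smooth_def using Ck.simps(1)[of f] by blast

lemma smooth_partial_continuous:
  "smooth f \<Longrightarrow> i \<in> Basis \<Longrightarrow> continuous_on UNIV (\<lambda>x. frechet_derivative f (at x) i)"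
  unfolding smooth_def using Ck.simps(2)[of 0 f] Ck.simps(1) by blast

definition classical_grad :: "('a::euclidean_space \<Rightarrow> real) \<Rightarrow> 'a \<Rightarrow> 'a" where
  "classical_grad f x = (\<Sum>i\<in>Basis. frechet_derivative f (at x) i *\<^sub>R i)"

lemma classical_grad_inner:
  assumes "smooth f" shows "classical_grad f x \<bullet> h = frechet_derivative f (at x) h"
proof -
  have lin: "bounded_linear (frechet_derivative f (at x))"
    by (rule has_derivative_bounded_linear[OF smooth_differentiable[OF assms, unfolded frechet_derivative_works]])
  interpret bl: bounded_linear "frechet_derivative f (at x)" by (rule lin)
  have "frechet_derivative f (at x) h = frechet_derivative f (at x) (\<Sum>i\<in>Basis. (h \<bullet> i) *\<^sub>R i)"
    by (simp add: euclidean_representation)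
  also have "\<dots> = (\<Sum>i\<in>Basis. (h \<bullet> i) * frechet_derivative f (at x) i)"
    by (simp add: bl.sum bl.scaleR)
  also have "\<dots> = classical_grad f x \<bullet> h"
    unfolding classical_grad_def inner_sum_left inner_scaleR_left
    by (simp add: inner_commute mult.commute)
  finally show ?thesis by simp
qed

lemma classical_grad_has_derivative:
  "smooth f \<Longrightarrow> (f has_derivative (\<lambda>h. classical_grad f x \<bullet> h)) (at x)"
  using smooth_differentiable[of f x] by (simp add: classical_grad_inner frechet_derivative_works)

lemma classical_grad_continuous: "smooth f \<Longrightarrow> continuous_on UNIV (classical_grad f)"
  unfolding classical_grad_def[abs_def] by (intro continuous_intros smooth_partial_continuous)

lemma classical_grad_line_derivative:
  assumes "smooth f"
  shows "((\<lambda>t. f (x + t *\<^sub>R v)) has_real_derivative (classical_grad f (x + t *\<^sub>R v) \<bullet> v)) (at t)"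
proof -
  have "((\<lambda>t. x + t *\<^sub>R v) has_derivative (\<lambda>s. s *\<^sub>R v)) (at t)"
    by (auto intro!: derivative_eq_intros)
  from has_derivative_compose[OF this classical_grad_has_derivative[OF assms]]
  show ?thesis by (simp add: has_field_derivative_def mult.commute[of _ "classical_grad f (x + t *\<^sub>R v) \<bullet> v"])
qed

text \<open>The integral of each difference quotient of \<open>F\<close> is zero by translation invariance of Lebesgue
  measure, and the quotients converge to \<open>F'\<close> dominatedly.\<close>

lemma integral_partial_derivative_zero:
  fixes F :: "'a::euclidean_space \<Rightarrow> real" and b :: 'a
  assumes D: "\<And>x t. ((\<lambda>t. F (x + t *\<^sub>R b)) has_real_derivative F' (x + t *\<^sub>R b)) (at t)"
    and cont: "continuous_on UNIV F" "continuous_on UNIV F'"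
    and supp: "\<And>x. x \<notin> cball 0 R \<Longrightarrow> F x = 0 \<and> F' x = 0" and b: "norm b = 1"
  shows "(\<integral>x. F' x \<partial>lborel) = 0"
proof -
  have [measurable]: "F \<in> borel_measurable borel" "F' \<in> borel_measurable borel"
    using cont by (auto intro: borel_measurable_continuous_onI)
  have "bounded (F' ` cball 0 R)"
    by (intro compact_imp_bounded compact_continuous_image continuous_on_subset[OF cont(2)]) auto
  then obtain B where B: "B > 0" "\<And>x. x \<in> cball 0 R \<Longrightarrow> \<bar>F' x\<bar> \<le> B"
    unfolding bounded_pos by auto
  have B': "\<bar>F' x\<bar> \<le> B" for x using B supp[of x] by (cases "x \<in> cball 0 R") auto
  define h where "h n = 1 / real (Suc n)" for n
  have h: "0 < h n" "h n \<le> 1" for n by (auto simp: h_def)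
  have int: "integrable lborel F"
  proof -
    have "integrable lborel (\<lambda>x. indicator (cball 0 R) x *\<^sub>R F x)"
      by (intro borel_integrable_compact continuous_on_subset[OF cont(1)]) auto
    moreover have "(\<lambda>x. indicator (cball 0 R) x *\<^sub>R F x) = F"
      using supp by (auto simp: fun_eq_iff indicator_def)
    ultimately show ?thesis by simp
  qed
  have shift: "integrable lborel (\<lambda>x. F (x + c))" "(\<integral>x. F (x + c) \<partial>lborel) = (\<integral>x. F x \<partial>lborel)" for c
  proof -
    have "integrable (distr lborel borel ((+) c)) F" using int by (simp add: lborel_distr_plus)
    then show "integrable lborel (\<lambda>x. F (x + c))" by (simp add: integrable_distr_eq add.commute)
    have "(\<integral>x. F x \<partial>lborel) = (\<integral>x. F x \<partial>distr lborel borel ((+) c))" by (simp add: lborel_distr_plus)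
    then show "(\<integral>x. F (x + c) \<partial>lborel) = (\<integral>x. F x \<partial>lborel)" by (simp add: integral_distr add.commute)
  qed
  define q where "q n x = (F (x + h n *\<^sub>R b) - F x) / h n" for n x
  have "(\<lambda>n. \<integral>x. q n x \<partial>lborel) \<longlonglongrightarrow> (\<integral>x. F' x \<partial>lborel)"
  proof (rule integral_dominated_convergence[where w = "\<lambda>x. indicator (cball 0 (R + 1)) x * B"])
    show "integrable lborel (\<lambda>x. indicator (cball 0 (R + 1)) x * B)"
      using emeasure_bounded_finite[OF bounded_cball, of 0 "R + 1"]
      by (intro integrable_mult_left integrable_real_indicator) simp_all
    show "AE x in lborel. (\<lambda>n. q n x) \<longlonglongrightarrow> F' x"
    proof (rule AE_I2)
      fix x
      have "(\<lambda>s. (F (x + (0 + s) *\<^sub>R b) - F (x + 0 *\<^sub>R b)) / s) \<midarrow>0\<rightarrow> F' (x + 0 *\<^sub>R b)"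
        using D[of x 0] unfolding DERIV_def .
      moreover have "filterlim h (at 0) sequentially"
      proof (rule filterlim_atI)
        show "h \<longlonglongrightarrow> 0" unfolding h_def[abs_def] by (rule LIMSEQ_Suc[OF lim_1_over_n])
        have "h n \<noteq> 0" for n using h(1)[of n] by simp
        then show "eventually (\<lambda>n. h n \<noteq> 0) sequentially" by simp
      qed
      ultimately have "(\<lambda>n. (F (x + (0 + h n) *\<^sub>R b) - F (x + 0 *\<^sub>R b)) / h n) \<longlonglongrightarrow> F' (x + 0 *\<^sub>R b)"
        by (rule filterlim_compose)
      then show "(\<lambda>n. q n x) \<longlonglongrightarrow> F' x" by (simp add: q_def)
    qed
    show "AE x in lborel. norm (q n x) \<le> indicator (cball 0 (R + 1)) x * B" for n
    proof (rule AE_I2)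
      fix x
      show "norm (q n x) \<le> indicator (cball 0 (R + 1)) x * B"
      proof (cases "x \<in> cball 0 (R + 1)")
        case True
        obtain s where "F (x + h n *\<^sub>R b) - F (x + 0 *\<^sub>R b) = (h n - 0) * F' (x + s *\<^sub>R b)"
          using MVT2[of 0 "h n" "\<lambda>t. F (x + t *\<^sub>R b)" "\<lambda>t. F' (x + t *\<^sub>R b)"] h(1)[of n] D by auto
        then have "q n x = F' (x + s *\<^sub>R b)" using h(1)[of n] by (simp add: q_def)
        then show ?thesis using True B' by simp
      next
        case False
        then have "norm x > R + 1" by simp
        moreover have "norm x \<le> norm (x + h n *\<^sub>R b) + norm (h n *\<^sub>R b)"
          using norm_triangle_ineq4[of "x + h n *\<^sub>R b" "h n *\<^sub>R b"] by simp
        moreover have "norm (h n *\<^sub>R b) \<le> 1" using h[of n] b by simp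
        ultimately have "x + h n *\<^sub>R b \<notin> cball 0 R" "x \<notin> cball 0 R" by auto
        then have "q n x = 0" using supp unfolding q_def by simp
        then show ?thesis using B(1) by simp
      qed
    qed
  qed (auto simp: q_def)
  moreover have "(\<integral>x. q n x \<partial>lborel) = 0" for n
    unfolding q_def by (simp add: shift int)
  ultimately show ?thesis by (simp add: LIMSEQ_const_iff)
qed

lemma integral_lebesgue_on_eq_lborel:
  fixes f :: "'a::euclidean_space \<Rightarrow> real"
  assumes "open \<Omega>" "f \<in> borel_measurable borel" "\<And>x. x \<notin> \<Omega> \<Longrightarrow> f x = 0"
  shows "(\<integral>x. f x \<partial>lebesgue_on \<Omega>) = (\<integral>x. f x \<partial>lborel)"
proof -
  have "(\<integral>x. f x \<partial>lebesgue_on \<Omega>) = (\<integral>x. indicator \<Omega> x *\<^sub>R f x \<partial>lebesgue)"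
    using assms(1) by (subst integral_restrict_space) auto
  also have "(\<lambda>x. indicator \<Omega> x *\<^sub>R f x) = f" using assms(3) by (auto simp: fun_eq_iff indicator_def)
  also have "(\<integral>x. f x \<partial>lebesgue) = (\<integral>x. f x \<partial>lborel)" using assms(2) by (simp add: integral_completion)
  finally show ?thesis .
qed

lemma test_function_zero:
  assumes "\<psi> \<in> test_functions \<Omega>" "x \<notin> \<Omega>"
  shows "\<psi> x = 0" "frechet_derivative \<psi> (at x) b = 0"
proof -
  have x: "x \<notin> closure {x. \<psi> x \<noteq> 0}" using assms by (auto simp: test_functions_def)
  then show "\<psi> x = 0" using closure_subset[of "{x. \<psi> x \<noteq> 0}"] by blast
  have "(\<psi> has_derivative (\<lambda>h. 0)) (at x)"
  proof (rule has_derivative_transform_within_open[where f = "\<lambda>x. 0"])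
    show "open (- closure {x. \<psi> x \<noteq> 0})" "x \<in> - closure {x. \<psi> x \<noteq> 0}" using x by auto
    show "\<And>x. x \<in> - closure {x. \<psi> x \<noteq> 0} \<Longrightarrow> 0 = \<psi> x"
      using closure_subset[of "{x. \<psi> x \<noteq> 0}"] by auto
  qed simp
  from fun_cong[OF frechet_derivative_at[OF this], of b] show "frechet_derivative \<psi> (at x) b = 0" by simp
qed

lemma weak_gradient_classical_grad:
  assumes "open \<Omega>" and f: "smooth f"
  shows "weak_gradient \<Omega> f (classical_grad f)"
  unfolding weak_gradient_def
proof (intro ballI)
  fix \<psi> and b :: 'a assume \<psi>: "\<psi> \<in> test_functions \<Omega>" and b: "b \<in> Basis"
  have s: "smooth \<psi>" and "compact (closure {x. \<psi> x \<noteq> 0})" using \<psi> by (auto simp: test_functions_def)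
  from compact_imp_bounded[OF this(2)]
  obtain R where "\<forall>x\<in>closure {x. \<psi> x \<noteq> 0}. norm x \<le> R" unfolding bounded_iff by blast
  then have "closure {x. \<psi> x \<noteq> 0} \<subseteq> cball 0 R" by (simp add: subset_iff)
  then have R: "\<psi> \<in> test_functions (cball 0 R)" using \<psi> by (simp add: test_functions_def)
  let ?F = "\<lambda>x. f x * \<psi> x"
  let ?F1 = "\<lambda>x. f x * frechet_derivative \<psi> (at x) b" and ?F2 = "\<lambda>x. (classical_grad f x \<bullet> b) * \<psi> x"
  have c1: "continuous_on UNIV ?F1" and c2: "continuous_on UNIV ?F2" and c: "continuous_on UNIV ?F"
    by (intro continuous_on_mult continuous_on_inner continuous_on_const smooth_continuous[OF f] smooth_continuous[OF s]
        smooth_partial_continuous[OF s b] classical_grad_continuous[OF f])+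
  have 0: "(\<integral>x. ?F1 x + ?F2 x \<partial>lborel) = 0"
  proof (rule integral_partial_derivative_zero[where F = ?F and b = b and R = R])
    fix x t
    show "((\<lambda>t. f (x + t *\<^sub>R b) * \<psi> (x + t *\<^sub>R b)) has_real_derivative
        f (x + t *\<^sub>R b) * frechet_derivative \<psi> (at (x + t *\<^sub>R b)) b
        + (classical_grad f (x + t *\<^sub>R b) \<bullet> b) * \<psi> (x + t *\<^sub>R b)) (at t)"
      using DERIV_mult[OF classical_grad_line_derivative[OF f, where x = x and v = b and t = t]
          classical_grad_line_derivative[OF s, where x = x and v = b and t = t]]
      by (simp add: classical_grad_inner[OF s] mult.commute add.commute)
  next
    show "continuous_on UNIV ?F" by (rule c)
    show "continuous_on UNIV (\<lambda>x. ?F1 x + ?F2 x)" by (intro continuous_on_add c1 c2)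
    show "norm b = 1" using b by simp
    show "\<And>x. x \<notin> cball 0 R \<Longrightarrow> ?F x = 0 \<and> ?F1 x + ?F2 x = 0"
      using test_function_zero[OF R] by simp
  qed
  have int: "integrable lborel g" if "continuous_on UNIV g" "\<And>x. x \<notin> cball 0 R \<Longrightarrow> g x = 0" for g :: "'a \<Rightarrow> real"
  proof -
    have "integrable lborel (\<lambda>x. indicator (cball 0 R) x *\<^sub>R g x)"
      by (intro borel_integrable_compact continuous_on_subset[OF that(1)]) auto
    moreover have "(\<lambda>x. indicator (cball 0 R) x *\<^sub>R g x) = g"
      using that(2) by (auto simp: fun_eq_iff indicator_def)
    ultimately show ?thesis by simp
  qed
  have "(\<integral>x. ?F1 x \<partial>lborel) + (\<integral>x. ?F2 x \<partial>lborel) = 0"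
    using 0 by (subst (asm) Bochner_Integration.integral_add) (auto intro!: int c1 c2 test_function_zero[OF R])
  moreover have "(\<integral>x. ?F1 x \<partial>lebesgue_on \<Omega>) = (\<integral>x. ?F1 x \<partial>lborel)" "(\<integral>x. ?F2 x \<partial>lebesgue_on \<Omega>) = (\<integral>x. ?F2 x \<partial>lborel)"
    using c1 c2 by (auto intro!: integral_lebesgue_on_eq_lborel assms(1) borel_measurable_continuous_onI
        test_function_zero[OF \<psi>])
  ultimately show "(\<integral>x. ?F1 x \<partial>lebesgue_on \<Omega>) = - (\<integral>x. ?F2 x \<partial>lebesgue_on \<Omega>)" by linarith
qed

locale bounded_open =
  fixes \<Omega> :: "'a::euclidean_space set"
  assumes open_dom: "open \<Omega>" and bounded_dom: "bounded \<Omega>"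
begin

abbreviation "M \<equiv> lebesgue_on \<Omega>"

lemma finite_M: "finite_measure M"
  by (intro finite_measure_lebesgue_on bounded_set_imp_lmeasurable bounded_dom) (use open_dom in auto)

lemma L2_bounded:
  fixes f :: "'a \<Rightarrow> 'b::euclidean_space"
  assumes "f \<in> borel_measurable M" "\<And>x. x \<in> \<Omega> \<Longrightarrow> norm (f x) \<le> B"
  shows "f \<in> L2 M"
proof -
  interpret finite_measure M by (rule finite_M)
  have "integrable M (\<lambda>x. (norm (f x))\<^sup>2)"
    using assms by (intro integrable_const_bound[where B = "B\<^sup>2"]) (auto intro!: power_mono)
  then show ?thesis using assms by (simp add: L2_def)
qed

lemma L2_continuous:
  fixes f :: "'a \<Rightarrow> 'b::euclidean_space"
  assumes "continuous_on UNIV f"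
  shows "f \<in> L2 M"
proof -
  have "bounded (f ` closure \<Omega>)"
    using bounded_dom by (intro compact_imp_bounded compact_continuous_image continuous_on_subset[OF assms]) auto
  then obtain B where "\<And>x. x \<in> closure \<Omega> \<Longrightarrow> norm (f x) \<le> B" unfolding bounded_iff by auto
  then have "\<And>x. x \<in> \<Omega> \<Longrightarrow> norm (f x) \<le> B" using closure_subset by blast
  moreover have "f \<in> borel_measurable M"
    using borel_measurable_continuous_onI[OF assms]
    by (intro measurable_restrict_space1 measurable_completion) simp
  ultimately show ?thesis by (intro L2_bounded)
qed

lemma L2_integrable: "f \<in> L2 M \<Longrightarrow> integrable M f" for f :: "'a \<Rightarrow> real"
  using L2_inner_integrable[OF _ L2_continuous[of "\<lambda>x. 1::real"]] by simp

lemma L2_inner_Basis: "g \<in> L2 M \<Longrightarrow> (\<lambda>x. g x \<bullet> b) \<in> L2 M" for g :: "'a \<Rightarrow> 'a"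
proof -
  assume g: "g \<in> L2 M"
  note [measurable] = L2_D(1)[OF g]
  have "integrable M (\<lambda>x. (norm (g x \<bullet> b))\<^sup>2)"
  proof (rule Bochner_Integration.integrable_bound)
    show "integrable M (\<lambda>x. (norm b)\<^sup>2 * (norm (g x))\<^sup>2)" by (intro integrable_mult_right L2_D g)
    show "AE x in M. norm ((norm (g x \<bullet> b))\<^sup>2) \<le> norm ((norm b)\<^sup>2 * (norm (g x))\<^sup>2)"
    proof (rule AE_I2)
      fix x
      have "\<bar>g x \<bullet> b\<bar>\<^sup>2 \<le> (norm (g x) * norm b)\<^sup>2" by (intro power_mono Cauchy_Schwarz_ineq2) simp
      then show "norm ((norm (g x \<bullet> b))\<^sup>2) \<le> norm ((norm b)\<^sup>2 * (norm (g x))\<^sup>2)"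
        by (simp add: power_mult_distrib mult.commute)
    qed
  qed measurable
  then show ?thesis by (simp add: L2_def)
qed

lemma test_function_L2:
  assumes "\<psi> \<in> test_functions \<Omega>"
  shows "\<psi> \<in> L2 M" "b \<in> Basis \<Longrightarrow> (\<lambda>x. frechet_derivative \<psi> (at x) b) \<in> L2 M"
  using assms by (auto intro!: L2_continuous intro: smooth_continuous smooth_partial_continuous simp: test_functions_def)

lemma weak_gradient_iff:
  "weak_gradient \<Omega> u g \<longleftrightarrow> (\<forall>\<psi>\<in>test_functions \<Omega>. \<forall>b\<in>Basis.
     l2_inner M u (\<lambda>x. frechet_derivative \<psi> (at x) b) = - l2_inner M g (\<lambda>x. \<psi> x *\<^sub>R b))"
  by (simp add: weak_gradient_def l2_inner_def mult.commute)

lemma test_scaleR_L2: "\<psi> \<in> test_functions \<Omega> \<Longrightarrow> (\<lambda>x. \<psi> x *\<^sub>R b) \<in> L2 M" for b :: 'a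
  by (auto intro!: L2_continuous continuous_intros smooth_continuous simp: test_functions_def)

text \<open>The fundamental lemma is applied to each coordinate of the difference.\<close>

lemma weak_gradient_unique:
  assumes g: "g \<in> L2 M" "g' \<in> L2 M" and w: "weak_gradient \<Omega> u g" "weak_gradient \<Omega> u g'"
  shows "AE x in M. g x = g' x"
proof -
  have "AE x in M. (g x - g' x) \<bullet> b = 0" if b: "b \<in> Basis" for b
  proof (rule fundamental_lemma_variations[OF open_dom])
    have d: "(\<lambda>x. g x - g' x) \<in> L2 M" using L2_diff[OF g] by (simp add: fun_diff_def)
    then show "integrable M (\<lambda>x. (g x - g' x) \<bullet> b)" by (intro L2_integrable L2_inner_Basis)
    fix \<phi> assume \<phi>: "\<phi> \<in> test_functions \<Omega>"
    have "l2_inner M g (\<lambda>x. \<phi> x *\<^sub>R b) = l2_inner M g' (\<lambda>x. \<phi> x *\<^sub>R b)"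
      using w \<phi> b unfolding weak_gradient_iff by (metis neg_equal_iff_equal)
    then have "l2_inner M (\<lambda>x. 1 *\<^sub>R g x + (- 1) *\<^sub>R g' x) (\<lambda>x. \<phi> x *\<^sub>R b) = 0"
      by (subst L2.p_lc) (auto intro: g test_scaleR_L2 \<phi>)
    then show "(\<integral>x. ((g x - g' x) \<bullet> b) * \<phi> x \<partial>M) = 0" by (simp add: l2_inner_def mult.commute)
  qed
  then have "AE x in M. \<forall>b\<in>Basis. (g x - g' x) \<bullet> b = 0"
    by (subst AE_ball_countable) (auto intro: countable_finite)
  then show ?thesis by eventually_elim (simp add: euclidean_eq_iff[of "g _"] inner_diff_left)
qed

lemma H1_L2: "u \<in> H1 \<Omega> \<Longrightarrow> u \<in> L2 M"
  by (simp add: H1_def)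

lemma grad_props:
  assumes "u \<in> H1 \<Omega>" shows grad_L2: "grad \<Omega> u \<in> L2 M" and grad_weak: "weak_gradient \<Omega> u (grad \<Omega> u)"
proof -
  have "\<exists>g. g \<in> L2 M \<and> weak_gradient \<Omega> u g" using assms by (auto simp: H1_def)
  from someI_ex[OF this] show "grad \<Omega> u \<in> L2 M" "weak_gradient \<Omega> u (grad \<Omega> u)"
    by (auto simp: grad_def)
qed

lemma H1I:
  assumes "u \<in> L2 M" "g \<in> L2 M" "weak_gradient \<Omega> u g"
  shows "u \<in> H1 \<Omega>" "AE x in M. grad \<Omega> u x = g x"
proof -
  show u: "u \<in> H1 \<Omega>" using assms by (auto simp: H1_def)
  show "AE x in M. grad \<Omega> u x = g x"
    using assms grad_L2[OF u] grad_weak[OF u] by (intro weak_gradient_unique) auto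
qed

lemma H1_lincomb:
  assumes "u \<in> H1 \<Omega>" "v \<in> H1 \<Omega>"
  shows "(\<lambda>x. a * u x + b * v x) \<in> H1 \<Omega>"
    and "AE x in M. grad \<Omega> (\<lambda>x. a * u x + b * v x) x = a *\<^sub>R grad \<Omega> u x + b *\<^sub>R grad \<Omega> v x"
proof -
  have *: "(\<lambda>x. a * u x + b * v x) \<in> L2 M"
    using L2_lincomb[OF assms[THEN H1_L2], of a b] by simp
  have **: "(\<lambda>x. a *\<^sub>R grad \<Omega> u x + b *\<^sub>R grad \<Omega> v x) \<in> L2 M"
    by (intro L2_lincomb grad_L2 assms)
  have "weak_gradient \<Omega> (\<lambda>x. a * u x + b * v x) (\<lambda>x. a *\<^sub>R grad \<Omega> u x + b *\<^sub>R grad \<Omega> v x)"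
    unfolding weak_gradient_iff
  proof (intro ballI)
    fix \<psi> and i :: 'a assume \<psi>: "\<psi> \<in> test_functions \<Omega>" and i: "i \<in> Basis"
    have "l2_inner M (\<lambda>x. a *\<^sub>R u x + b *\<^sub>R v x) (\<lambda>x. frechet_derivative \<psi> (at x) i)
        = - l2_inner M (\<lambda>x. a *\<^sub>R grad \<Omega> u x + b *\<^sub>R grad \<Omega> v x) (\<lambda>x. \<psi> x *\<^sub>R i)"
      using \<psi> i grad_weak[OF assms(1)] grad_weak[OF assms(2)] unfolding weak_gradient_iff
      by (subst (1 2) L2.p_lc) (auto intro: H1_L2 grad_L2 assms test_function_L2 test_scaleR_L2)
    then show "l2_inner M (\<lambda>x. a * u x + b * v x) (\<lambda>x. frechet_derivative \<psi> (at x) i)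
        = - l2_inner M (\<lambda>x. a *\<^sub>R grad \<Omega> u x + b *\<^sub>R grad \<Omega> v x) (\<lambda>x. \<psi> x *\<^sub>R i)" by simp
  qed
  from H1I[OF * ** this] show "(\<lambda>x. a * u x + b * v x) \<in> H1 \<Omega>"
    "AE x in M. grad \<Omega> (\<lambda>x. a * u x + b * v x) x = a *\<^sub>R grad \<Omega> u x + b *\<^sub>R grad \<Omega> v x" by auto
qed

lemma H1_diff:
  assumes "u \<in> H1 \<Omega>" "v \<in> H1 \<Omega>"
  shows "u - v \<in> H1 \<Omega>" and "AE x in M. grad \<Omega> (u - v) x = (grad \<Omega> u - grad \<Omega> v) x"
  using H1_lincomb[OF assms, of 1 "- 1"] by (simp_all add: fun_diff_def)

lemma H1_smooth:
  assumes "smooth f" shows "f \<in> H1 \<Omega>" "AE x in M. grad \<Omega> f x = classical_grad f x"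
  using assms by (auto intro!: H1I L2_continuous smooth_continuous classical_grad_continuous
      weak_gradient_classical_grad open_dom)

text \<open>Both sides of the integration by parts formula are continuous in \<open>L\<^sup>2\<close>: weak gradients form a closed
  operator.\<close>

lemma weak_gradient_limit:
  assumes "\<And>n. u n \<in> H1 \<Omega>" "v \<in> L2 M" "g \<in> L2 M"
    and "(\<lambda>n. l2_norm M (u n - v)) \<longlonglongrightarrow> 0" "(\<lambda>n. l2_norm M (grad \<Omega> (u n) - g)) \<longlonglongrightarrow> 0"
  shows "weak_gradient \<Omega> v g"
  unfolding weak_gradient_iff
proof (intro ballI)
  fix \<psi> and i :: 'a assume \<psi>: "\<psi> \<in> test_functions \<Omega>" and i: "i \<in> Basis"
  have lim: "(\<lambda>n. l2_inner M (f n) h) \<longlonglongrightarrow> l2_inner M g h"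
    if "\<And>n. f n \<in> L2 M" "g \<in> L2 M" "h \<in> L2 M" "(\<lambda>n. l2_norm M (f n - g)) \<longlonglongrightarrow> 0"
    for f :: "nat \<Rightarrow> 'a \<Rightarrow> 'b::euclidean_space" and g h
  proof (rule LIM_zero_cancel, rule Lim_null_comparison)
    have "\<bar>l2_inner M (f n) h - l2_inner M g h\<bar> \<le> l2_norm M (f n - g) * l2_norm M h" for n
    proof -
      have "l2_inner M (\<lambda>x. 1 *\<^sub>R f n x + (- 1) *\<^sub>R g x) h = l2_inner M (f n) h - l2_inner M g h"
        by (subst L2.p_lc) (auto intro: that)
      then have "l2_inner M (f n - g) h = l2_inner M (f n) h - l2_inner M g h" by (simp add: fun_diff_def)
      then show ?thesis using l2_Cauchy_Schwarz[OF L2_diff[OF that(1,2)] that(3), of n] by simp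
    qed
    then show "\<forall>\<^sub>F n in sequentially. norm (l2_inner M (f n) h - l2_inner M g h) \<le> l2_norm M (f n - g) * l2_norm M h"
      by simp
    show "(\<lambda>n. l2_norm M (f n - g) * l2_norm M h) \<longlonglongrightarrow> 0" using tendsto_mult_left_zero[OF that(4)] .
  qed
  have "(\<lambda>n. l2_inner M (u n) (\<lambda>x. frechet_derivative \<psi> (at x) i)) \<longlonglongrightarrow> l2_inner M v (\<lambda>x. frechet_derivative \<psi> (at x) i)"
    by (intro lim H1_L2 assms test_function_L2 \<psi> i)
  moreover have "(\<lambda>n. - l2_inner M (grad \<Omega> (u n)) (\<lambda>x. \<psi> x *\<^sub>R i)) \<longlonglongrightarrow> - l2_inner M g (\<lambda>x. \<psi> x *\<^sub>R i)"
    by (intro tendsto_minus lim grad_L2 assms test_scaleR_L2 \<psi>)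
  moreover have "l2_inner M (u n) (\<lambda>x. frechet_derivative \<psi> (at x) i) = - l2_inner M (grad \<Omega> (u n)) (\<lambda>x. \<psi> x *\<^sub>R i)" for n
    using grad_weak[OF assms(1)] \<psi> i unfolding weak_gradient_iff by blast
  ultimately show "l2_inner M v (\<lambda>x. frechet_derivative \<psi> (at x) i) = - l2_inner M g (\<lambda>x. \<psi> x *\<^sub>R i)"
    using LIMSEQ_unique by fastforce
qed

end

section \<open>Sets on which the mean square is controlled by boundary values and energy\<close>

lemma nn_integral_lborel_translate:
  fixes g :: "'a::euclidean_space \<Rightarrow> ennreal"
  assumes [measurable]: "g \<in> borel_measurable borel"
  shows "(\<integral>\<^sup>+x. g (x + c) \<partial>lborel) = (\<integral>\<^sup>+x. g x \<partial>lborel)"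
proof -
  have "(\<integral>\<^sup>+x. g x \<partial>lborel) = (\<integral>\<^sup>+x. g x \<partial>distr lborel borel ((+) c))" by (simp add: lborel_distr_plus)
  also have "\<dots> = (\<integral>\<^sup>+x. g (c + x) \<partial>lborel)" by (subst nn_integral_distr) simp_all
  finally show ?thesis by (simp add: add.commute)
qed

definition sq_integral :: "'a::euclidean_space set \<Rightarrow> ('a \<Rightarrow> real) \<Rightarrow> ennreal" where
  "sq_integral A f = (\<integral>\<^sup>+x. indicator A x * ennreal ((f x)\<^sup>2) \<partial>lborel)"

text \<open>The energy is taken with the classical gradient, and as an extended real, so that the estimates
  below hold for smooth functions without integrability conditions.\<close>

definition energy :: "'a::euclidean_space set \<Rightarrow> ('a \<Rightarrow> real) \<Rightarrow> ennreal" where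
  "energy \<Omega> f = (\<integral>\<^sup>+x. indicator \<Omega> x * ennreal ((norm (classical_grad f x))\<^sup>2) \<partial>lborel)"

lemma smooth_measurable:
  assumes "smooth f" shows "f \<in> borel_measurable borel" "classical_grad f \<in> borel_measurable borel"
  using assms by (auto intro: borel_measurable_continuous_onI smooth_continuous classical_grad_continuous)

text \<open>The fundamental theorem of calculus and the Cauchy-Schwarz inequality on the segment. The half-open
  interval leaves out the end point \<open>x + t v\<close>, which may lie on the boundary of the domain.\<close>

lemma segment_increment_le:
  assumes f: "smooth f" and t: "0 \<le> t"
  shows "ennreal ((f (x + t *\<^sub>R v) - f x)\<^sup>2)
    \<le> ennreal (t * (norm v)\<^sup>2) * (\<integral>\<^sup>+s. indicator {0..<t} s * ennreal ((norm (classical_grad f (x + s *\<^sub>R v)))\<^sup>2) \<partial>lborel)"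
proof -
  note [measurable] = smooth_measurable[OF f]
  define g where "g s = classical_grad f (x + s *\<^sub>R v) \<bullet> v" for s
  let ?N = "\<lambda>s. norm (classical_grad f (x + s *\<^sub>R v))"
  have cont: "continuous_on UNIV g"
    unfolding g_def by (intro continuous_intros continuous_on_compose2[OF classical_grad_continuous[OF f]]) auto
  then have isCont: "isCont g s" for s by (simp add: continuous_on_eq_continuous_at)
  have D: "((\<lambda>s. f (x + s *\<^sub>R v)) has_real_derivative g s) (at s)" for s
    unfolding g_def by (rule classical_grad_line_derivative[OF f])
  have eq: "(\<integral>s. g s * indicator {0..t} s \<partial>lborel) = f (x + t *\<^sub>R v) - f x"
    using integral_FTC_Icc_real[OF t D isCont] by simp
  have int: "integrable lborel (\<lambda>s. g s * indicator {0..t} s)"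
    using isCont by (intro borel_integrable_atLeastAtMost)
  have "ennreal \<bar>f (x + t *\<^sub>R v) - f x\<bar> \<le> (\<integral>\<^sup>+s. ennreal (norm (g s * indicator {0..t} s)) \<partial>lborel)"
    using integral_norm_bound_ennreal[OF int] by (simp add: eq)
  also have "\<dots> \<le> (\<integral>\<^sup>+s. indicator {0..<t} s * (indicator {0..<t} s * ennreal (?N s * norm v)) \<partial>lborel)"
  proof (rule nn_integral_mono_AE)
    show "AE s in lborel. ennreal (norm (g s * indicator {0..t} s))
        \<le> indicator {0..<t} s * (indicator {0..<t} s * ennreal (?N s * norm v))"
      using AE_lborel_singleton[of t]
    proof eventually_elim
      fix s assume "s \<noteq> t"
      then show "ennreal (norm (g s * indicator {0..t} s))
        \<le> indicator {0..<t} s * (indicator {0..<t} s * ennreal (?N s * norm v))"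
        using Cauchy_Schwarz_ineq2[of "classical_grad f (x + s *\<^sub>R v)" v]
        by (auto simp: g_def indicator_def intro!: ennreal_leI)
    qed
  qed
  finally have "(ennreal \<bar>f (x + t *\<^sub>R v) - f x\<bar>)\<^sup>2
      \<le> (\<integral>\<^sup>+s. indicator {0..<t} s * (indicator {0..<t} s * ennreal (?N s * norm v)) \<partial>lborel)\<^sup>2"
    by (rule power_mono) simp
  also have "\<dots> \<le> (\<integral>\<^sup>+s. (indicator {0..<t} s)\<^sup>2 \<partial>lborel) * (\<integral>\<^sup>+s. (indicator {0..<t} s * ennreal (?N s * norm v))\<^sup>2 \<partial>lborel)"
    by (rule Cauchy_Schwarz_nn_integral) measurable
  also have "(\<integral>\<^sup>+s. (indicator {0..<t} s :: ennreal)\<^sup>2 \<partial>lborel) = (\<integral>\<^sup>+s. indicator {0..<t} s \<partial>lborel)"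
    by (intro nn_integral_cong) (auto simp: indicator_def)
  also have "\<dots> = ennreal t" using t by simp
  also have "(\<integral>\<^sup>+s. (indicator {0..<t} s * ennreal (?N s * norm v))\<^sup>2 \<partial>lborel)
      = (\<integral>\<^sup>+s. ennreal ((norm v)\<^sup>2) * (indicator {0..<t} s * ennreal ((?N s)\<^sup>2)) \<partial>lborel)"
    by (intro nn_integral_cong) (auto simp: indicator_def ennreal_power power_mult_distrib ennreal_mult mult.commute)
  also have "\<dots> = ennreal ((norm v)\<^sup>2) * (\<integral>\<^sup>+s. indicator {0..<t} s * ennreal ((?N s)\<^sup>2) \<partial>lborel)"
    by (rule nn_integral_cmult) measurable
  finally show ?thesis
    using t by (simp add: ennreal_power ennreal_mult mult.assoc)
qed

text \<open>The engine of all geometric estimates. Each increment is bounded by the energy along its segment;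
  after exchanging the integrals over \<open>x\<close> and over the segment parameter \<open>s\<close>, translation invariance
  bounds the inner integral by the full energy for every \<open>s\<close>. The length \<open>\<tau> x\<close> may vary with \<open>x\<close>, and
  the end point \<open>x + \<tau> x v\<close> may lie on the boundary of \<open>\<Omega>\<close>.\<close>

lemma increment_integral_le:
  assumes f: "smooth f" and [measurable]: "A \<in> sets borel" "\<Omega> \<in> sets borel" "\<tau> \<in> borel_measurable borel"
    and \<tau>: "\<And>x. x \<in> A \<Longrightarrow> 0 \<le> \<tau> x \<and> \<tau> x \<le> H"
    and seg: "\<And>x s. x \<in> A \<Longrightarrow> 0 \<le> s \<Longrightarrow> s < \<tau> x \<Longrightarrow> x + s *\<^sub>R v \<in> \<Omega>" and H: "0 \<le> H"
  shows "sq_integral A (\<lambda>x. f (x + \<tau> x *\<^sub>R v) - f x) \<le> ennreal (H\<^sup>2 * (norm v)\<^sup>2) * energy \<Omega> f"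
proof -
  note [measurable] = smooth_measurable[OF f]
  let ?G = "\<lambda>x. ennreal ((norm (classical_grad f x))\<^sup>2)"
  define K where "K x s = (if x \<in> A \<and> 0 \<le> s \<and> s < \<tau> x then ?G (x + s *\<^sub>R v) else 0)" for x s
  have [measurable]: "case_prod K \<in> borel_measurable (lborel \<Otimes>\<^sub>M lborel)"
    unfolding K_def[abs_def] by measurable
  have "sq_integral A (\<lambda>x. f (x + \<tau> x *\<^sub>R v) - f x)
      \<le> (\<integral>\<^sup>+x. ennreal (H * (norm v)\<^sup>2) * (\<integral>\<^sup>+s. K x s \<partial>lborel) \<partial>lborel)"
    unfolding sq_integral_def
  proof (rule nn_integral_mono)
    fix x
    show "indicator A x * ennreal ((f (x + \<tau> x *\<^sub>R v) - f x)\<^sup>2) \<le> ennreal (H * (norm v)\<^sup>2) * (\<integral>\<^sup>+s. K x s \<partial>lborel)"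
    proof (cases "x \<in> A")
      case True
      have "ennreal ((f (x + \<tau> x *\<^sub>R v) - f x)\<^sup>2) \<le> ennreal (\<tau> x * (norm v)\<^sup>2) * (\<integral>\<^sup>+s. indicator {0..<\<tau> x} s * ?G (x + s *\<^sub>R v) \<partial>lborel)"
        using \<tau>[OF True] by (intro segment_increment_le f) auto
      also have "(\<integral>\<^sup>+s. indicator {0..<\<tau> x} s * ?G (x + s *\<^sub>R v) \<partial>lborel) = (\<integral>\<^sup>+s. K x s \<partial>lborel)"
        using True by (intro nn_integral_cong) (auto simp: K_def indicator_def)
      also have "ennreal (\<tau> x * (norm v)\<^sup>2) * \<dots> \<le> ennreal (H * (norm v)\<^sup>2) * \<dots>"
        using \<tau>[OF True] by (intro mult_right_mono ennreal_leI) auto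
      finally show ?thesis using True by simp
    qed simp
  qed
  also have "\<dots> = ennreal (H * (norm v)\<^sup>2) * (\<integral>\<^sup>+x. \<integral>\<^sup>+s. K x s \<partial>lborel \<partial>lborel)"
    by (rule nn_integral_cmult) measurable
  finally have 1: "sq_integral A (\<lambda>x. f (x + \<tau> x *\<^sub>R v) - f x)
      \<le> ennreal (H * (norm v)\<^sup>2) * (\<integral>\<^sup>+x. \<integral>\<^sup>+s. K x s \<partial>lborel \<partial>lborel)" .
  have "(\<integral>\<^sup>+x. \<integral>\<^sup>+s. K x s \<partial>lborel \<partial>lborel) = (\<integral>\<^sup>+s. \<integral>\<^sup>+x. K x s \<partial>lborel \<partial>lborel)"
    by (rule lborel_pair.Fubini'[symmetric]) measurable
  also have "\<dots> \<le> (\<integral>\<^sup>+s. energy \<Omega> f * indicator {0..H} s \<partial>lborel)"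
  proof (rule nn_integral_mono)
    fix s :: real
    show "(\<integral>\<^sup>+x. K x s \<partial>lborel) \<le> energy \<Omega> f * indicator {0..H} s"
    proof (cases "s \<in> {0..H}")
      case True
      have "(\<integral>\<^sup>+x. K x s \<partial>lborel) \<le> (\<integral>\<^sup>+x. indicator \<Omega> (x + s *\<^sub>R v) * ?G (x + s *\<^sub>R v) \<partial>lborel)"
        using seg by (intro nn_integral_mono) (auto simp: K_def)
      also have "\<dots> = energy \<Omega> f"
        unfolding energy_def by (rule nn_integral_lborel_translate) measurable
      finally show ?thesis using True by simp
    next
      case False
      have "K x s = 0" for x using False \<tau>[of x] by (auto simp: K_def)
      then show ?thesis by simp
    qed
  qed
  also have "\<dots> = energy \<Omega> f * ennreal H"
    using H by (subst nn_integral_cmult_indicator) auto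
  finally have "ennreal (H * (norm v)\<^sup>2) * (\<integral>\<^sup>+x. \<integral>\<^sup>+s. K x s \<partial>lborel \<partial>lborel)
      \<le> ennreal (H * (norm v)\<^sup>2) * (energy \<Omega> f * ennreal H)"
    by (rule mult_left_mono) simp
  also have "\<dots> = ennreal (H\<^sup>2 * (norm v)\<^sup>2) * energy \<Omega> f"
    using H by (simp add: ennreal_mult mult_ac power2_eq_square)
  finally show ?thesis using 1 by (rule order_trans[rotated])
qed

lemma sq_integral_mono: "A \<subseteq> B \<Longrightarrow> sq_integral A f \<le> sq_integral B f"
  unfolding sq_integral_def by (intro nn_integral_mono mult_right_mono) (auto simp: indicator_def)

lemma ennreal_sq_le: "ennreal (a\<^sup>2) \<le> 2 * ennreal (b\<^sup>2) + 2 * ennreal ((b - a)\<^sup>2)"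
proof -
  have "0 \<le> (2 * b - a)\<^sup>2" by simp
  then have "a\<^sup>2 \<le> 2 * b\<^sup>2 + 2 * (b - a)\<^sup>2" by (simp add: power2_eq_square algebra_simps)
  then have "ennreal (a\<^sup>2) \<le> ennreal (2 * b\<^sup>2 + 2 * (b - a)\<^sup>2)" by (rule ennreal_leI)
  then show ?thesis by (simp add: ennreal_plus ennreal_mult)
qed

lemma sq_integral_le_increment:
  assumes f: "smooth f" and [measurable]: "A \<in> sets borel" "\<rho> \<in> borel_measurable borel"
  shows "sq_integral A f \<le> 2 * sq_integral A (\<lambda>x. f (\<rho> x)) + 2 * sq_integral A (\<lambda>x. f (\<rho> x) - f x)"
proof -
  note [measurable] = smooth_measurable[OF f]
  have "sq_integral A f \<le> (\<integral>\<^sup>+x. 2 * (indicator A x * ennreal ((f (\<rho> x))\<^sup>2)) + 2 * (indicator A x * ennreal ((f (\<rho> x) - f x)\<^sup>2)) \<partial>lborel)"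
    unfolding sq_integral_def by (intro nn_integral_mono) (auto simp: indicator_def ennreal_sq_le)
  also have "\<dots> = 2 * sq_integral A (\<lambda>x. f (\<rho> x)) + 2 * sq_integral A (\<lambda>x. f (\<rho> x) - f x)"
    unfolding sq_integral_def by (subst nn_integral_add) (simp_all add: nn_integral_cmult)
  finally show ?thesis .
qed

text \<open>The constant may depend on the set \<open>A\<close> but not on \<open>f\<close>; the functional \<open>\<Phi>\<close> will be the mean square of
  \<open>f\<close> on a piece of the boundary. The Friedrichs inequality amounts to \<open>\<Omega>\<close> itself being controlled.\<close>

definition controlled :: "'a::euclidean_space set \<Rightarrow> (('a \<Rightarrow> real) \<Rightarrow> ennreal) \<Rightarrow> 'a set \<Rightarrow> bool" where
  "controlled \<Omega> \<Phi> A \<longleftrightarrow> A \<in> sets borel \<and>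
     (\<exists>C<\<infinity>. \<forall>f. smooth f \<longrightarrow> sq_integral A f \<le> C * (\<Phi> f + energy \<Omega> f))"

lemma controlledI:
  assumes "A \<in> sets borel" "C < \<infinity>" "\<And>f. smooth f \<Longrightarrow> sq_integral A f \<le> C * (\<Phi> f + energy \<Omega> f)"
  shows "controlled \<Omega> \<Phi> A"
  using assms unfolding controlled_def by blast

lemma controlledE:
  assumes "controlled \<Omega> \<Phi> A"
  obtains C where "A \<in> sets borel" "C < \<infinity>" "\<And>f. smooth f \<Longrightarrow> sq_integral A f \<le> C * (\<Phi> f + energy \<Omega> f)"
  using assms unfolding controlled_def by blast

lemma controlled_subset: "controlled \<Omega> \<Phi> A \<Longrightarrow> B \<in> sets borel \<Longrightarrow> B \<subseteq> A \<Longrightarrow> controlled \<Omega> \<Phi> B"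
  unfolding controlled_def using sq_integral_mono order_trans by blast

lemma controlled_empty: "controlled \<Omega> \<Phi> {}"
  by (rule controlledI[of _ 0]) (auto simp: sq_integral_def)

lemma controlled_Un:
  assumes "controlled \<Omega> \<Phi> A" "controlled \<Omega> \<Phi> B" shows "controlled \<Omega> \<Phi> (A \<union> B)"
proof -
  obtain C where C: "A \<in> sets borel" "C < \<infinity>" "\<And>f. smooth f \<Longrightarrow> sq_integral A f \<le> C * (\<Phi> f + energy \<Omega> f)"
    by (rule controlledE[OF assms(1)]) blast
  obtain D where D: "B \<in> sets borel" "D < \<infinity>" "\<And>f. smooth f \<Longrightarrow> sq_integral B f \<le> D * (\<Phi> f + energy \<Omega> f)"
    by (rule controlledE[OF assms(2)]) blast
  note [measurable] = C(1) D(1)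
  show ?thesis
  proof (rule controlledI)
    show "A \<union> B \<in> sets borel" by simp
    show "C + D < \<infinity>" using C D by simp
    fix f :: "'a \<Rightarrow> real" assume f: "smooth f"
    note [measurable] = smooth_measurable[OF f]
    have "sq_integral (A \<union> B) f \<le> (\<integral>\<^sup>+x. indicator A x * ennreal ((f x)\<^sup>2) + indicator B x * ennreal ((f x)\<^sup>2) \<partial>lborel)"
      unfolding sq_integral_def by (intro nn_integral_mono) (auto simp: indicator_def)
    also have "\<dots> = sq_integral A f + sq_integral B f"
      unfolding sq_integral_def by (rule nn_integral_add) measurable
    also have "\<dots> \<le> C * (\<Phi> f + energy \<Omega> f) + D * (\<Phi> f + energy \<Omega> f)"
      using C(3)[OF f] D(3)[OF f] by (rule add_mono)
    also have "\<dots> = (C + D) * (\<Phi> f + energy \<Omega> f)" by (simp add: distrib_right)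
    finally show "sq_integral (A \<union> B) f \<le> (C + D) * (\<Phi> f + energy \<Omega> f)" .
  qed
qed

lemma controlled_UN: "finite I \<Longrightarrow> (\<And>i. i \<in> I \<Longrightarrow> controlled \<Omega> \<Phi> (A i)) \<Longrightarrow> controlled \<Omega> \<Phi> (\<Union>i\<in>I. A i)"
  by (induction rule: finite_induct) (auto intro: controlled_Un controlled_empty)

lemma controlled_translate:
  assumes A: "controlled \<Omega> \<Phi> A" and [measurable]: "B \<in> sets borel" "\<Omega> \<in> sets borel"
    and BA: "\<And>x. x \<in> B \<Longrightarrow> x + v \<in> A" and seg: "\<And>x s. x \<in> B \<Longrightarrow> 0 \<le> s \<Longrightarrow> s < 1 \<Longrightarrow> x + s *\<^sub>R v \<in> \<Omega>"
  shows "controlled \<Omega> \<Phi> B"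
proof -
  obtain C where C: "A \<in> sets borel" "C < \<infinity>" "\<And>f. smooth f \<Longrightarrow> sq_integral A f \<le> C * (\<Phi> f + energy \<Omega> f)"
    by (rule controlledE[OF A]) blast
  note [measurable] = C(1)
  show ?thesis
  proof (rule controlledI)
    show "B \<in> sets borel" by simp
    show "2 * C + 2 * ennreal ((norm v)\<^sup>2) < \<infinity>" using C(2) by (simp add: ennreal_mult_less_top)
    fix f :: "'a \<Rightarrow> real" assume f: "smooth f"
    note [measurable] = smooth_measurable[OF f]
    have "sq_integral B (\<lambda>x. f (x + v)) \<le> (\<integral>\<^sup>+x. indicator A (x + v) * ennreal ((f (x + v))\<^sup>2) \<partial>lborel)"
      unfolding sq_integral_def using BA by (intro nn_integral_mono) (auto simp: indicator_def)
    also have "\<dots> = sq_integral A f"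
      unfolding sq_integral_def by (rule nn_integral_lborel_translate) measurable
    also have "\<dots> \<le> C * (\<Phi> f + energy \<Omega> f)" by (rule C(3)[OF f])
    finally have 1: "sq_integral B (\<lambda>x. f (x + v)) \<le> C * (\<Phi> f + energy \<Omega> f)" .
    have "sq_integral B (\<lambda>x. f (x + 1 *\<^sub>R v) - f x) \<le> ennreal (1\<^sup>2 * (norm v)\<^sup>2) * energy \<Omega> f"
      using seg by (intro increment_integral_le[where \<tau> = "\<lambda>x. 1"] f) auto
    then have 2: "sq_integral B (\<lambda>x. f (x + v) - f x) \<le> ennreal ((norm v)\<^sup>2) * (\<Phi> f + energy \<Omega> f)"
      by (auto elim!: order_trans intro!: mult_left_mono)
    have "sq_integral B f \<le> 2 * sq_integral B (\<lambda>x. f (x + v)) + 2 * sq_integral B (\<lambda>x. f (x + v) - f x)"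
      by (rule sq_integral_le_increment[OF f]) measurable
    also have "\<dots> \<le> 2 * (C * (\<Phi> f + energy \<Omega> f)) + 2 * (ennreal ((norm v)\<^sup>2) * (\<Phi> f + energy \<Omega> f))"
      using 1 2 by (intro add_mono mult_left_mono) auto
    also have "\<dots> = (2 * C + 2 * ennreal ((norm v)\<^sup>2)) * (\<Phi> f + energy \<Omega> f)"
      by (simp add: distrib_right mult.assoc)
    finally show "sq_integral B f \<le> (2 * C + 2 * ennreal ((norm v)\<^sup>2)) * (\<Phi> f + energy \<Omega> f)" .
  qed
qed

text \<open>Averaging \<open>(f x)\<^sup>2 \<le> 2 (f y)\<^sup>2 + 2 (f y - f x)\<^sup>2\<close> over \<open>x\<close> in the ball and \<open>y\<close> in \<open>A\<close> reduces the claim to a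
  double integral of squared increments. With \<open>h = y - x\<close> it becomes an integral over \<open>h\<close> of increments
  by a fixed vector, whose segments stay in the ball by convexity.\<close>

lemma controlled_ball:
  assumes A: "controlled \<Omega> \<Phi> A" and pos: "emeasure lborel (A \<inter> ball c r) > 0"
    and ball: "ball c r \<subseteq> \<Omega>" and [measurable]: "\<Omega> \<in> sets borel"
  shows "controlled \<Omega> \<Phi> (ball c r)"
proof -
  let ?B = "ball c r" and ?A = "A \<inter> ball c r"
  have [measurable]: "A \<in> sets borel" "?B \<in> sets borel" using A by (simp_all add: controlled_def)
  then have A': "controlled \<Omega> \<Phi> ?A" by (intro controlled_subset[OF A]) auto
  obtain C where C: "?A \<in> sets borel" "C < \<infinity>" "\<And>f. smooth f \<Longrightarrow> sq_integral ?A f \<le> C * (\<Phi> f + energy \<Omega> f)"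
    by (rule controlledE[OF A']) blast
  note [measurable] = C(1)
  define a where "a = emeasure lborel ?A"
  define b where "b = emeasure lborel ?B"
  have b: "b < \<infinity>" unfolding b_def by (intro emeasure_bounded_finite) auto
  have "a \<le> b" unfolding a_def b_def by (intro emeasure_mono) auto
  then have a: "a \<noteq> 0" "a < \<infinity>" using pos b by (auto simp: a_def)
  define e where "e = emeasure lborel (ball (0::'a) (2 * r))"
  have e: "e < \<infinity>" unfolding e_def by (intro emeasure_bounded_finite) auto
  (* Bounds emeasure A times the mean square over the ball: first the values on A, then the increments. *)
  define Q where "Q = 2 * b * C + 2 * (ennreal ((2 * r)\<^sup>2) * e)"
  have Q: "Q < \<infinity>" unfolding Q_def using b C(2) e by (simp add: ennreal_mult_less_top)
  show ?thesis
  proof (rule controlledI)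
    show "?B \<in> sets borel" by simp
    show "Q / a < \<infinity>" using Q a by (auto simp: ennreal_divide_eq_top_iff less_top[symmetric])
    fix f :: "'a \<Rightarrow> real" assume f: "smooth f"
    note [measurable] = smooth_measurable[OF f]
    define W where "W = \<Phi> f + energy \<Omega> f"
    have EW: "energy \<Omega> f \<le> W" by (simp add: W_def)
    let ?\<chi> = "\<lambda>x y. indicator ?B x * indicator ?A y :: ennreal"
    define P where "P x y = ?\<chi> x y * ennreal ((f y)\<^sup>2)" for x y
    define R where "R x y = ?\<chi> x y * ennreal ((f y - f x)\<^sup>2)" for x y
    have [measurable]: "case_prod P \<in> borel_measurable (lborel \<Otimes>\<^sub>M lborel)"
      "case_prod R \<in> borel_measurable (lborel \<Otimes>\<^sub>M lborel)"
      unfolding P_def[abs_def] R_def[abs_def] by measurable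
    have "a * sq_integral ?B f = (\<integral>\<^sup>+x. \<integral>\<^sup>+y. ?\<chi> x y * ennreal ((f x)\<^sup>2) \<partial>lborel \<partial>lborel)"
    proof -
      have "(\<integral>\<^sup>+y. ?\<chi> x y * ennreal ((f x)\<^sup>2) \<partial>lborel) = a * (indicator ?B x * ennreal ((f x)\<^sup>2))" for x
      proof -
        have "(\<integral>\<^sup>+y. ?\<chi> x y * ennreal ((f x)\<^sup>2) \<partial>lborel) = (\<integral>\<^sup>+y. (indicator ?B x * ennreal ((f x)\<^sup>2)) * indicator ?A y \<partial>lborel)"
          by (intro nn_integral_cong) (simp add: mult_ac)
        also have "\<dots> = (indicator ?B x * ennreal ((f x)\<^sup>2)) * a"
          unfolding a_def by (rule nn_integral_cmult_indicator) simp
        finally show ?thesis by (simp add: mult_ac)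
      qed
      then show ?thesis unfolding sq_integral_def by (simp add: nn_integral_cmult)
    qed
    also have "\<dots> \<le> (\<integral>\<^sup>+x. \<integral>\<^sup>+y. 2 * P x y + 2 * R x y \<partial>lborel \<partial>lborel)"
      by (intro nn_integral_mono) (auto simp: P_def R_def indicator_def ennreal_sq_le)
    also have "\<dots> = 2 * (\<integral>\<^sup>+x. \<integral>\<^sup>+y. P x y \<partial>lborel \<partial>lborel)
        + 2 * (\<integral>\<^sup>+x. \<integral>\<^sup>+y. R x y \<partial>lborel \<partial>lborel)"
    proof -
      have "(\<integral>\<^sup>+x. \<integral>\<^sup>+y. 2 * P x y + 2 * R x y \<partial>lborel \<partial>lborel)
          = (\<integral>\<^sup>+x. 2 * (\<integral>\<^sup>+y. P x y \<partial>lborel) + 2 * (\<integral>\<^sup>+y. R x y \<partial>lborel) \<partial>lborel)"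
        by (intro nn_integral_cong) (simp add: nn_integral_add nn_integral_cmult)
      also have "\<dots> = 2 * (\<integral>\<^sup>+x. \<integral>\<^sup>+y. P x y \<partial>lborel \<partial>lborel) + 2 * (\<integral>\<^sup>+x. \<integral>\<^sup>+y. R x y \<partial>lborel \<partial>lborel)"
        by (simp add: nn_integral_add nn_integral_cmult)
      finally show ?thesis .
    qed
    also have "(\<integral>\<^sup>+x. \<integral>\<^sup>+y. P x y \<partial>lborel \<partial>lborel) = b * sq_integral ?A f"
    proof -
      have "(\<integral>\<^sup>+y. P x y \<partial>lborel) = sq_integral ?A f * indicator ?B x" for x
        unfolding P_def sq_integral_def mult.assoc by (subst nn_integral_cmult) (simp_all add: mult.commute)
      then show ?thesis unfolding b_def by (simp add: nn_integral_cmult_indicator) (simp add: mult.commute)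
    qed
    also have "(\<integral>\<^sup>+x. \<integral>\<^sup>+y. R x y \<partial>lborel \<partial>lborel)
        \<le> ennreal ((2 * r)\<^sup>2) * e * W"
    proof -
      have "(\<integral>\<^sup>+y. R x y \<partial>lborel)
          = (\<integral>\<^sup>+h. R x (h + x) \<partial>lborel)" for x
        by (rule nn_integral_lborel_translate[of "R x" x, symmetric]) measurable
      then have "(\<integral>\<^sup>+x. \<integral>\<^sup>+y. R x y \<partial>lborel \<partial>lborel)
          = (\<integral>\<^sup>+x. \<integral>\<^sup>+h. R x (h + x) \<partial>lborel \<partial>lborel)" by simp
      also have "\<dots> = (\<integral>\<^sup>+h. \<integral>\<^sup>+x. R x (h + x) \<partial>lborel \<partial>lborel)"
        by (rule lborel_pair.Fubini'[symmetric]) measurable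
      also have "\<dots> \<le> (\<integral>\<^sup>+h. (ennreal ((2 * r)\<^sup>2) * W) * indicator (ball (0::'a) (2 * r)) h \<partial>lborel)"
      proof (rule nn_integral_mono)
        fix h :: 'a
        let ?S = "{x \<in> ?B. h + x \<in> ?A}"
        have [measurable]: "?S \<in> sets borel"
        proof -
          have "(\<lambda>x. h + x) -` ?A \<inter> space borel \<in> sets borel" by measurable
          moreover have "?S = ?B \<inter> ((\<lambda>x. h + x) -` ?A \<inter> space borel)" by auto
          ultimately show ?thesis by (metis borel_open open_ball sets.Int)
        qed
        show "(\<integral>\<^sup>+x. R x (h + x) \<partial>lborel)
            \<le> (ennreal ((2 * r)\<^sup>2) * W) * indicator (ball (0::'a) (2 * r)) h"
        proof (cases "h \<in> ball 0 (2 * r)")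
          case True
          have "(\<integral>\<^sup>+x. R x (h + x) \<partial>lborel)
              = sq_integral ?S (\<lambda>x. f (x + 1 *\<^sub>R h) - f x)"
            unfolding sq_integral_def by (intro nn_integral_cong) (auto simp: R_def indicator_def add.commute)
          also have "\<dots> \<le> ennreal (1\<^sup>2 * (norm h)\<^sup>2) * energy \<Omega> f"
          proof (rule increment_integral_le[OF f])
            fix x s assume x: "x \<in> ?S" and s: "0 \<le> s" "s < (1::real)"
            have "(1 - s) *\<^sub>R x + s *\<^sub>R (h + x) \<in> ?B"
              using x s by (intro convexD_alt[OF convex_ball]) auto
            moreover have "(1 - s) *\<^sub>R x + s *\<^sub>R (h + x) = x + s *\<^sub>R h" by (simp add: algebra_simps)
            ultimately show "x + s *\<^sub>R h \<in> \<Omega>" using ball by auto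
          qed auto
          also have "\<dots> \<le> ennreal ((2 * r)\<^sup>2) * W"
          proof -
            have "(norm h)\<^sup>2 \<le> (2 * r)\<^sup>2" using True by (intro power_mono) auto
            then show ?thesis using EW by (intro mult_mono ennreal_leI) auto
          qed
          finally show ?thesis using True by simp
        next
          case False
          have "R x (h + x) = 0" for x
          proof -
            have "\<not> (x \<in> ?B \<and> h + x \<in> ?B)"
            proof
              assume "x \<in> ?B \<and> h + x \<in> ?B"
              then have "dist c x < r" "dist c (h + x) < r" by simp_all
              moreover have "dist x (h + x) = norm h" by (simp add: dist_norm)
              ultimately have "norm h < 2 * r" using dist_triangle3[of x "h + x" c] by linarith
              then show False using False by simp
            qed
            then show ?thesis by (auto simp: R_def indicator_def)
          qed
          then show ?thesis by simp
        qed
      qed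
      also have "\<dots> = ennreal ((2 * r)\<^sup>2) * W * e"
        unfolding e_def by (rule nn_integral_cmult_indicator) simp
      finally show ?thesis by (simp add: mult_ac)
    qed
    finally have "a * sq_integral ?B f \<le> 2 * (b * sq_integral ?A f) + 2 * (ennreal ((2 * r)\<^sup>2) * e * W)"
      by (simp add: mult_left_mono)
    also have "\<dots> \<le> 2 * (b * (C * W)) + 2 * (ennreal ((2 * r)\<^sup>2) * e * W)"
      unfolding W_def using C(3)[OF f] by (intro add_mono mult_left_mono) auto
    also have "\<dots> = Q * W" by (simp add: Q_def distrib_right mult.assoc)
    finally have *: "a * sq_integral ?B f \<le> Q * W" .
    have "sq_integral ?B f = a * sq_integral ?B f / a"
      using a by (subst mult.commute, subst ennreal_mult_divide_eq) auto
    also have "\<dots> \<le> Q * W / a" using * by (rule divide_right_mono_ennreal)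
    also have "\<dots> = Q / a * W" by (simp add: divide_ennreal_def mult_ac)
    finally show "sq_integral ?B f \<le> Q / a * (\<Phi> f + energy \<Omega> f)" unfolding W_def .
  qed
qed

text \<open>The centres of controlled balls form a subset of \<open>\<Omega>\<close> that is open, relatively closed and nonempty:
  overlapping balls pass control on to each other, and some ball meets \<open>A\<close> in positive measure.\<close>

lemma controlled_compact:
  assumes \<Omega>: "open \<Omega>" "connected \<Omega>" and A: "controlled \<Omega> \<Phi> A" "A \<subseteq> \<Omega>" "emeasure lborel A > 0"
    and K: "compact K" "K \<subseteq> \<Omega>"
  shows "controlled \<Omega> \<Phi> K"
proof -
  have [measurable]: "\<Omega> \<in> sets borel" "A \<in> sets borel" using \<Omega> A by (auto simp: controlled_def)
  define G where "G = {x \<in> \<Omega>. \<exists>r>0. ball x r \<subseteq> \<Omega> \<and> controlled \<Omega> \<Phi> (ball x r)}"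
  have spread: "ball x r \<subseteq> G" if "ball x r \<subseteq> \<Omega>" "controlled \<Omega> \<Phi> (ball x r)" for x r
  proof
    fix y assume y: "y \<in> ball x r"
    have "ball y (r - dist x y) \<subseteq> ball x r" using y by (auto simp: dist_commute intro: le_less_trans[OF dist_triangle])
      (metis add.commute add_less_cancel_left dist_commute dist_triangle diff_add_cancel le_less_trans less_diff_eq)
    then have "controlled \<Omega> \<Phi> (ball y (r - dist x y))" "ball y (r - dist x y) \<subseteq> \<Omega>"
      using that controlled_subset[OF that(2)] by auto
    then show "y \<in> G" using y that(1) unfolding G_def by (auto intro!: exI[of _ "r - dist x y"])
  qed
  have oG: "open G"
    unfolding open_contains_ball
  proof
    fix x assume "x \<in> G"
    then show "\<exists>e>0. ball x e \<subseteq> G" using spread unfolding G_def by blast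
  qed
  have oC: "open (\<Omega> - G)"
    unfolding open_contains_ball
  proof
    fix x assume x: "x \<in> \<Omega> - G"
    then obtain r where r: "r > 0" "ball x r \<subseteq> \<Omega>" using \<Omega>(1) open_contains_ball by blast
    have "ball x r \<inter> G = {}"
    proof (rule ccontr)
      assume ne: "ball x r \<inter> G \<noteq> {}"
      then obtain y where y: "y \<in> ball x r" "y \<in> G" by blast
      then obtain s where s: "s > 0" "controlled \<Omega> \<Phi> (ball y s)" unfolding G_def by blast
      have "y \<in> ball y s \<inter> ball x r" using y s(1) by simp
      then have "open (ball y s \<inter> ball x r)" "ball y s \<inter> ball x r \<noteq> {}" by (blast intro: open_Int open_ball)+
      then have "\<not> negligible (ball y s \<inter> ball x r)" using open_not_negligible by blast
      then have "emeasure lborel (ball y s \<inter> ball x r) > 0"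
        by (metis \<open>open (ball y s \<inter> ball x r)\<close> borel_open negligible_iff_null_sets not_gr_zero null_sets_completionI null_setsI sets_lborel)
      from controlled_ball[OF s(2) this r(2)] have "controlled \<Omega> \<Phi> (ball x r)" by simp
      then have "x \<in> G" using x r unfolding G_def by blast
      then show False using x by blast
    qed
    then show "\<exists>e>0. ball x e \<subseteq> \<Omega> - G" using r by blast
  qed
  have "G \<noteq> {}"
  proof
    assume G0: "G = {}"
    obtain D where D: "countable D" "\<And>X. X \<in> D \<Longrightarrow> \<exists>x r. X = ball x r \<and> r > 0 \<and> ball x r \<subseteq> \<Omega>" "\<Omega> \<subseteq> \<Union>D"
    proof -
      let ?F = "{ball x r | x r. r > 0 \<and> ball x r \<subseteq> \<Omega>}"
      obtain D where D: "D \<subseteq> ?F" "countable D" "\<Union>D = \<Union>?F"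
        using Lindelof[of ?F] by auto
      have "\<Omega> \<subseteq> \<Union>?F"
      proof
        fix x assume "x \<in> \<Omega>"
        then obtain r where "r > 0" "ball x r \<subseteq> \<Omega>" using \<Omega>(1) open_contains_ball by blast
        then show "x \<in> \<Union>?F" using centre_in_ball[of x r] by blast
      qed
      moreover have "\<exists>x r. X = ball x r \<and> r > 0 \<and> ball x r \<subseteq> \<Omega>" if "X \<in> D" for X
        using D(1) that by blast
      ultimately show ?thesis using D(2,3) by (intro that[of D]) simp_all
    qed
    have "A \<inter> X \<in> null_sets lborel" if "X \<in> D" for X
    proof (rule ccontr)
      assume *: "A \<inter> X \<notin> null_sets lborel"
      obtain x r where X: "X = ball x r" "r > 0" "ball x r \<subseteq> \<Omega>" using D(2)[OF \<open>X \<in> D\<close>] by blast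
      have "A \<inter> X \<in> sets lborel" using X by simp
      with * have "emeasure lborel (A \<inter> ball x r) > 0" using X(1) by (auto simp: null_sets_def zero_less_iff_neq_zero)
      then have "controlled \<Omega> \<Phi> (ball x r)" using X by (intro controlled_ball[OF A(1)]) auto
      then have "ball x r \<subseteq> G" using X by (intro spread)
      then show False using G0 X(2) by simp
    qed
    then have "(\<Union>X\<in>D. A \<inter> X) \<in> null_sets lborel" by (intro null_sets_UN' D(1))
    moreover have "(\<Union>X\<in>D. A \<inter> X) = A" using A(2) D(3) by blast
    ultimately have "A \<in> null_sets lborel" by simp
    then show False using A(3) by (simp add: null_sets_def)
  qed
  moreover have "G \<subseteq> \<Omega>" by (auto simp: G_def)
  ultimately have "G = \<Omega>"
    using connectedD[OF \<Omega>(2) oG oC] by blast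
  then have "\<forall>x\<in>K. \<exists>r>0. controlled \<Omega> \<Phi> (ball x r)" using K(2) unfolding G_def by blast
  then obtain r where r: "\<And>x. x \<in> K \<Longrightarrow> r x > 0 \<and> controlled \<Omega> \<Phi> (ball x (r x))" by metis
  obtain F where F: "F \<subseteq> K" "finite F" "K \<subseteq> (\<Union>x\<in>F. ball x (r x))"
  proof (rule compactE_image[OF K(1), of K "\<lambda>x. ball x (r x)"])
    show "K \<subseteq> (\<Union>x\<in>K. ball x (r x))" using r by force
  qed auto
  have "controlled \<Omega> \<Phi> (\<Union>x\<in>F. ball x (r x))" using F r by (intro controlled_UN) auto
  then show ?thesis by (rule controlled_subset) (use K F in \<open>auto intro: borel_compact\<close>)
qed

section \<open>Hausdorff measure of Lipschitz boundary pieces\<close>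

text \<open>In a Lipschitz chart with axis \<open>n\<close> the function \<open>\<tau>\<close> measures the height above the graph; it increases
  at unit rate along \<open>n\<close>. Everything about the boundary is derived from such a height function,
  defined on the whole space, and the graph itself is not used again.\<close>

definition boundary_height :: "'a::euclidean_space set \<Rightarrow> 'a \<Rightarrow> real \<Rightarrow> 'a \<Rightarrow> ('a \<Rightarrow> real) \<Rightarrow> bool" where
  "boundary_height \<Omega> x0 r n \<tau> \<longleftrightarrow> 0 < r \<and> norm n = 1 \<and> (\<exists>L. L-lipschitz_on UNIV \<tau>) \<and>
     (\<forall>x t. \<tau> (x + t *\<^sub>R n) = \<tau> x + t) \<and> (\<forall>x\<in>ball x0 r. x \<in> \<Omega> \<longleftrightarrow> 0 < \<tau> x) \<and>
     (\<forall>z\<in>frontier \<Omega> \<inter> ball x0 r. \<tau> z = 0)"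

lemma boundary_heightE:
  assumes "boundary_height \<Omega> x0 r n \<tau>"
  obtains L where "r > 0" "norm n = 1" "L-lipschitz_on UNIV \<tau>" "\<And>x t. \<tau> (x + t *\<^sub>R n) = \<tau> x + t"
    "\<And>x. x \<in> ball x0 r \<Longrightarrow> x \<in> \<Omega> \<longleftrightarrow> 0 < \<tau> x"
    "\<And>z. z \<in> frontier \<Omega> \<Longrightarrow> z \<in> ball x0 r \<Longrightarrow> \<tau> z = 0"
  using assms unfolding boundary_height_def by blast

lemma lipschitz_boundary_height:
  fixes \<Omega> :: "'a::euclidean_space set"
  assumes \<Omega>: "open \<Omega>" "lipschitz_boundary \<Omega>" and x0: "x0 \<in> frontier \<Omega>"
  shows "\<exists>r n \<tau>. boundary_height \<Omega> x0 r n \<tau>"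
proof -
  obtain r n \<gamma> C where r: "r > 0" and n: "norm n = 1" and \<gamma>: "C-lipschitz_on {y. y \<bullet> n = 0} \<gamma>"
    and eq: "\<Omega> \<inter> ball x0 r = {x \<in> ball x0 r. \<gamma> (x - (x \<bullet> n) *\<^sub>R n) < x \<bullet> n}"
    using \<Omega>(2) x0 unfolding lipschitz_boundary_def by blast
  have nn: "n \<bullet> n = 1" using n by (simp add: dot_square_norm)
  define P where "P x = x - (x \<bullet> n) *\<^sub>R n" for x
  define \<tau> where "\<tau> x = x \<bullet> n - \<gamma> (P x)" for x
  have P: "P x \<in> {y. y \<bullet> n = 0}" for x by (simp add: P_def inner_diff_left nn)
  have P1: "norm (P x) \<le> norm x" for x
  proof -
    have "(norm (P x))\<^sup>2 = (norm x)\<^sup>2 - (x \<bullet> n)\<^sup>2"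
      unfolding P_def power2_norm_eq_inner by (simp add: inner_diff_left inner_diff_right nn inner_commute power2_eq_square)
    then have "(norm (P x))\<^sup>2 \<le> (norm x)\<^sup>2" by simp
    then show ?thesis by (rule power2_le_imp_le) simp
  qed
  have C: "C \<ge> 0" using \<gamma> by (rule lipschitz_on_nonneg)
  have lip: "(1 + C)-lipschitz_on UNIV \<tau>"
  proof (rule lipschitz_onI)
    fix x y
    have "\<bar>\<gamma> (P x) - \<gamma> (P y)\<bar> \<le> C * norm (P x - P y)"
      using lipschitz_onD[OF \<gamma> P P, of x y] by (simp add: dist_norm)
    also have "P x - P y = P (x - y)" by (simp add: P_def inner_diff_left algebra_simps)
    also have "C * norm \<dots> \<le> C * norm (x - y)" using C P1 by (intro mult_left_mono)
    finally have 1: "\<bar>\<gamma> (P x) - \<gamma> (P y)\<bar> \<le> C * norm (x - y)" .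
    have "\<bar>(x - y) \<bullet> n\<bar> \<le> norm (x - y) * norm n" by (rule Cauchy_Schwarz_ineq2)
    then have 2: "\<bar>x \<bullet> n - y \<bullet> n\<bar> \<le> norm (x - y)" using n by (simp add: inner_diff_left)
    show "dist (\<tau> x) (\<tau> y) \<le> (1 + C) * dist x y"
      using 1 2 by (simp add: dist_norm \<tau>_def distrib_right)
  qed (use C in simp)
  have shift: "\<tau> (x + t *\<^sub>R n) = \<tau> x + t" for x t
    by (simp add: \<tau>_def P_def inner_add_left nn algebra_simps)
  have ball: "x \<in> \<Omega> \<longleftrightarrow> 0 < \<tau> x" if "x \<in> ball x0 r" for x
  proof -
    have "x \<in> \<Omega> \<longleftrightarrow> x \<in> \<Omega> \<inter> ball x0 r" using that by simp
    also have "\<dots> \<longleftrightarrow> 0 < \<tau> x" unfolding eq using that by (simp add: \<tau>_def P_def)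
    finally show ?thesis .
  qed
  have "\<tau> z = 0" if z: "z \<in> frontier \<Omega>" "z \<in> ball x0 r" for z
  proof (rule ccontr)
    assume "\<tau> z \<noteq> 0"
    have "z \<notin> \<Omega>" using z(1) \<Omega>(1) by (simp add: frontier_def interior_open)
    then have neg: "\<tau> z < 0" using ball[OF z(2)] \<open>\<tau> z \<noteq> 0\<close> by simp
    have cont: "continuous_on UNIV \<tau>" using lip by (rule lipschitz_on_continuous_on)
    have "open ({x. \<tau> x < 0} \<inter> ball x0 r)"
      by (intro open_Int open_Collect_less cont continuous_on_const open_ball)
    moreover have "({x. \<tau> x < 0} \<inter> ball x0 r) \<inter> \<Omega> = {}" using ball by force
    ultimately have "({x. \<tau> x < 0} \<inter> ball x0 r) \<inter> closure \<Omega> = {}" by (simp add: open_Int_closure_eq_empty)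
    then show False using z neg by (auto simp: frontier_def)
  qed
  with r n lip shift ball have "boundary_height \<Omega> x0 r n \<tau>" unfolding boundary_height_def by blast
  then show ?thesis by blast
qed

definition tube :: "'a::euclidean_space \<Rightarrow> real \<Rightarrow> 'a set \<Rightarrow> 'a set" where
  "tube n h S = {z + t *\<^sub>R n | z t. z \<in> S \<and> 0 \<le> t \<and> t \<le> h}"

text \<open>A tube over a set of diameter \<open>D\<close> is covered by about \<open>h / \<rho>\<close> balls of radius \<open>2 \<rho>\<close> for every \<open>\<rho> > D\<close>;
  letting \<open>\<rho>\<close> tend to \<open>D\<close> includes the case \<open>D = 0\<close>. Taking the closure makes the tube measurable while
  staying inside the finite union of closed balls.\<close>

lemma emeasure_closure_tube_le:
  fixes n :: "'a::euclidean_space"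
  assumes n: "norm n = 1" and h: "0 < h" and A: "A \<noteq> {}" "bounded A" "diameter A \<le> h"
  shows "emeasure lborel (closure (tube n h A))
    \<le> ennreal (2 * h * unit_ball_vol (DIM('a)) * 2 ^ DIM('a) * diameter A ^ (DIM('a) - 1))"
proof -
  let ?d = "DIM('a)"
  define D where "D = diameter A"
  obtain z0 where z0: "z0 \<in> A" using A by blast
  have D0: "0 \<le> D" unfolding D_def using A(2) by (rule diameter_ge_0)
  define m where "m = emeasure lborel (closure (tube n h A))"
  have bound: "m \<le> ennreal ((h + \<rho>) * unit_ball_vol ?d * 2 ^ ?d * \<rho> ^ (?d - 1))" if \<rho>: "D < \<rho>" for \<rho>
  proof -
    have \<rho>0: "\<rho> > 0" using D0 \<rho> by simp
    define N where "N = nat \<lfloor>h / \<rho>\<rfloor>"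
    let ?B = "\<lambda>k. cball (z0 + (real k * \<rho>) *\<^sub>R n) (2 * \<rho>)"
    have "tube n h A \<subseteq> (\<Union>k\<in>{..N}. ?B k)"
    proof
      fix x assume "x \<in> tube n h A"
      then obtain z t where x: "x = z + t *\<^sub>R n" "z \<in> A" "0 \<le> t" "t \<le> h" unfolding tube_def by blast
      define k where "k = nat \<lfloor>t / \<rho>\<rfloor>"
      have "t / \<rho> \<le> h / \<rho>" using x \<rho>0 by (intro divide_right_mono) auto
      then have "k \<le> N" unfolding k_def N_def by (intro nat_mono floor_mono)
      have t0: "0 \<le> t / \<rho>" using x \<rho>0 by simp
      have "real k \<le> t / \<rho>" "t / \<rho> < real k + 1" unfolding k_def using t0 by linarith+
      then have k: "real k * \<rho> \<le> t" "t < real k * \<rho> + \<rho>" using \<rho>0 by (simp_all add: field_simps)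
      have "dist (z0 + (real k * \<rho>) *\<^sub>R n) x = norm ((z0 - z) + (real k * \<rho> - t) *\<^sub>R n)"
        by (simp add: x(1) dist_norm algebra_simps)
      also have "\<dots> \<le> norm (z0 - z) + \<bar>real k * \<rho> - t\<bar> * norm n"
        using norm_triangle_ineq[of "z0 - z" "(real k * \<rho> - t) *\<^sub>R n"] by simp
      also have "norm (z0 - z) \<le> \<rho>"
        using diameter_bounded_bound[OF A(2) z0 x(2)] \<rho> by (simp add: dist_norm D_def)
      also have "\<bar>real k * \<rho> - t\<bar> * norm n \<le> \<rho>" using k n by simp
      finally show "x \<in> (\<Union>k\<in>{..N}. ?B k)" using \<open>k \<le> N\<close> by auto
    qed
    then have "closure (tube n h A) \<subseteq> (\<Union>k\<in>{..N}. ?B k)" by (rule closure_minimal) auto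
    then have "m \<le> emeasure lborel (\<Union>k\<in>{..N}. ?B k)" unfolding m_def by (intro emeasure_mono) auto
    also have "\<dots> \<le> (\<Sum>k\<in>{..N}. emeasure lborel (?B k))" by (intro emeasure_subadditive_finite) auto
    also have "\<dots> = (\<Sum>k\<in>{..N}. ennreal (unit_ball_vol ?d * (2 * \<rho>) ^ ?d))"
      using \<rho>0 by (intro sum.cong refl emeasure_cball) auto
    also have "\<dots> = ennreal (real (N + 1) * (unit_ball_vol ?d * (2 * \<rho>) ^ ?d))"
      using \<rho>0 by (simp add: sum_constant ennreal_of_nat_eq_real_of_nat ennreal_mult' add.commute)
    also have "\<dots> \<le> ennreal ((h / \<rho> + 1) * (unit_ball_vol ?d * (2 * \<rho>) ^ ?d))"
    proof (intro ennreal_leI mult_right_mono)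
      have "0 \<le> h / \<rho>" using h \<rho>0 by simp
      then show "real (N + 1) \<le> h / \<rho> + 1" unfolding N_def by simp
    qed (use \<rho>0 in auto)
    also have "(h / \<rho> + 1) * (unit_ball_vol ?d * (2 * \<rho>) ^ ?d) = (h + \<rho>) * unit_ball_vol ?d * 2 ^ ?d * \<rho> ^ (?d - 1)"
    proof -
      have "\<rho> ^ ?d = \<rho> * \<rho> ^ (?d - 1)" using DIM_positive[where 'a='a] by (metis power_eq_if less_numeral_extra(3))
      then show ?thesis using \<rho>0 by (simp add: power_mult_distrib field_simps)
    qed
    finally show ?thesis .
  qed
  have "m \<le> ennreal ((h + D) * unit_ball_vol ?d * 2 ^ ?d * D ^ (?d - 1))"
  proof (rule tendsto_lowerbound)
    show "((\<lambda>\<rho>. ennreal ((h + \<rho>) * unit_ball_vol ?d * 2 ^ ?d * \<rho> ^ (?d - 1))) \<longlongrightarrow>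
        ennreal ((h + D) * unit_ball_vol ?d * 2 ^ ?d * D ^ (?d - 1))) (at_right D)"
      by (intro tendsto_ennrealI tendsto_intros)
    show "eventually (\<lambda>\<rho>. m \<le> ennreal ((h + \<rho>) * unit_ball_vol ?d * 2 ^ ?d * \<rho> ^ (?d - 1))) (at_right D)"
      using bound eventually_at_right_less[of D] by (auto elim: eventually_mono)
  qed simp
  also have "\<dots> \<le> ennreal (2 * h * unit_ball_vol ?d * 2 ^ ?d * D ^ (?d - 1))"
    using A(3) D0 by (intro ennreal_leI mult_right_mono) (auto simp: D_def)
  finally show ?thesis by (simp add: m_def D_def)
qed

text \<open>The tubes over the members of a covering of \<open>S\<close> by sets of diameter at most \<open>h\<close> cover the tube over
  \<open>S\<close>, and the volume of each is at most a constant times the gauge of the member.\<close>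

lemma tube_measure_le_hausdorff:
  fixes n :: "'a::euclidean_space"
  assumes n: "norm n = 1" and h: "0 < h"
  obtains C where "C < \<infinity>"
    "\<And>W S. W \<in> sets borel \<Longrightarrow> W \<subseteq> tube n h S \<Longrightarrow> emeasure lborel W \<le> C * hausdorff_outer (DIM('a) - 1) S"
proof -
  let ?d = "DIM('a)" and ?s = "DIM('a) - 1"
  define w where "w = unit_ball_vol (real ?s)"
  have w: "w > 0" by (simp add: w_def)
  define c where "c = 2 * h * unit_ball_vol ?d * 2 ^ ?d * 2 ^ ?s / w"
  have c: "c > 0" using h w by (simp add: c_def)
  have cancel: "ennreal (1 / c) * (ennreal c * x) = x" "ennreal c * (ennreal (1 / c) * x) = x" for x
    unfolding mult.assoc[symmetric] using c by (simp_all flip: ennreal_mult)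
  have "emeasure lborel W \<le> ennreal c * hausdorff_outer ?s S" if W: "W \<in> sets borel" "W \<subseteq> tube n h S" for W S
  proof -
    have gauge: "emeasure lborel (closure (tube n h A)) \<le> ennreal c * hausdorff_gauge ?s h A" for A :: "'a set"
    proof -
      consider "A = {}" | "A \<noteq> {}" "bounded A" "diameter A \<le> h" | "A \<noteq> {}" "\<not> (bounded A \<and> diameter A \<le> h)" by blast
      then show ?thesis
      proof cases
        case 1
        then show ?thesis by (simp add: tube_def)
      next
        case 2
        have "2 * h * unit_ball_vol ?d * 2 ^ ?d * diameter A ^ ?s = c * (w * (diameter A / 2) ^ ?s)"
          using w by (simp add: c_def power_divide field_simps)
        moreover have "hausdorff_gauge ?s h A = ennreal (w * (diameter A / 2) ^ ?s)"
          using 2 by (simp add: hausdorff_gauge_def w_def)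
        ultimately show ?thesis
          using emeasure_closure_tube_le[OF n h 2] c by (simp only: ennreal_mult' less_imp_le)
      next
        case 3
        have "hausdorff_gauge ?s h A = \<infinity>" unfolding hausdorff_gauge_def using 3 by (simp only: if_False)
        then have "ennreal c * hausdorff_gauge ?s h A = \<infinity>" using c by (simp add: ennreal_mult_top)
        then show ?thesis by simp
      qed
    qed
    have "emeasure lborel W \<le> ennreal c * (\<Sum>i. hausdorff_gauge ?s h (A i))"
      if A: "S \<subseteq> (\<Union>i. A i)" for A :: "nat \<Rightarrow> 'a set"
    proof -
      have "W \<subseteq> (\<Union>i. closure (tube n h (A i)))"
      proof
        fix x assume "x \<in> W"
        then obtain z t where x: "x = z + t *\<^sub>R n" "z \<in> S" "0 \<le> t" "t \<le> h" using W(2) unfolding tube_def by blast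
        then obtain i where "z \<in> A i" using A by blast
        then have "x \<in> tube n h (A i)" using x unfolding tube_def by blast
        then show "x \<in> (\<Union>i. closure (tube n h (A i)))" using closure_subset by blast
      qed
      then have "emeasure lborel W \<le> emeasure lborel (\<Union>i. closure (tube n h (A i)))"
        by (intro emeasure_mono) auto
      also have "\<dots> \<le> (\<Sum>i. emeasure lborel (closure (tube n h (A i))))"
        by (intro emeasure_subadditive_countably) auto
      also have "\<dots> \<le> (\<Sum>i. ennreal c * hausdorff_gauge ?s h (A i))" by (intro suminf_le gauge) auto
      also have "\<dots> = ennreal c * (\<Sum>i. hausdorff_gauge ?s h (A i))" by (rule ennreal_suminf_cmult)
      finally show ?thesis .
    qed
    then have "ennreal (1 / c) * emeasure lborel W \<le> ennreal (1 / c) * (ennreal c * (\<Sum>i. hausdorff_gauge ?s h (A i)))"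
      if "S \<subseteq> (\<Union>i. A i)" for A :: "nat \<Rightarrow> 'a set" using that by (intro mult_left_mono) auto
    then have "ennreal (1 / c) * emeasure lborel W \<le> outer_measure UNIV (hausdorff_gauge ?s h) S"
      unfolding outer_measure_def cancel(1) by (intro INF_greatest) auto
    then have "ennreal c * (ennreal (1 / c) * emeasure lborel W) \<le> ennreal c * outer_measure UNIV (hausdorff_gauge ?s h) S"
      by (rule mult_left_mono) simp
    also have "\<dots> \<le> ennreal c * hausdorff_outer ?s S"
      unfolding hausdorff_outer_def using h by (intro mult_left_mono SUP_upper) auto
    finally show ?thesis unfolding cancel(2) .
  qed
  then show ?thesis by (intro that[of "ennreal c"]) auto
qed

lemma cube_norm_le:
  fixes u v :: "'a::euclidean_space" and \<sigma> :: real
  assumes "\<And>i. i \<in> Basis \<Longrightarrow> v \<bullet> i - u \<bullet> i = \<sigma>" "x \<in> cbox u v" "y \<in> cbox u v"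
  shows "norm (x - y) \<le> DIM('a) * \<sigma>"
proof -
  have "norm (x - y) \<le> (\<Sum>i\<in>Basis. \<bar>(x - y) \<bullet> i\<bar>)" by (rule norm_le_l1)
  also have "\<dots> \<le> (\<Sum>i\<in>(Basis::'a set). \<sigma>)"
  proof (rule sum_mono)
    fix i :: 'a assume i: "i \<in> Basis"
    then show "\<bar>(x - y) \<bullet> i\<bar> \<le> \<sigma>" using assms(1)[OF i] assms(2,3) i by (force simp: mem_box inner_diff_left abs_le_iff)
  qed
  finally show ?thesis by simp
qed

text \<open>Cover the null set \<open>T\<close> by small cubes of total volume at most \<open>\<epsilon>\<close>. For every level \<open>t\<close> the translate of \<open>S\<close>
  by \<open>t n\<close> is covered by the cubes that it meets, which bounds the Hausdorff content of \<open>S\<close> by a multiple of the sum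
  of the \<open>(d - 1)\<close>-st powers of their side lengths. A cube of side \<open>\<sigma>\<close> meets only levels in an interval of
  length proportional to \<open>\<sigma>\<close>, because the height is Lipschitz; so integrating over \<open>t\<close> bounds \<open>h\<close> times
  the content by a multiple of the total volume \<open>\<epsilon>\<close>.\<close>

lemma hausdorff_null_if_swept_null:
  fixes n :: "'a::euclidean_space"
  assumes n: "norm n = 1" and h: "0 < h" and \<tau>: "L-lipschitz_on UNIV \<tau>" "\<And>x t. \<tau> (x + t *\<^sub>R n) = \<tau> x + t"
    and S: "\<And>z. z \<in> S \<Longrightarrow> \<tau> z = 0" and T: "\<And>z t. z \<in> S \<Longrightarrow> 0 < t \<Longrightarrow> t < h \<Longrightarrow> z + t *\<^sub>R n \<in> T"
    and null: "T \<in> null_sets lborel" and bdd: "bounded T"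
  shows "hausdorff_outer (DIM('a) - 1) S = 0"
proof -
  let ?d = "DIM('a)" and ?s = "DIM('a) - 1"
  let ?w = "unit_ball_vol (real ?s)"
  let ?O = "\<lambda>\<delta>. outer_measure UNIV (hausdorff_gauge ?s \<delta>) S"
  have L: "L \<ge> 0" using \<tau>(1) by (rule lipschitz_on_nonneg)
  (* The gauge of a set of diameter d \<sigma> times the length 2 L d \<sigma> of the interval of levels, without the powers of \<sigma>. *)
  define K where "K = ?w * (real ?d / 2) ^ ?s * (2 * L * real ?d)"
  have K: "0 \<le> K" using L by (simp add: K_def)
  have main: "ennreal h * ?O \<delta> \<le> ennreal (K * \<epsilon>)" if \<delta>: "\<delta> > 0" and \<epsilon>: "\<epsilon> > 0" for \<delta> \<epsilon>
  proof -
    obtain U where U: "open U" "T \<subseteq> U" "emeasure lborel (U - T) < ennreal \<epsilon>"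
      using outer_regular_lborel[OF null_setsD2[OF null, unfolded sets_lborel] \<epsilon>] by metis
    have Um: "emeasure lborel U \<le> ennreal \<epsilon>"
      using U null emeasure_Diff_null_set[of T lborel U] by auto
    obtain c where c: "c > 0" "\<And>x. x \<in> T \<Longrightarrow> norm x \<le> c" using bdd unfolding bounded_pos by blast
    define a where "a = - c *\<^sub>R (One::'a)"
    define b where "b = c *\<^sub>R (One::'a)"
    have Tab: "T \<subseteq> cbox a b"
    proof
      fix x assume "x \<in> T"
      then have "norm x \<le> c" by (rule c)
      then have "\<bar>x \<bullet> i\<bar> \<le> c" if "i \<in> Basis" for i using that Basis_le_norm order_trans by blast
      then show "x \<in> cbox a b" by (auto simp: a_def b_def mem_box abs_le_iff minus_le_iff)
    qed
    have ab: "box a b \<noteq> {}" using c by (auto simp: a_def b_def box_ne_empty)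
    define g where "g x = (if x \<in> U then ball x (\<delta> / 2) \<inter> U else ball x 1)" for x
    have "gauge g" using U(1) \<delta> by (auto simp: gauge_def g_def)
    from covering_lemma[OF Tab ab this] obtain \<D> where D: "countable \<D>"
      "\<And>A. A \<in> \<D> \<Longrightarrow> interior A \<noteq> {} \<and> (\<exists>u v. A = cbox u v)"
      "pairwise (\<lambda>A B. interior A \<inter> interior B = {}) \<D>"
      "\<And>A. A \<in> \<D> \<Longrightarrow> \<exists>x \<in> T \<inter> A. A \<subseteq> g x"
      "\<And>u v. cbox u v \<in> \<D> \<Longrightarrow> \<exists>k. \<forall>i \<in> Basis. v \<bullet> i - u \<bullet> i = (b \<bullet> i - a \<bullet> i) / 2 ^ k"
      "T \<subseteq> \<Union>\<D>" by metis
    (* Enumerate the cubes without repetition, so that sums over all k count every cube once. *)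
    define Q where "Q k = (if k \<in> to_nat_on \<D> ` \<D> then from_nat_into \<D> k else {})" for k
    have Q_cases: "Q k = {} \<or> Q k \<in> \<D>" for k
      by (auto simp: Q_def D(1))
    have TQ: "T \<subseteq> (\<Union>k. Q k)"
    proof
      fix x assume "x \<in> T"
      then obtain A where A: "x \<in> A" "A \<in> \<D>" using D(6) by blast
      then have "Q (to_nat_on \<D> A) = A" using D(1) by (simp add: Q_def)
      then show "x \<in> (\<Union>k. Q k)" using A by blast
    qed
    have cube: "\<exists>p \<sigma>. 0 < \<sigma> \<and> p \<in> A \<and> A \<subseteq> U \<and> (\<forall>x\<in>A. \<forall>y\<in>A. dist x y \<le> \<delta> \<and> dist x y \<le> real ?d * \<sigma>)
        \<and> emeasure lborel (interior A) = ennreal (\<sigma> ^ ?d)" if A: "A \<in> \<D>" for A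
    proof -
      obtain u v where uv: "A = cbox u v" using D(2)[OF A] by blast
      obtain k where k: "\<And>i. i \<in> Basis \<Longrightarrow> v \<bullet> i - u \<bullet> i = (b \<bullet> i - a \<bullet> i) / 2 ^ k"
        using D(5)[of u v] A uv by blast
      define \<sigma> where "\<sigma> = 2 * c / 2 ^ k"
      have \<sigma>: "v \<bullet> i - u \<bullet> i = \<sigma>" if "i \<in> Basis" for i
        using k[OF that] that by (simp add: a_def b_def \<sigma>_def)
      have \<sigma>0: "\<sigma> > 0" using c by (simp add: \<sigma>_def)
      obtain p where p: "p \<in> T" "p \<in> A" "A \<subseteq> g p" using D(4)[OF A] by blast
      have gp: "g p = ball p (\<delta> / 2) \<inter> U" using p U(2) by (auto simp: g_def)
      have "dist x y \<le> \<delta>" if "x \<in> A" "y \<in> A" for x y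
      proof -
        have "dist p x < \<delta> / 2" "dist p y < \<delta> / 2" using p(3) gp that by auto
        then show ?thesis using dist_triangle3[of x y p] by linarith
      qed
      moreover have "dist x y \<le> real ?d * \<sigma>" if "x \<in> A" "y \<in> A" for x y
        using cube_norm_le[of v u \<sigma> x y] \<sigma> that by (simp add: uv dist_norm)
      moreover have "emeasure lborel (interior A) = ennreal (\<sigma> ^ ?d)"
      proof -
        have "u \<bullet> i \<le> v \<bullet> i" if "i \<in> Basis" for i using \<sigma>[OF that] \<sigma>0 by linarith
        then have "emeasure lborel (box u v) = ennreal (\<Prod>i\<in>Basis. (v - u) \<bullet> i)"
          by (rule emeasure_lborel_box)
        also have "(\<Prod>i\<in>Basis. (v - u) \<bullet> i) = (\<Prod>i\<in>(Basis::'a set). \<sigma>)"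
          using \<sigma> by (intro prod.cong) (auto simp: inner_diff_left)
        finally show ?thesis by (simp add: uv interior_cbox)
      qed
      ultimately show ?thesis using p gp \<sigma>0 by blast
    qed
    have "\<forall>k. \<exists>p \<sigma>. 0 \<le> \<sigma> \<and> Q k \<subseteq> U \<and> (\<forall>x\<in>Q k. \<forall>y\<in>Q k. dist x y \<le> \<delta> \<and> dist x y \<le> real ?d * \<sigma>)
        \<and> emeasure lborel (interior (Q k)) = ennreal (\<sigma> ^ ?d) \<and> (Q k \<noteq> {} \<longrightarrow> p \<in> Q k)" (is "\<forall>k. ?R k")
    proof
      fix k
      show "?R k"
      proof (cases "Q k = {}")
        case True
        then show ?thesis by (intro exI[of _ 0]) (simp add: zero_power)
      next
        case False
        then have "Q k \<in> \<D>" using Q_cases by blast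
        from cube[OF this] show ?thesis by (meson less_imp_le)
      qed
    qed
    then obtain p \<sigma> where p\<sigma>: "\<And>k. 0 \<le> \<sigma> k" "\<And>k. Q k \<subseteq> U"
      "\<And>k x y. x \<in> Q k \<Longrightarrow> y \<in> Q k \<Longrightarrow> dist x y \<le> \<delta>"
      "\<And>k x y. x \<in> Q k \<Longrightarrow> y \<in> Q k \<Longrightarrow> dist x y \<le> real ?d * \<sigma> k"
      "\<And>k. emeasure lborel (interior (Q k)) = ennreal (\<sigma> k ^ ?d)" "\<And>k. Q k \<noteq> {} \<Longrightarrow> p k \<in> Q k"
      by metis
    have "disjoint_family (\<lambda>k. interior (Q k))"
      unfolding disjoint_family_on_def
    proof (intro ballI impI)
      fix j k :: nat assume jk: "j \<noteq> k"
      show "interior (Q j) \<inter> interior (Q k) = {}"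
      proof (cases "Q j = {} \<or> Q k = {}")
        case False
        then have "j \<in> to_nat_on \<D> ` \<D>" "k \<in> to_nat_on \<D> ` \<D>"
          by (metis Q_def)+
        then obtain A B where AB: "A \<in> \<D>" "B \<in> \<D>" "j = to_nat_on \<D> A" "k = to_nat_on \<D> B" by blast
        then have "Q j = A" "Q k = B" using D(1) by (simp_all add: Q_def)
        moreover have "A \<noteq> B" using jk AB by blast
        ultimately show ?thesis using D(3) AB by (auto simp: pairwise_def)
      qed auto
    qed
    then have "(\<Sum>k. emeasure lborel (interior (Q k))) = emeasure lborel (\<Union>k. interior (Q k))"
      by (intro suminf_emeasure) auto
    also have "\<dots> \<le> emeasure lborel U"
      using p\<sigma>(2) interior_subset U(1) by (intro emeasure_mono) (blast, simp)
    finally have sum: "(\<Sum>k. ennreal (\<sigma> k ^ ?d)) \<le> ennreal \<epsilon>" using Um by (simp add: p\<sigma>(5))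
    define R where "R k = L * (real ?d * \<sigma> k)" for k
    define W where "W k = ?w * (real ?d * \<sigma> k / 2) ^ ?s" for k
    have RW: "0 \<le> R k" "0 \<le> W k" for k using L p\<sigma>(1)[of k] by (simp_all add: R_def W_def)
    let ?I = "\<lambda>k. {\<tau> (p k) - R k .. \<tau> (p k) + R k}"
    (* The covering bound at the level t: the k-th term occurs only if t lies in the interval ?I k. *)
    have level: "?O \<delta> \<le> (\<Sum>k. ennreal (W k) * indicator (?I k) t)" if t: "0 < t" "t < h" for t
    proof -
      define E where "E k = {z \<in> S. z + t *\<^sub>R n \<in> Q k}" for k
      have "S \<subseteq> (\<Union>k. E k)" using T[OF _ t] TQ by (auto simp: E_def)
      then have "?O \<delta> \<le> (\<Sum>k. hausdorff_gauge ?s \<delta> (E k))"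
        by (intro ring_of_sets.outer_measure_le[OF ring_of_sets_UNIV
            hausdorff_gauge_positive hausdorff_gauge_increasing]) auto
      also have "\<dots> \<le> (\<Sum>k. ennreal (W k) * indicator (?I k) t)"
      proof (intro suminf_le)
        fix k
        show "hausdorff_gauge ?s \<delta> (E k) \<le> ennreal (W k) * indicator (?I k) t"
        proof (cases "E k = {}")
          case True
          then show ?thesis by (simp add: hausdorff_gauge_def)
        next
          case False
          then obtain z where z: "z \<in> S" "z + t *\<^sub>R n \<in> Q k" by (auto simp: E_def)
          then have pk: "p k \<in> Q k" using p\<sigma>(6) by blast
          have E1: "dist x y \<le> \<delta>" "dist x y \<le> real ?d * \<sigma> k" if "x \<in> E k" "y \<in> E k" for x y
            using that p\<sigma>(3,4)[of "x + t *\<^sub>R n" k "y + t *\<^sub>R n"] by (simp_all add: E_def)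
          have bE: "bounded (E k)" unfolding bounded_two_points using E1(1) by blast
          have dia: "diameter (E k) \<le> \<delta>" "diameter (E k) \<le> real ?d * \<sigma> k"
            using False E1 by (auto intro!: diameter_le simp: dist_norm)
          have "hausdorff_gauge ?s \<delta> (E k) = ennreal (?w * (diameter (E k) / 2) ^ ?s)"
            using False bE dia(1) by (simp add: hausdorff_gauge_def)
          also have "\<dots> \<le> ennreal (W k)"
            unfolding W_def using dia(2) diameter_ge_0[OF bE]
            by (intro ennreal_leI mult_left_mono power_mono divide_right_mono) auto
          finally have 1: "hausdorff_gauge ?s \<delta> (E k) \<le> ennreal (W k)" .
          have "\<bar>\<tau> (p k) - \<tau> (z + t *\<^sub>R n)\<bar> \<le> L * dist (p k) (z + t *\<^sub>R n)"
            using lipschitz_onD[OF \<tau>(1), of "p k" "z + t *\<^sub>R n"] by (simp add: dist_real_def)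
          also have "\<dots> \<le> R k" unfolding R_def using p\<sigma>(4)[OF pk z(2)] L by (intro mult_left_mono)
          finally have "t \<in> ?I k" using S[OF z(1)] by (auto simp: \<tau>(2) abs_le_iff)
          then show ?thesis using 1 by simp
        qed
      qed auto
      finally show ?thesis .
    qed
    have "ennreal h * ?O \<delta> = (\<integral>\<^sup>+t. ?O \<delta> * indicator {0<..<h} t \<partial>lborel)"
      using h by (subst nn_integral_cmult_indicator) (auto simp: mult.commute)
    also have "\<dots> \<le> (\<integral>\<^sup>+t. (\<Sum>k. ennreal (W k) * indicator (?I k) t) \<partial>lborel)"
      using level by (intro nn_integral_mono) (auto simp: indicator_def)
    also have "\<dots> = (\<Sum>k. \<integral>\<^sup>+t. ennreal (W k) * indicator (?I k) t \<partial>lborel)"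
      by (rule nn_integral_suminf) measurable
    also have "\<dots> = (\<Sum>k. ennreal K * ennreal (\<sigma> k ^ ?d))"
    proof (rule suminf_cong)
      fix k
      have "(\<integral>\<^sup>+t. ennreal (W k) * indicator (?I k) t \<partial>lborel) = ennreal (W k) * ennreal (2 * R k)"
        using RW[of k] by (subst nn_integral_cmult_indicator) auto
      also have "\<dots> = ennreal (W k * (2 * R k))" using RW[of k] by (simp add: ennreal_mult)
      also have "W k * (2 * R k) = K * \<sigma> k ^ ?d"
      proof -
        have "\<sigma> k ^ ?d = \<sigma> k * \<sigma> k ^ ?s" using DIM_positive[where 'a='a] by (metis power_eq_if less_numeral_extra(3))
        then show ?thesis by (simp add: W_def R_def K_def power_mult_distrib power_divide)
      qed
      finally show "(\<integral>\<^sup>+t. ennreal (W k) * indicator (?I k) t \<partial>lborel) = ennreal K * ennreal (\<sigma> k ^ ?d)"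
        using K p\<sigma>(1)[of k] by (simp add: ennreal_mult)
    qed
    also have "\<dots> = ennreal K * (\<Sum>k. ennreal (\<sigma> k ^ ?d))" by (rule ennreal_suminf_cmult)
    also have "\<dots> \<le> ennreal K * ennreal \<epsilon>" by (rule mult_left_mono[OF sum]) simp
    also have "\<dots> = ennreal (K * \<epsilon>)" using K \<epsilon> by (simp add: ennreal_mult)
    finally show ?thesis .
  qed
  have "?O \<delta> = 0" if \<delta>: "\<delta> > 0" for \<delta>
  proof (rule ccontr)
    assume nz: "?O \<delta> \<noteq> 0"
    have "ennreal h * ?O \<delta> \<le> 0"
    proof (rule tendsto_lowerbound)
      show "((\<lambda>\<epsilon>. ennreal (K * \<epsilon>)) \<longlongrightarrow> 0) (at_right 0)"
      proof -
        have "((\<lambda>\<epsilon>. ennreal (K * \<epsilon>)) \<longlongrightarrow> ennreal (K * 0)) (at_right 0)"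
          by (intro tendsto_ennrealI tendsto_intros)
        then show ?thesis by simp
      qed
      show "eventually (\<lambda>\<epsilon>. ennreal h * ?O \<delta> \<le> ennreal (K * \<epsilon>)) (at_right 0)"
        using main[OF \<delta>] eventually_at_right_less[of 0] by (auto elim: eventually_mono)
    qed simp
    then show False using nz h by simp
  qed
  then have "hausdorff_outer ?s S \<le> 0" unfolding hausdorff_outer_def by (intro SUP_least) simp
  then show ?thesis by simp
qed

section \<open>From the Dirichlet boundary to the whole domain\<close>

text \<open>Sets of the completed surface measure are Borel sets up to null sets, so a set of positive measure
  has a Borel part of the same measure.\<close>

lemma surface_positive_borel_part:
  fixes \<Gamma> :: "'a::euclidean_space set"
  assumes "\<Gamma> \<in> sets (surface_measure \<Omega>)" "emeasure (surface_measure \<Omega>) \<Gamma> > 0"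
  obtains P where "P \<in> sets borel" "P \<subseteq> \<Gamma>" "P \<subseteq> frontier \<Omega>" "emeasure (hausdorff_measure (DIM('a) - 1)) P > 0"
proof -
  let ?H = "hausdorff_measure (DIM('a) - 1) :: 'a measure"
  let ?N = "restrict_space ?H (frontier \<Omega>)"
  have fr: "frontier \<Omega> \<inter> space ?H \<in> sets ?H" by simp
  define P where "P = main_part ?N \<Gamma>"
  have G: "\<Gamma> \<in> sets (completion ?N)" using assms(1) by (simp add: surface_measure_def)
  have P: "P \<in> sets ?N" unfolding P_def using G by (rule main_part_sets)
  have "P \<subseteq> \<Gamma>" unfolding P_def using main_part_null_part_Un[OF G] by blast
  moreover have "P \<in> sets borel" "P \<subseteq> frontier \<Omega>" 
    using sets_restrict_space_iff[OF fr, THEN iffD1, OF P] by simp_all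
  moreover have "emeasure ?H P > 0"
  proof -
    have "emeasure (surface_measure \<Omega>) \<Gamma> = emeasure ?N P"
      unfolding surface_measure_def P_def by (rule emeasure_completion[OF G])
    also have "\<dots> = emeasure ?H P" using \<open>P \<subseteq> frontier \<Omega>\<close> by (rule emeasure_restrict_space[OF fr])
    finally show ?thesis using assms(2) by simp
  qed
  ultimately show ?thesis using that by blast
qed

text \<open>A translation by \<open>(r / 2) n\<close> moves the part of \<open>\<Omega>\<close> near \<open>x0\<close> to height at least \<open>r / 2\<close>, into a compact
  subset of \<open>\<Omega>\<close>, along segments inside \<open>\<Omega>\<close>.\<close>

lemma boundary_patch_controlled:
  fixes \<Omega> :: "'a::euclidean_space set"
  assumes \<Omega>: "open \<Omega>" "lipschitz_boundary \<Omega>" and x0: "x0 \<in> frontier \<Omega>"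
    and compact: "\<And>K. compact K \<Longrightarrow> K \<subseteq> \<Omega> \<Longrightarrow> controlled \<Omega> \<Phi> K"
  shows "\<exists>\<rho>>0. controlled \<Omega> \<Phi> (\<Omega> \<inter> ball x0 \<rho>)"
proof -
  have [measurable]: "\<Omega> \<in> sets borel" using \<Omega>(1) by simp
  obtain r n \<tau> where "boundary_height \<Omega> x0 r n \<tau>"
    using lipschitz_boundary_height[OF \<Omega> x0] by blast
  then obtain L where r: "r > 0" and n: "norm n = 1" and lip: "L-lipschitz_on UNIV \<tau>"
    and shift: "\<And>x t. \<tau> (x + t *\<^sub>R n) = \<tau> x + t" and dom: "\<And>x. x \<in> ball x0 r \<Longrightarrow> x \<in> \<Omega> \<longleftrightarrow> 0 < \<tau> x"
    by (rule boundary_heightE) blast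
  have cont: "continuous_on UNIV \<tau>" using lip by (rule lipschitz_on_continuous_on)
  define K where "K = {y. r / 2 \<le> \<tau> y} \<inter> cball x0 (3 / 4 * r)"
  have "closed {y. r / 2 \<le> \<tau> y}" by (intro closed_Collect_le cont continuous_on_const)
  then have "compact K" unfolding K_def by (intro closed_Int_compact compact_cball)
  moreover have "K \<subseteq> \<Omega>"
  proof
    fix y assume "y \<in> K"
    then have "r / 2 \<le> \<tau> y" "dist x0 y \<le> 3 / 4 * r" by (auto simp: K_def)
    then have "y \<in> ball x0 r" "0 < \<tau> y" using r by auto
    then show "y \<in> \<Omega>" using dom by blast
  qed
  ultimately have K: "controlled \<Omega> \<Phi> K" by (rule compact)
  have near: "dist x0 (x + s *\<^sub>R n) \<le> 3 / 4 * r" if "x \<in> ball x0 (r / 4)" "0 \<le> s" "s \<le> r / 2" for x s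
  proof -
    have "dist x0 (x + s *\<^sub>R n) \<le> dist x0 x + dist x (x + s *\<^sub>R n)" by (rule dist_triangle)
    moreover have "dist x (x + s *\<^sub>R n) = s" using that n by (simp add: dist_norm)
    ultimately show ?thesis using that by simp
  qed
  have "controlled \<Omega> \<Phi> (\<Omega> \<inter> ball x0 (r / 4))"
  proof (rule controlled_translate[OF K, where v = "(r / 2) *\<^sub>R n"])
    fix x assume x: "x \<in> \<Omega> \<inter> ball x0 (r / 4)"
    then have \<tau>x: "\<tau> x > 0" using dom[of x] r by simp
    show "x + (r / 2) *\<^sub>R n \<in> K" using near[of x "r / 2"] x r \<tau>x by (simp add: K_def shift)
    fix s :: real assume s: "0 \<le> s" "s < 1"
    have "s * (r / 2) \<le> 1 * (r / 2)" using s r by (intro mult_right_mono) auto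
    then have "dist x0 (x + (s * (r / 2)) *\<^sub>R n) \<le> 3 / 4 * r" using near[of x "s * (r / 2)"] x s r by simp
    then have "x + (s * (r / 2)) *\<^sub>R n \<in> ball x0 r" using r by (simp add: field_simps)
    moreover have "0 < \<tau> (x + (s * (r / 2)) *\<^sub>R n)"
      unfolding shift using \<tau>x s r by (intro add_pos_nonneg) auto
    ultimately show "x + s *\<^sub>R (r / 2) *\<^sub>R n \<in> \<Omega>" using dom[of "x + (s * (r / 2)) *\<^sub>R n"] by simp
  qed auto
  then show ?thesis using r by (intro exI[of _ "r / 4"]) auto
qed

text \<open>Every point of the compact closure of \<open>\<Omega>\<close> has a neighbourhood whose part in \<open>\<Omega>\<close> is controlled.\<close>

lemma domain_controlled:
  fixes \<Omega> :: "'a::euclidean_space set"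
  assumes reg: "regular_domain \<Omega>" and A: "controlled \<Omega> \<Phi> A" "A \<subseteq> \<Omega>" "emeasure lborel A > 0"
  shows "controlled \<Omega> \<Phi> \<Omega>"
proof -
  have \<Omega>: "open \<Omega>" "connected \<Omega>" "bounded \<Omega>" "lipschitz_boundary \<Omega>"
    using reg by (auto simp: regular_domain_def)
  have K: "controlled \<Omega> \<Phi> K" if "compact K" "K \<subseteq> \<Omega>" for K
    using controlled_compact[OF \<Omega>(1,2) A that] .
  have "\<exists>\<rho>>0. controlled \<Omega> \<Phi> (\<Omega> \<inter> ball x \<rho>)" if "x \<in> closure \<Omega>" for x
  proof (cases "x \<in> \<Omega>")
    case True
    then obtain e where e: "e > 0" "cball x e \<subseteq> \<Omega>" using \<Omega>(1) open_contains_cball by blast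
    have "controlled \<Omega> \<Phi> (\<Omega> \<inter> ball x e)"
      by (rule controlled_subset[OF K[OF compact_cball e(2)]]) (use \<Omega>(1) in auto)
    then show ?thesis using e by blast
  next
    case False
    then have "x \<in> frontier \<Omega>" using that \<Omega>(1) by (simp add: frontier_def interior_open)
    then show ?thesis using boundary_patch_controlled[OF \<Omega>(1,4) _ K] by blast
  qed
  then obtain \<rho> where \<rho>: "\<And>x. x \<in> closure \<Omega> \<Longrightarrow> \<rho> x > 0 \<and> controlled \<Omega> \<Phi> (\<Omega> \<inter> ball x (\<rho> x))" by metis
  have "compact (closure \<Omega>)" using \<Omega>(3) by simp
  then obtain F where F: "F \<subseteq> closure \<Omega>" "finite F" "closure \<Omega> \<subseteq> (\<Union>x\<in>F. ball x (\<rho> x))"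
  proof (rule compactE_image[of _ "closure \<Omega>" "\<lambda>x. ball x (\<rho> x)"])
    show "closure \<Omega> \<subseteq> (\<Union>x\<in>closure \<Omega>. ball x (\<rho> x))" using \<rho> by force
  qed auto
  have "controlled \<Omega> \<Phi> (\<Union>x\<in>F. \<Omega> \<inter> ball x (\<rho> x))" using F \<rho> by (intro controlled_UN) auto
  moreover have "(\<Union>x\<in>F. \<Omega> \<inter> ball x (\<rho> x)) = \<Omega>" using F(3) closure_subset[of \<Omega>] by blast
  ultimately show ?thesis by simp
qed

definition boundary_sq_integral :: "'a::euclidean_space set \<Rightarrow> ('a \<Rightarrow> real) \<Rightarrow> ennreal" where
  "boundary_sq_integral E f = (\<integral>\<^sup>+x. indicator E x * ennreal ((f x)\<^sup>2) \<partial>hausdorff_measure (DIM('a) - 1))"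

text \<open>Some chart contains a part \<open>E\<close> of \<open>P\<close> of positive measure. The layer \<open>T\<close> of points less than \<open>h\<close> above
  \<open>E\<close> has positive volume. Each point of \<open>T\<close> is joined to its foot point \<open>\<pi> x\<close> in \<open>E\<close> by a segment in \<open>\<Omega>\<close>,
  and the image of the volume measure on \<open>T\<close> under \<open>\<pi>\<close> is at most a constant times the surface measure
  on \<open>E\<close>; so \<open>T\<close> is controlled, and with it \<open>\<Omega>\<close>.\<close>

lemma boundary_controls_domain:
  fixes \<Omega> :: "'a::euclidean_space set"
  assumes reg: "regular_domain \<Omega>" and P: "P \<in> sets borel" "P \<subseteq> frontier \<Omega>"
    and pos: "emeasure (hausdorff_measure (DIM('a) - 1)) P > 0"
  shows "controlled \<Omega> (boundary_sq_integral P) \<Omega>"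
proof -
  let ?H = "hausdorff_measure (DIM('a) - 1) :: 'a measure"
  have \<Omega>: "open \<Omega>" "connected \<Omega>" "bounded \<Omega>" "lipschitz_boundary \<Omega>"
    using reg by (auto simp: regular_domain_def)
  have [measurable]: "\<Omega> \<in> sets borel" using \<Omega>(1) by simp
  obtain r \<nu> \<theta> where ht: "\<And>x. x \<in> frontier \<Omega> \<Longrightarrow> boundary_height \<Omega> x (r x) (\<nu> x) (\<theta> x)"
    using lipschitz_boundary_height[OF \<Omega>(1,4)] by metis
  have r: "r x > 0" if "x \<in> frontier \<Omega>" for x using ht[OF that] by (simp add: boundary_height_def)
  have "compact (frontier \<Omega>)" using \<Omega>(3) by (rule compact_frontier_bounded)
  then obtain F where F: "F \<subseteq> frontier \<Omega>" "finite F" "frontier \<Omega> \<subseteq> (\<Union>x\<in>F. ball x (r x / 2))"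
  proof (rule compactE_image[of _ "frontier \<Omega>" "\<lambda>x. ball x (r x / 2)"])
    show "frontier \<Omega> \<subseteq> (\<Union>x\<in>frontier \<Omega>. ball x (r x / 2))" using r by force
  qed auto
  have "\<exists>x\<in>F. emeasure ?H (P \<inter> ball x (r x / 2)) > 0"
  proof (rule ccontr)
    assume "\<not> ?thesis"
    then have "P \<inter> ball x (r x / 2) \<in> null_sets ?H" if "x \<in> F" for x
      using that P by (auto simp: null_sets_def)
    then have "(\<Union>x\<in>F. P \<inter> ball x (r x / 2)) \<in> null_sets ?H" by (intro null_sets_UN' countable_finite F)
    moreover have "(\<Union>x\<in>F. P \<inter> ball x (r x / 2)) = P" using F(3) P(2) by blast
    ultimately show False using pos by (simp add: null_sets_def)
  qed
  then obtain x0 where x0: "x0 \<in> F" and Epos: "emeasure ?H (P \<inter> ball x0 (r x0 / 2)) > 0" by blast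
  define R where "R = r x0"
  define h where "h = R / 2"
  define E where "E = P \<inter> ball x0 h"
  have [measurable]: "E \<in> sets borel" using P by (simp add: E_def)
  have x0f: "x0 \<in> frontier \<Omega>" using x0 F(1) by blast
  obtain n \<tau> where "boundary_height \<Omega> x0 R n \<tau>" using ht[OF x0f] unfolding R_def by blast
  then obtain L where n: "norm n = 1" and lip: "L-lipschitz_on UNIV \<tau>" and shift: "\<And>x t. \<tau> (x + t *\<^sub>R n) = \<tau> x + t"
    and dom: "\<And>y. y \<in> ball x0 R \<Longrightarrow> y \<in> \<Omega> \<longleftrightarrow> 0 < \<tau> y"
    and bd: "\<And>z. z \<in> frontier \<Omega> \<Longrightarrow> z \<in> ball x0 R \<Longrightarrow> \<tau> z = 0"
    by (rule boundary_heightE) blast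
  have h: "h > 0" using r[OF x0f] by (simp add: h_def R_def)
  have cont: "continuous_on UNIV \<tau>" using lip by (rule lipschitz_on_continuous_on)
  have [measurable]: "\<tau> \<in> borel_measurable borel" using cont by (rule borel_measurable_continuous_onI)
  have E0: "\<tau> z = 0" if "z \<in> E" for z
    using that P(2) h by (intro bd) (auto simp: E_def h_def)
  define \<pi> where "\<pi> x = x - \<tau> x *\<^sub>R n" for x
  have [measurable]: "\<pi> \<in> borel_measurable borel" unfolding \<pi>_def[abs_def] by measurable
  have \<pi>: "\<pi> (z + t *\<^sub>R n) = z" if "z \<in> E" for z t using E0[OF that] by (simp add: \<pi>_def shift)
  define T where "T = {x. 0 < \<tau> x \<and> \<tau> x < h \<and> \<pi> x \<in> E}"
  have [measurable]: "T \<in> sets borel"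
  proof -
    have "{x \<in> space borel. 0 < \<tau> x \<and> \<tau> x < h \<and> \<pi> x \<in> E} \<in> sets borel" by measurable
    then show ?thesis by (simp add: T_def)
  qed
  have seg: "x + s *\<^sub>R (- n) \<in> \<Omega>" if x: "x \<in> T" and s: "0 \<le> s" "s < \<tau> x" for x s
  proof -
    have "dist x0 (\<pi> x) < h" "\<tau> x < h" using x by (auto simp: T_def E_def)
    moreover have "dist (\<pi> x) (x - s *\<^sub>R n) = \<tau> x - s"
    proof -
      have "\<pi> x - (x - s *\<^sub>R n) = (s - \<tau> x) *\<^sub>R n" by (simp add: \<pi>_def algebra_simps)
      then show ?thesis using s n by (simp add: dist_norm)
    qed
    ultimately have "dist x0 (x - s *\<^sub>R n) < R" using dist_triangle[of x0 "x - s *\<^sub>R n" "\<pi> x"] s by (simp add: h_def)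
    moreover have "\<tau> (x - s *\<^sub>R n) = \<tau> x - s" using shift[of x "- s"] by simp
    ultimately show ?thesis using dom[of "x - s *\<^sub>R n"] s by simp
  qed
  have T\<Omega>: "T \<subseteq> \<Omega>" using seg[of _ 0] by (auto simp: T_def)
  have Tpos: "emeasure lborel T > 0"
  proof (rule ccontr)
    assume "\<not> emeasure lborel T > 0"
    then have "T \<in> null_sets lborel" by (simp add: null_sets_def)
    moreover have "z + t *\<^sub>R n \<in> T" if "z \<in> E" "0 < t" "t < h" for z t
      using that \<pi>[OF that(1)] E0[OF that(1)] by (simp add: T_def shift)
    moreover have "bounded T" using T\<Omega> \<Omega>(3) bounded_subset by blast
    ultimately have "hausdorff_outer (DIM('a) - 1) E = 0"
      using hausdorff_null_if_swept_null[OF n h lip shift E0] by blast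
    moreover have "emeasure ?H E = hausdorff_outer (DIM('a) - 1) E" by (rule emeasure_hausdorff_measure) simp
    ultimately show False using Epos by (simp add: E_def h_def R_def)
  qed
  obtain C where C: "C < \<infinity>"
    "\<And>W S. W \<in> sets borel \<Longrightarrow> W \<subseteq> tube n h S \<Longrightarrow> emeasure lborel W \<le> C * hausdorff_outer (DIM('a) - 1) S"
    using tube_measure_le_hausdorff[OF n h] by metis
  have proj: "sq_integral T (\<lambda>x. f (\<pi> x)) \<le> C * boundary_sq_integral P f" if f: "smooth f" for f
  proof -
    note [measurable] = smooth_measurable[OF f]
    define H where "H = ?H"
    have sH[measurable_cong, simp]: "sets H = sets borel" by (simp add: H_def)
    have bsi: "boundary_sq_integral S f = (\<integral>\<^sup>+x. indicator S x * ennreal ((f x)\<^sup>2) \<partial>H)" for S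
      by (simp only: boundary_sq_integral_def H_def)
    let ?\<nu> = "distr (density lborel (indicator T)) borel \<pi>"
    let ?\<mu> = "scale_measure C (density H (indicator E))"
    have "?\<nu> \<le> ?\<mu>"
    proof (rule le_measure[THEN iffD2])
      show "\<forall>B\<in>sets ?\<nu>. emeasure ?\<nu> B \<le> emeasure ?\<mu> B"
      proof
        fix B assume "B \<in> sets ?\<nu>"
        then have B[measurable]: "B \<in> sets borel" by simp
        have vB: "\<pi> -` B \<in> sets borel" using measurable_sets[of \<pi> borel borel B] by simp
        have "emeasure ?\<nu> B = emeasure (density lborel (indicator T)) (\<pi> -` B)"
          by (subst emeasure_distr) simp_all
        also have "\<dots> = emeasure lborel (T \<inter> \<pi> -` B)"
          using vB by (subst emeasure_density) (simp_all flip: indicator_inter_arith add: nn_integral_indicator)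
        also have "\<dots> \<le> C * hausdorff_outer (DIM('a) - 1) (E \<inter> B)"
        proof (rule C(2))
          show "T \<inter> \<pi> -` B \<in> sets borel" using vB by simp
          show "T \<inter> \<pi> -` B \<subseteq> tube n h (E \<inter> B)"
          proof
            fix x assume "x \<in> T \<inter> \<pi> -` B"
            then have "x = \<pi> x + \<tau> x *\<^sub>R n" "\<pi> x \<in> E \<inter> B" "0 \<le> \<tau> x" "\<tau> x \<le> h" by (auto simp: T_def \<pi>_def)
            then show "x \<in> tube n h (E \<inter> B)" unfolding tube_def by blast
          qed
        qed
        also have "hausdorff_outer (DIM('a) - 1) (E \<inter> B) = emeasure H (E \<inter> B)"
          unfolding H_def by (rule emeasure_hausdorff_measure[symmetric]) simp
        also have "emeasure H (E \<inter> B) = emeasure (density H (indicator E)) B"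
          by (subst emeasure_density)
            (simp_all flip: indicator_inter_arith add: nn_integral_indicator borel_measurable_indicator)
        finally show "emeasure ?\<nu> B \<le> emeasure ?\<mu> B" by simp
      qed
    qed simp
    then have "(\<integral>\<^sup>+x. ennreal ((f x)\<^sup>2) \<partial>?\<nu>) \<le> (\<integral>\<^sup>+x. ennreal ((f x)\<^sup>2) \<partial>?\<mu>)"
      by (intro nn_integral_mono_measure) simp_all
    moreover have "(\<integral>\<^sup>+x. ennreal ((f x)\<^sup>2) \<partial>?\<nu>) = sq_integral T (\<lambda>x. f (\<pi> x))"
      unfolding sq_integral_def by (subst nn_integral_distr) (simp_all add: nn_integral_density)
    moreover have "(\<integral>\<^sup>+x. ennreal ((f x)\<^sup>2) \<partial>?\<mu>) = C * boundary_sq_integral E f"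
      unfolding bsi by (subst nn_integral_scale_measure) (simp_all add: nn_integral_density)
    moreover have "boundary_sq_integral E f \<le> boundary_sq_integral P f"
      unfolding bsi by (intro nn_integral_mono) (auto simp: E_def indicator_def)
    ultimately show ?thesis by (metis mult_left_mono order_trans zero_le)
  qed
  have "controlled \<Omega> (boundary_sq_integral P) T"
  proof (rule controlledI)
    show "2 * C + 2 * ennreal (h\<^sup>2) < \<infinity>" using C(1) by (simp add: ennreal_mult_less_top)
    fix f :: "'a \<Rightarrow> real" assume f: "smooth f"
    have "sq_integral T (\<lambda>x. f (x + \<tau> x *\<^sub>R (- n)) - f x) \<le> ennreal (h\<^sup>2 * (norm (- n))\<^sup>2) * energy \<Omega> f"
      using seg h by (intro increment_integral_le f) (auto simp: T_def)
    then have 1: "sq_integral T (\<lambda>x. f (\<pi> x) - f x) \<le> ennreal (h\<^sup>2) * energy \<Omega> f"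
      by (simp add: \<pi>_def n)
    have "sq_integral T f \<le> 2 * sq_integral T (\<lambda>x. f (\<pi> x)) + 2 * sq_integral T (\<lambda>x. f (\<pi> x) - f x)"
      by (rule sq_integral_le_increment[OF f]) measurable
    also have "\<dots> \<le> 2 * (C * boundary_sq_integral P f) + 2 * (ennreal (h\<^sup>2) * energy \<Omega> f)"
      using 1 proj[OF f] by (intro add_mono mult_left_mono) auto
    also have "\<dots> \<le> 2 * (C * (boundary_sq_integral P f + energy \<Omega> f)) + 2 * (ennreal (h\<^sup>2) * (boundary_sq_integral P f + energy \<Omega> f))"
      by (intro add_mono mult_left_mono) auto
    also have "\<dots> = (2 * C + 2 * ennreal (h\<^sup>2)) * (boundary_sq_integral P f + energy \<Omega> f)"
      by (simp only: distrib_right mult.assoc)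
    finally show "sq_integral T f \<le> (2 * C + 2 * ennreal (h\<^sup>2)) * (boundary_sq_integral P f + energy \<Omega> f)" .
  qed simp
  from domain_controlled[OF reg this T\<Omega> Tpos] show ?thesis .
qed

lemma (in bounded_open) sq_integral_eq_l2_norm:
  assumes "smooth f" shows "sq_integral \<Omega> f = ennreal ((l2_norm M f)\<^sup>2)"
proof -
  have "ennreal ((l2_norm M f)\<^sup>2) = (\<integral>\<^sup>+x. ennreal ((norm (f x))\<^sup>2) \<partial>M)"
    by (rule nn_integral_L2[symmetric]) (intro L2_continuous smooth_continuous assms)
  also have "\<dots> = sq_integral \<Omega> f"
    using open_dom unfolding sq_integral_def
    by (subst nn_integral_restrict_space) (simp_all add: nn_integral_completion mult.commute)
  finally show ?thesis by simp
qed

lemma (in bounded_open) energy_eq_l2_norm_grad: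
  assumes "smooth f" shows "energy \<Omega> f = ennreal ((l2_norm M (grad \<Omega> f))\<^sup>2)"
proof -
  have c: "classical_grad f \<in> L2 M" by (intro L2_continuous classical_grad_continuous assms)
  have "l2_norm M (grad \<Omega> f) = l2_norm M (classical_grad f)"
    using H1_smooth[OF assms] by (intro l2_norm_cong_AE L2_D(1) c grad_L2)
  then have "ennreal ((l2_norm M (grad \<Omega> f))\<^sup>2) = (\<integral>\<^sup>+x. ennreal ((norm (classical_grad f x))\<^sup>2) \<partial>M)"
    using nn_integral_L2[OF c] by simp
  also have "\<dots> = energy \<Omega> f"
    using open_dom unfolding energy_def
    by (subst nn_integral_restrict_space) (simp_all add: nn_integral_completion mult.commute)
  finally show ?thesis by simp
qed

lemma boundary_sq_integral_le_l2_norm: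
  fixes \<Gamma> :: "'a::euclidean_space set"
  assumes G: "\<Gamma> \<in> sets (surface_measure \<Omega>)" and P: "P \<in> sets borel" "P \<subseteq> \<Gamma>" "P \<subseteq> frontier \<Omega>"
    and f: "f \<in> L2 (restrict_space (surface_measure \<Omega>) \<Gamma>)" 
  shows "boundary_sq_integral P f \<le> ennreal ((l2_norm (restrict_space (surface_measure \<Omega>) \<Gamma>) f)\<^sup>2)"
proof -
  let ?H = "hausdorff_measure (DIM('a) - 1) :: 'a measure"
  have "boundary_sq_integral P f = (\<integral>\<^sup>+x. (indicator P x * ennreal ((f x)\<^sup>2)) * indicator (frontier \<Omega>) x \<partial>?H)"
    unfolding boundary_sq_integral_def using P(3) by (intro nn_integral_cong) (auto simp: indicator_def)
  also have "\<dots> = (\<integral>\<^sup>+x. indicator P x * ennreal ((f x)\<^sup>2) \<partial>restrict_space ?H (frontier \<Omega>))"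
    by (rule nn_integral_restrict_space[symmetric]) simp
  also have "\<dots> = (\<integral>\<^sup>+x. indicator P x * ennreal ((f x)\<^sup>2) \<partial>surface_measure \<Omega>)"
    by (simp add: surface_measure_def nn_integral_completion)
  also have "\<dots> \<le> (\<integral>\<^sup>+x. ennreal ((norm (f x))\<^sup>2) * indicator \<Gamma> x \<partial>surface_measure \<Omega>)"
    using P(2) by (intro nn_integral_mono) (auto simp: indicator_def)
  also have "\<dots> = (\<integral>\<^sup>+x. ennreal ((norm (f x))\<^sup>2) \<partial>restrict_space (surface_measure \<Omega>) \<Gamma>)"
    using G by (intro nn_integral_restrict_space[symmetric]) auto
  also have "\<dots> = ennreal ((l2_norm (restrict_space (surface_measure \<Omega>) \<Gamma>) f)\<^sup>2)"
    by (rule nn_integral_L2[OF f])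
  finally show ?thesis .
qed

section \<open>Functions with vanishing trace and the Friedrichs inequality\<close>

context bounded_open
begin

definition h1_inner :: "('a \<Rightarrow> real) \<Rightarrow> ('a \<Rightarrow> real) \<Rightarrow> real" where
  "h1_inner u v = l2_inner M u v + l2_inner M (grad \<Omega> u) (grad \<Omega> v)"

definition dirichlet_form :: "('a \<Rightarrow> real) \<Rightarrow> ('a \<Rightarrow> real) \<Rightarrow> real" where
  "dirichlet_form u v = l2_inner M (grad \<Omega> u) (grad \<Omega> v)"

abbreviation lincomb :: "real \<Rightarrow> ('a \<Rightarrow> real) \<Rightarrow> real \<Rightarrow> ('a \<Rightarrow> real) \<Rightarrow> 'a \<Rightarrow> real" where
  "lincomb a u b v \<equiv> \<lambda>x. a * u x + b * v x"

lemma l2_inner_grad_lincomb: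
  assumes "u \<in> H1 \<Omega>" "v \<in> H1 \<Omega>" "g \<in> L2 M"
  shows "l2_inner M (grad \<Omega> (lincomb a u b v)) g = a * l2_inner M (grad \<Omega> u) g + b * l2_inner M (grad \<Omega> v) g"
proof -
  have "l2_inner M (grad \<Omega> (lincomb a u b v)) g = l2_inner M (\<lambda>x. a *\<^sub>R grad \<Omega> u x + b *\<^sub>R grad \<Omega> v x) g"
    using H1_lincomb[OF assms(1,2), of a b] assms
    by (intro l2_inner_cong_AE L2_D(1) L2_lincomb grad_L2) auto
  then show ?thesis by (simp add: L2.p_lc grad_L2 assms)
qed

sublocale dirichlet: semi_inner_space "H1 \<Omega>" lincomb dirichlet_form
proof
  fix u v w :: "'a \<Rightarrow> real" and a b assume u: "u \<in> H1 \<Omega>" and v: "v \<in> H1 \<Omega>"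
  show "lincomb a u b v \<in> H1 \<Omega>" using u v by (rule H1_lincomb)
  show "dirichlet_form u v = dirichlet_form v u" unfolding dirichlet_form_def by (rule l2_inner_commute)
  assume w: "w \<in> H1 \<Omega>"
  show "dirichlet_form (lincomb a u b v) w = a * dirichlet_form u w + b * dirichlet_form v w"
    unfolding dirichlet_form_def using u v w by (intro l2_inner_grad_lincomb grad_L2)
next
  fix u :: "'a \<Rightarrow> real" show "0 \<le> dirichlet_form u u" by (simp add: dirichlet_form_def l2_inner_self_nonneg)
qed

sublocale h1: semi_inner_space "H1 \<Omega>" lincomb h1_inner
proof
  fix u v w :: "'a \<Rightarrow> real" and a b assume u: "u \<in> H1 \<Omega>" and v: "v \<in> H1 \<Omega>"
  show "lincomb a u b v \<in> H1 \<Omega>" using u v by (rule H1_lincomb)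
  show "h1_inner u v = h1_inner v u" by (simp add: h1_inner_def l2_inner_commute)
  assume w: "w \<in> H1 \<Omega>"
  show "h1_inner (lincomb a u b v) w = a * h1_inner u w + b * h1_inner v w"
    using u v w by (simp add: h1_inner_def l2_inner_lincomb l2_inner_grad_lincomb H1_L2 grad_L2 algebra_simps)
next
  fix u :: "'a \<Rightarrow> real" show "0 \<le> h1_inner u u" by (simp add: h1_inner_def l2_inner_self_nonneg)
qed

lemma h1_norm_eq: "h1_norm \<Omega> u = sqrt (h1_inner u u)"
  by (simp add: h1_norm_def h1_inner_def l2_norm_sq)

lemma h1_norm_lincomb:
  "u \<in> H1 \<Omega> \<Longrightarrow> v \<in> H1 \<Omega> \<Longrightarrow> h1_norm \<Omega> (lincomb a u b v) \<le> \<bar>a\<bar> * h1_norm \<Omega> u + \<bar>b\<bar> * h1_norm \<Omega> v"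
  unfolding h1_norm_eq by (rule h1.norm_lc_le)

lemma h1_norm_bounds:
  shows "l2_norm M u \<le> h1_norm \<Omega> u" "l2_norm M (grad \<Omega> u) \<le> h1_norm \<Omega> u"
    "h1_norm \<Omega> u \<le> l2_norm M u + l2_norm M (grad \<Omega> u)" "0 \<le> h1_norm \<Omega> u"
  unfolding h1_norm_def using l2_norm_nonneg[of M u] l2_norm_nonneg[of M "grad \<Omega> u"]
  by (auto intro!: real_le_rsqrt sqrt_sum_squares_le_sum)

lemma dirichlet_form_self: "dirichlet_form u u = (l2_norm M (grad \<Omega> u))\<^sup>2"
  by (simp add: dirichlet_form_def l2_norm_sq)

lemma sqrt_dirichlet_form: "sqrt (dirichlet_form u u) = l2_norm M (grad \<Omega> u)"
  by (simp add: dirichlet_form_self l2_norm_nonneg)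

lemma diff_eq_lincomb: "u - v = lincomb 1 u (- 1) v"
  by (auto simp: fun_eq_iff)

lemma l2_norm_grad_diff:
  assumes "u \<in> H1 \<Omega>" "v \<in> H1 \<Omega>"
  shows "l2_norm M (grad \<Omega> (u - v)) = l2_norm M (grad \<Omega> u - grad \<Omega> v)"
  using H1_diff[OF assms] assms by (intro l2_norm_cong_AE L2_D(1) L2_diff grad_L2)

text \<open>Approximation within every \<open>e\<close> is easier to combine than convergent sequences: that functions of
  vanishing trace form a closed subspace follows by choosing \<open>e\<close> suitably.\<close>

lemma H1_zero_on_iff:
  fixes \<Gamma> :: "'a set"
  defines "\<sigma> \<equiv> restrict_space (surface_measure \<Omega>) \<Gamma>"
  shows "u \<in> H1_zero_on \<Omega> \<Gamma> \<longleftrightarrow> u \<in> H1 \<Omega> \<and>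
    (\<forall>e>0. \<exists>\<phi>. smooth \<phi> \<and> \<phi> \<in> L2 \<sigma> \<and> h1_norm \<Omega> (\<phi> - u) < e \<and> l2_norm \<sigma> \<phi> < e)"
proof
  assume u: "u \<in> H1_zero_on \<Omega> \<Gamma>"
  then obtain \<phi> where \<phi>: "\<And>n. smooth (\<phi> n)" "\<And>n. \<phi> n \<in> L2 \<sigma>" "(\<lambda>n. h1_norm \<Omega> (\<phi> n - u)) \<longlonglongrightarrow> 0"
    "(\<lambda>n. l2_norm \<sigma> (\<phi> n - (\<lambda>x. 0))) \<longlonglongrightarrow> 0"
    unfolding H1_zero_on_def has_trace_def Let_def \<sigma>_def by blast
  have "\<exists>\<phi>. smooth \<phi> \<and> \<phi> \<in> L2 \<sigma> \<and> h1_norm \<Omega> (\<phi> - u) < e \<and> l2_norm \<sigma> \<phi> < e" if "e > 0" for e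
  proof -
    have "eventually (\<lambda>n. h1_norm \<Omega> (\<phi> n - u) < e \<and> l2_norm \<sigma> (\<phi> n - (\<lambda>x. 0)) < e) sequentially"
      using order_tendstoD(2)[OF \<phi>(3) that] order_tendstoD(2)[OF \<phi>(4) that] by (rule eventually_conj)
    then obtain n where "h1_norm \<Omega> (\<phi> n - u) < e" "l2_norm \<sigma> (\<phi> n - (\<lambda>x. 0)) < e"
      using eventually_happens'[OF sequentially_bot] by blast
    moreover have "\<phi> n - (\<lambda>x. 0) = \<phi> n" by (simp add: fun_diff_def)
    ultimately show ?thesis using \<phi>(1,2) by metis
  qed
  then show "u \<in> H1 \<Omega> \<and> (\<forall>e>0. \<exists>\<phi>. smooth \<phi> \<and> \<phi> \<in> L2 \<sigma> \<and> h1_norm \<Omega> (\<phi> - u) < e \<and> l2_norm \<sigma> \<phi> < e)"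
    using u by (simp add: H1_zero_on_def)
next
  assume *: "u \<in> H1 \<Omega> \<and> (\<forall>e>0. \<exists>\<phi>. smooth \<phi> \<and> \<phi> \<in> L2 \<sigma> \<and> h1_norm \<Omega> (\<phi> - u) < e \<and> l2_norm \<sigma> \<phi> < e)"
  have "\<forall>n. \<exists>\<phi>. smooth \<phi> \<and> \<phi> \<in> L2 \<sigma> \<and> h1_norm \<Omega> (\<phi> - u) < 1 / real (Suc n) \<and> l2_norm \<sigma> \<phi> < 1 / real (Suc n)"
    using * by (metis of_nat_0_less_iff zero_less_Suc zero_less_divide_1_iff)
  then obtain \<phi> where \<phi>: "\<And>n. smooth (\<phi> n)" "\<And>n. \<phi> n \<in> L2 \<sigma>" "\<And>n. h1_norm \<Omega> (\<phi> n - u) < 1 / real (Suc n)"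
    "\<And>n. l2_norm \<sigma> (\<phi> n) < 1 / real (Suc n)" by metis
  have lim0: "f \<longlonglongrightarrow> 0" if "\<And>n. 0 \<le> f n" "\<And>n. f n < 1 / real (Suc n)" for f :: "nat \<Rightarrow> real"
  proof (rule Lim_null_comparison[where g = "\<lambda>n. 1 / real (Suc n)"])
    show "\<forall>\<^sub>F n in sequentially. norm (f n) \<le> 1 / real (Suc n)" using that by (auto intro!: always_eventually less_imp_le)
    show "(\<lambda>n. 1 / real (Suc n)) \<longlonglongrightarrow> 0" by (rule LIMSEQ_Suc[OF lim_1_over_n])
  qed
  have "(\<lambda>n. h1_norm \<Omega> (\<phi> n - u)) \<longlonglongrightarrow> 0" "(\<lambda>n. l2_norm \<sigma> (\<phi> n)) \<longlonglongrightarrow> 0"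
    using \<phi>(3,4) h1_norm_bounds(4) l2_norm_nonneg by (auto intro!: lim0)
  moreover have "\<phi> n - (\<lambda>x. 0) = \<phi> n" for n by (simp add: fun_diff_def)
  ultimately have "has_trace \<Omega> \<Gamma> u (\<lambda>x. 0)"
    unfolding has_trace_def Let_def \<sigma>_def[symmetric] using * \<phi>(1,2) H1_smooth(1)
    by (intro conjI exI[of _ \<phi>]) auto
  then show "u \<in> H1_zero_on \<Omega> \<Gamma>" using * by (simp add: H1_zero_on_def)
qed

lemma H1_zero_on_lincomb:
  assumes u: "u \<in> H1_zero_on \<Omega> \<Gamma>" and v: "v \<in> H1_zero_on \<Omega> \<Gamma>"
  shows "lincomb a u b v \<in> H1_zero_on \<Omega> \<Gamma>"
  unfolding H1_zero_on_iff
proof (intro conjI allI impI)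
  let ?\<sigma> = "restrict_space (surface_measure \<Omega>) \<Gamma>"
  have uH: "u \<in> H1 \<Omega>" and vH: "v \<in> H1 \<Omega>" using u v by (auto simp: H1_zero_on_def)
  then show "lincomb a u b v \<in> H1 \<Omega>" by (rule H1_lincomb)
  fix e :: real assume e: "e > 0"
  define d where "d = e / (\<bar>a\<bar> + \<bar>b\<bar> + 1)"
  have d: "d > 0" using e by (simp add: d_def add_nonneg_pos)
  have small: "\<bar>a\<bar> * s + \<bar>b\<bar> * t < e" if "0 \<le> s" "s < d" "0 \<le> t" "t < d" for s t
  proof -
    have "\<bar>a\<bar> * s + \<bar>b\<bar> * t \<le> \<bar>a\<bar> * d + \<bar>b\<bar> * d" using that by (intro add_mono mult_left_mono) auto
    also have "\<dots> < (\<bar>a\<bar> + \<bar>b\<bar> + 1) * d" using d by (simp add: algebra_simps)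
    also have "\<dots> = e" by (simp add: d_def add_nonneg_pos less_imp_neq[THEN not_sym])
    finally show ?thesis .
  qed
  obtain \<phi> where \<phi>: "smooth \<phi>" "\<phi> \<in> L2 ?\<sigma>" "h1_norm \<Omega> (\<phi> - u) < d" "l2_norm ?\<sigma> \<phi> < d"
    using u d unfolding H1_zero_on_iff by blast
  obtain \<psi> where \<psi>: "smooth \<psi>" "\<psi> \<in> L2 ?\<sigma>" "h1_norm \<Omega> (\<psi> - v) < d" "l2_norm ?\<sigma> \<psi> < d"
    using v d unfolding H1_zero_on_iff by blast
  have "smooth (lincomb a \<phi> b \<psi>)" using \<phi>(1) \<psi>(1) by (rule smooth_lincomb)
  moreover have "lincomb a \<phi> b \<psi> \<in> L2 ?\<sigma>" using L2_lincomb[OF \<phi>(2) \<psi>(2), of a b] by simp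
  moreover have "h1_norm \<Omega> (lincomb a \<phi> b \<psi> - lincomb a u b v) < e"
  proof -
    have "lincomb a \<phi> b \<psi> - lincomb a u b v = lincomb a (\<phi> - u) b (\<psi> - v)"
      by (auto simp: fun_eq_iff algebra_simps)
    moreover have "h1_norm \<Omega> (lincomb a (\<phi> - u) b (\<psi> - v)) \<le> \<bar>a\<bar> * h1_norm \<Omega> (\<phi> - u) + \<bar>b\<bar> * h1_norm \<Omega> (\<psi> - v)"
      by (intro h1_norm_lincomb H1_diff(1) H1_smooth(1)[OF \<phi>(1)] H1_smooth(1)[OF \<psi>(1)] uH vH)
    ultimately have "h1_norm \<Omega> (lincomb a \<phi> b \<psi> - lincomb a u b v) \<le> \<bar>a\<bar> * h1_norm \<Omega> (\<phi> - u) + \<bar>b\<bar> * h1_norm \<Omega> (\<psi> - v)"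
      by (simp only:)
    also have "\<dots> < e" using \<phi>(3) \<psi>(3) h1_norm_bounds(4) by (intro small) auto
    finally show ?thesis .
  qed
  moreover have "l2_norm ?\<sigma> (lincomb a \<phi> b \<psi>) < e"
  proof -
    have "l2_norm ?\<sigma> (lincomb a \<phi> b \<psi>) \<le> \<bar>a\<bar> * l2_norm ?\<sigma> \<phi> + \<bar>b\<bar> * l2_norm ?\<sigma> \<psi>"
      using l2_norm_lincomb[OF \<phi>(2) \<psi>(2), of a b] by simp
    also have "\<dots> < e" using \<phi>(4) \<psi>(4) l2_norm_nonneg by (intro small) auto
    finally show ?thesis .
  qed
  ultimately show "\<exists>\<phi>. smooth \<phi> \<and> \<phi> \<in> L2 ?\<sigma> \<and> h1_norm \<Omega> (\<phi> - lincomb a u b v) < e \<and> l2_norm ?\<sigma> \<phi> < e"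
    by blast
qed

lemma H1_zero_on_closed:
  assumes U: "\<And>n. U n \<in> H1_zero_on \<Omega> \<Gamma>" and u: "u \<in> H1 \<Omega>" and lim: "(\<lambda>n. h1_norm \<Omega> (U n - u)) \<longlonglongrightarrow> 0"
  shows "u \<in> H1_zero_on \<Omega> \<Gamma>"
  unfolding H1_zero_on_iff
proof (intro conjI allI impI)
  let ?\<sigma> = "restrict_space (surface_measure \<Omega>) \<Gamma>"
  show "u \<in> H1 \<Omega>" by (rule u)
  fix e :: real assume e: "e > 0"
  then have e2: "e / 2 > 0" by simp
  obtain n where n: "h1_norm \<Omega> (U n - u) < e / 2"
    using eventually_happens'[OF sequentially_bot order_tendstoD(2)[OF lim e2]] by blast
  obtain \<phi> where \<phi>: "smooth \<phi>" "\<phi> \<in> L2 ?\<sigma>" "h1_norm \<Omega> (\<phi> - U n) < e / 2" "l2_norm ?\<sigma> \<phi> < e / 2"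
    using U[of n] e2 unfolding H1_zero_on_iff by blast
  have "U n \<in> H1 \<Omega>" using U by (simp add: H1_zero_on_def)
  then have "h1_norm \<Omega> (lincomb 1 (\<phi> - U n) 1 (U n - u)) \<le> \<bar>1\<bar> * h1_norm \<Omega> (\<phi> - U n) + \<bar>1\<bar> * h1_norm \<Omega> (U n - u)"
    by (intro h1_norm_lincomb H1_diff(1) H1_smooth(1)[OF \<phi>(1)] u)
  moreover have "lincomb 1 (\<phi> - U n) 1 (U n - u) = \<phi> - u" by (auto simp: fun_eq_iff)
  ultimately have "h1_norm \<Omega> (\<phi> - u) < e" using n \<phi>(3) by simp
  moreover have "l2_norm ?\<sigma> \<phi> < e" using \<phi>(4) e by simp
  ultimately show "\<exists>\<phi>. smooth \<phi> \<and> \<phi> \<in> L2 ?\<sigma> \<and> h1_norm \<Omega> (\<phi> - u) < e \<and> l2_norm ?\<sigma> \<phi> < e"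
    using \<phi>(1,2) by blast
qed

text \<open>For smooth functions this is \<open>boundary_controls_domain\<close>; for the others, the boundary term of the
  approximating smooth functions tends to zero.\<close>

lemma friedrichs_inequality:
  assumes reg: "regular_domain \<Omega>" and G: "\<Gamma> \<in> sets (surface_measure \<Omega>)" "emeasure (surface_measure \<Omega>) \<Gamma> > 0"
  obtains C where "0 \<le> C" "\<And>u. u \<in> H1_zero_on \<Omega> \<Gamma> \<Longrightarrow> l2_norm M u \<le> C * l2_norm M (grad \<Omega> u)"
proof -
  let ?\<sigma> = "restrict_space (surface_measure \<Omega>) \<Gamma>"
  obtain P where P: "P \<in> sets borel" "P \<subseteq> \<Gamma>" "P \<subseteq> frontier \<Omega>" "emeasure (hausdorff_measure (DIM('a) - 1)) P > 0"
    using surface_positive_borel_part[OF G] by blast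
  obtain C' where C': "C' < \<infinity>" "\<And>f. smooth f \<Longrightarrow> sq_integral \<Omega> f \<le> C' * (boundary_sq_integral P f + energy \<Omega> f)"
    using boundary_controls_domain[OF reg P(1,3,4)] unfolding controlled_def by blast
  obtain c where c: "0 \<le> c" "C' = ennreal c" using C'(1) by (cases C') auto
  define C where "C = sqrt c"
  have C: "0 \<le> C" "C\<^sup>2 = c" using c by (simp_all add: C_def)
  have smooth_bound: "l2_norm M \<phi> \<le> C * (l2_norm ?\<sigma> \<phi> + l2_norm M (grad \<Omega> \<phi>))" if \<phi>: "smooth \<phi>" "\<phi> \<in> L2 ?\<sigma>" for \<phi>
  proof (rule power2_le_imp_le)
    let ?s = "l2_norm ?\<sigma> \<phi>" and ?g = "l2_norm M (grad \<Omega> \<phi>)"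
    have "ennreal ((l2_norm M \<phi>)\<^sup>2) = sq_integral \<Omega> \<phi>" using sq_integral_eq_l2_norm[OF \<phi>(1)] by simp
    also have "\<dots> \<le> ennreal c * (boundary_sq_integral P \<phi> + energy \<Omega> \<phi>)" using C'(2)[OF \<phi>(1)] c by simp
    also have "\<dots> \<le> ennreal c * (ennreal (?s\<^sup>2) + ennreal (?g\<^sup>2))"
      unfolding energy_eq_l2_norm_grad[OF \<phi>(1)]
      by (intro mult_left_mono add_mono boundary_sq_integral_le_l2_norm G P \<phi>) auto
    also have "\<dots> = ennreal (c * (?s\<^sup>2 + ?g\<^sup>2))" using c by (simp add: ennreal_mult)
    finally have "(l2_norm M \<phi>)\<^sup>2 \<le> c * (?s\<^sup>2 + ?g\<^sup>2)" using c by (subst (asm) ennreal_le_iff) auto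
    also have "\<dots> \<le> c * (?s + ?g)\<^sup>2"
      using c l2_norm_nonneg[of ?\<sigma> \<phi>] l2_norm_nonneg[of M "grad \<Omega> \<phi>"]
      by (intro mult_left_mono) (auto simp: power2_sum)
    finally show "(l2_norm M \<phi>)\<^sup>2 \<le> (C * (?s + ?g))\<^sup>2" by (simp add: power_mult_distrib C)
    show "0 \<le> C * (?s + ?g)" by (intro mult_nonneg_nonneg add_nonneg_nonneg C l2_norm_nonneg)
  qed
  have "l2_norm M u \<le> C * l2_norm M (grad \<Omega> u)" if u: "u \<in> H1_zero_on \<Omega> \<Gamma>" for u
  proof (rule field_le_epsilon)
    fix e :: real assume e: "e > 0"
    have uH: "u \<in> H1 \<Omega>" using u by (simp add: H1_zero_on_def)
    define d where "d = e / (1 + 2 * C)"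
    have d: "d > 0" "(1 + 2 * C) * d = e" using e C by (simp_all add: d_def)
    obtain \<phi> where \<phi>: "smooth \<phi>" "\<phi> \<in> L2 ?\<sigma>" "h1_norm \<Omega> (\<phi> - u) < d" "l2_norm ?\<sigma> \<phi> < d"
      using u d(1) unfolding H1_zero_on_iff by blast
    have \<phi>H: "\<phi> \<in> H1 \<Omega>" using \<phi>(1) by (rule H1_smooth)
    have tri: "l2_norm M f \<le> l2_norm M g + l2_norm M (f - g)" if "f \<in> L2 M" "g \<in> L2 M" for f g :: "'a \<Rightarrow> 'c::euclidean_space"
      using l2_norm_lincomb[OF that(2) L2_diff[OF that], of 1 1] by simp
    have "l2_norm M u \<le> l2_norm M \<phi> + l2_norm M (u - \<phi>)" using uH \<phi>H by (intro tri H1_L2)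
    also have "l2_norm M (u - \<phi>) \<le> d"
      using h1_norm_bounds(1)[of "\<phi> - u"] \<phi>(3) by (simp add: l2_norm_diff_commute)
    also have "l2_norm M \<phi> \<le> C * (l2_norm ?\<sigma> \<phi> + l2_norm M (grad \<Omega> \<phi>))" by (rule smooth_bound[OF \<phi>(1,2)])
    also have "l2_norm M (grad \<Omega> \<phi>) \<le> l2_norm M (grad \<Omega> u) + d"
      using tri[OF grad_L2[OF \<phi>H] grad_L2[OF uH]] h1_norm_bounds(2)[of "\<phi> - u"] \<phi>(3)
      by (simp add: l2_norm_grad_diff[OF \<phi>H uH])
    finally have "l2_norm M u \<le> C * (l2_norm ?\<sigma> \<phi> + (l2_norm M (grad \<Omega> u) + d)) + d"
      using C by (simp add: mult_left_mono)
    also have "\<dots> \<le> C * (d + (l2_norm M (grad \<Omega> u) + d)) + d"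
      using \<phi>(4) C by (intro add_mono mult_left_mono) auto
    also have "\<dots> = C * l2_norm M (grad \<Omega> u) + (1 + 2 * C) * d" by (simp add: algebra_simps)
    finally show "l2_norm M u \<le> C * l2_norm M (grad \<Omega> u) + e" unfolding d(2) .
  qed
  with C(1) show ?thesis by (rule that)
qed

end

text \<open>The rest depends on the domain and the Dirichlet boundary only through the Friedrichs inequality.\<close>

locale friedrichs_space = bounded_open \<Omega> for \<Omega> :: "'a::euclidean_space set" +
  fixes \<Gamma> :: "'a set" and C :: real
  assumes C_nonneg: "0 \<le> C"
    and friedrichs: "u \<in> H1_zero_on \<Omega> \<Gamma> \<Longrightarrow> l2_norm M u \<le> C * l2_norm M (grad \<Omega> u)"
begin

abbreviation "V \<equiv> H1_zero_on \<Omega> \<Gamma>"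

lemma V_H1: "u \<in> V \<Longrightarrow> u \<in> H1 \<Omega>"
  by (simp add: H1_zero_on_def)

lemma V_L2: "u \<in> V \<Longrightarrow> u \<in> L2 M" "u \<in> V \<Longrightarrow> grad \<Omega> u \<in> L2 M"
  by (simp_all add: V_H1 H1_L2 grad_L2)

lemma zero_V: "(\<lambda>x. 0) \<in> V"
proof -
  have s: "smooth (\<lambda>x::'a. 0::real)"
  proof -
    have "Ck k (\<lambda>x::'a. 0::real)" for k
      by (induction k) (simp_all add: frechet_derivative_at[OF has_derivative_const, symmetric])
    then show ?thesis by (simp add: smooth_def)
  qed
  have 0: "(\<lambda>x. 0) \<in> H1 \<Omega>" by (rule H1_smooth[OF s])
  have "h1_norm \<Omega> (\<lambda>x. 0) = 0"
    using h1_norm_lincomb[OF 0 0, of 0 0] h1_norm_bounds(4)[of "\<lambda>x. 0"] by simp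
  moreover have "(\<lambda>x. 0) - (\<lambda>x::'a. 0) = (\<lambda>x. 0::real)" by auto
  ultimately show ?thesis
    unfolding H1_zero_on_iff using s 0 by (auto intro!: exI[of _ "\<lambda>x. 0"] simp: l2_norm_def l2_inner_def)
qed

text \<open>By the Friedrichs inequality gradients that form a Cauchy sequence come from functions that do, and
  the two limits belong together since weak gradients form a closed operator.\<close>

lemma V_complete:
  assumes U: "\<And>n. U n \<in> V"
    and Cauchy: "\<And>e. e > 0 \<Longrightarrow> \<exists>N. \<forall>m\<ge>N. \<forall>n\<ge>N. l2_norm M (grad \<Omega> (U m - U n)) < e"
  shows "\<exists>u\<in>V. (\<lambda>n. l2_norm M (grad \<Omega> (U n - u))) \<longlonglongrightarrow> 0"
proof -
  note UH = V_H1[OF U]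
  have "\<exists>g\<in>L2 M. (\<lambda>n. l2_norm M (grad \<Omega> (U n) - g)) \<longlonglongrightarrow> 0"
    using Cauchy by (intro L2_complete finite_M grad_L2 UH) (simp add: l2_norm_grad_diff[OF UH UH])
  then obtain g where g: "g \<in> L2 M" "(\<lambda>n. l2_norm M (grad \<Omega> (U n) - g)) \<longlonglongrightarrow> 0" by blast
  have "\<exists>u\<in>L2 M. (\<lambda>n. l2_norm M (U n - u)) \<longlonglongrightarrow> 0"
  proof (intro L2_complete finite_M H1_L2 UH)
    fix e :: real assume e: "e > 0"
    have C1: "C + 1 > 0" using C_nonneg by simp
    have "e / (C + 1) > 0" using e C1 by simp
    from Cauchy[OF this] obtain N where N: "\<forall>m\<ge>N. \<forall>n\<ge>N. l2_norm M (grad \<Omega> (U m - U n)) < e / (C + 1)" by blast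
    have "l2_norm M (U m - U n) < e" if "m \<ge> N" "n \<ge> N" for m n
    proof -
      have D: "U m - U n \<in> V" unfolding diff_eq_lincomb by (intro H1_zero_on_lincomb U)
      have "l2_norm M (U m - U n) \<le> C * l2_norm M (grad \<Omega> (U m - U n))" by (rule friedrichs[OF D])
      also have "\<dots> \<le> (C + 1) * l2_norm M (grad \<Omega> (U m - U n))" using l2_norm_nonneg by (intro mult_right_mono) auto
      also have "\<dots> < (C + 1) * (e / (C + 1))" using N that C1 by (intro mult_strict_left_mono) auto
      also have "\<dots> = e" using C1 by simp
      finally show ?thesis .
    qed
    then show "\<exists>N. \<forall>m\<ge>N. \<forall>n\<ge>N. l2_norm M (U m - U n) < e" by blast
  qed
  then obtain u where u: "u \<in> L2 M" "(\<lambda>n. l2_norm M (U n - u)) \<longlonglongrightarrow> 0" by blast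
  have "weak_gradient \<Omega> u g" by (rule weak_gradient_limit[OF UH u(1) g(1) u(2) g(2)])
  from H1I[OF u(1) g(1) this] have uH: "u \<in> H1 \<Omega>" and gu: "AE x in M. grad \<Omega> u x = g x" by auto
  have eq: "l2_norm M (grad \<Omega> (U n - u)) = l2_norm M (grad \<Omega> (U n) - g)" for n
  proof -
    have "l2_norm M (grad \<Omega> (U n - u)) = l2_norm M (grad \<Omega> (U n) - grad \<Omega> u)"
      by (rule l2_norm_grad_diff[OF UH uH])
    also have "\<dots> = l2_norm M (grad \<Omega> (U n) - g)"
      using gu by (intro l2_norm_cong_AE L2_D(1) L2_diff grad_L2 UH uH g) auto
    finally show ?thesis .
  qed
  have lim: "(\<lambda>n. l2_norm M (grad \<Omega> (U n - u))) \<longlonglongrightarrow> 0" using g(2) by (simp add: eq)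
  have "(\<lambda>n. h1_norm \<Omega> (U n - u)) \<longlonglongrightarrow> 0"
  proof (rule Lim_null_comparison)
    show "\<forall>\<^sub>F n in sequentially. norm (h1_norm \<Omega> (U n - u)) \<le> l2_norm M (U n - u) + l2_norm M (grad \<Omega> (U n - u))"
      using h1_norm_bounds(3,4) by simp
    show "(\<lambda>n. l2_norm M (U n - u) + l2_norm M (grad \<Omega> (U n - u))) \<longlonglongrightarrow> 0"
      using tendsto_add[OF u(2) lim] by simp
  qed
  then have "u \<in> V" by (rule H1_zero_on_closed[OF U uH])
  with lim show ?thesis by blast
qed

text \<open>A form equivalent to the Dirichlet form inherits completeness from it.\<close>

lemma V_riesz:
  assumes p: "semi_inner_space V lincomb p"
    and lower: "\<And>u. u \<in> V \<Longrightarrow> dirichlet_form u u \<le> p u u"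
    and upper: "\<And>u. u \<in> V \<Longrightarrow> p u u \<le> K * dirichlet_form u u"
    and F: "\<And>a b u v. u \<in> V \<Longrightarrow> v \<in> V \<Longrightarrow> F (lincomb a u b v) = a * F u + b * F v"
      "0 \<le> B" "\<And>v. v \<in> V \<Longrightarrow> \<bar>F v\<bar> \<le> B * l2_norm M (grad \<Omega> v)"
  shows "\<exists>u\<in>V. \<forall>v\<in>V. p u v = F v"
proof (rule semi_inner_space.riesz[where V = V and lc = lincomb and p = p and F = F and C = B, OF p])
  show "F (lincomb a u b v) = a * F u + b * F v" if "u \<in> V" "v \<in> V" for a b u v using that by (rule F(1))
  show "V \<noteq> {}" using zero_V by blast
  show "\<bar>F v\<bar> \<le> B * sqrt (p v v)" if v: "v \<in> V" for v
  proof -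
    have "l2_norm M (grad \<Omega> v) \<le> sqrt (p v v)" using lower[OF v] unfolding sqrt_dirichlet_form[symmetric] by simp
    then have "B * l2_norm M (grad \<Omega> v) \<le> B * sqrt (p v v)" using F(2) by (rule mult_left_mono)
    then show ?thesis using F(3)[OF v] by linarith
  qed
  fix U :: "nat \<Rightarrow> 'a \<Rightarrow> real" assume U: "\<And>n. U n \<in> V"
    and Cauchy: "\<And>e. e > 0 \<Longrightarrow> \<exists>N. \<forall>m\<ge>N. \<forall>n\<ge>N. p (lincomb 1 (U m) (- 1) (U n)) (lincomb 1 (U m) (- 1) (U n)) < e"
  have "\<exists>u\<in>V. (\<lambda>n. l2_norm M (grad \<Omega> (U n - u))) \<longlonglongrightarrow> 0"
  proof (rule V_complete[OF U])
    fix e :: real assume e: "e > 0"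
    then have "e\<^sup>2 > 0" by simp
    from Cauchy[OF this] obtain N where N: "\<forall>m\<ge>N. \<forall>n\<ge>N. p (U m - U n) (U m - U n) < e\<^sup>2"
      unfolding diff_eq_lincomb by blast
    have "l2_norm M (grad \<Omega> (U m - U n)) < e" if "m \<ge> N" "n \<ge> N" for m n
    proof (rule power_less_imp_less_base)
      have D: "U m - U n \<in> V" unfolding diff_eq_lincomb by (intro H1_zero_on_lincomb U)
      have "(l2_norm M (grad \<Omega> (U m - U n)))\<^sup>2 \<le> p (U m - U n) (U m - U n)"
        using lower[OF D] by (simp add: dirichlet_form_self)
      also have "\<dots> < e\<^sup>2" using N that by blast
      finally show "(l2_norm M (grad \<Omega> (U m - U n)))\<^sup>2 < e\<^sup>2" .
    qed (use e in simp)
    then show "\<exists>N. \<forall>m\<ge>N. \<forall>n\<ge>N. l2_norm M (grad \<Omega> (U m - U n)) < e" by blast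
  qed
  then obtain u where u: "u \<in> V" and lim: "(\<lambda>n. l2_norm M (grad \<Omega> (U n - u))) \<longlonglongrightarrow> 0" by blast
  have D: "U n - u \<in> V" for n unfolding diff_eq_lincomb by (intro H1_zero_on_lincomb U u)
  have "(\<lambda>n. p (U n - u) (U n - u)) \<longlonglongrightarrow> 0"
  proof (rule Lim_null_comparison)
    have "norm (p (U n - u) (U n - u)) \<le> K * (l2_norm M (grad \<Omega> (U n - u)))\<^sup>2" for n
      using upper[OF D[of n]] semi_inner_space.p_nonneg[OF p D[of n]] by (simp add: dirichlet_form_self)
    then show "\<forall>\<^sub>F n in sequentially. norm (p (U n - u) (U n - u)) \<le> K * (l2_norm M (grad \<Omega> (U n - u)))\<^sup>2" by simp
    show "(\<lambda>n. K * (l2_norm M (grad \<Omega> (U n - u)))\<^sup>2) \<longlonglongrightarrow> 0"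
      using tendsto_mult_left[OF tendsto_power[OF lim, of 2], of K] by simp
  qed
  then show "\<exists>u\<in>V. (\<lambda>n. p (lincomb 1 (U n) (- 1) u) (lincomb 1 (U n) (- 1) u)) \<longlonglongrightarrow> 0"
    using u unfolding diff_eq_lincomb by blast
qed

end

section \<open>The saddle point problem\<close>

locale reaction_problem = friedrichs_space +
  fixes \<zeta> :: "'a \<Rightarrow> real" and \<kappa> :: real
  assumes \<zeta>: "\<zeta> \<in> Linfty M" and \<kappa>: "0 < \<kappa>"
begin

definition react :: "('a \<Rightarrow> real) \<Rightarrow> 'a \<Rightarrow> real" where
  "react u = (\<lambda>x. \<zeta> x * u x)"

definition react_bound :: real where
  "react_bound = (SOME B. 0 \<le> B \<and> (AE x in M. \<bar>\<zeta> x\<bar> \<le> B))"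

lemma react_bound: "0 \<le> react_bound" "AE x in M. \<bar>\<zeta> x\<bar> \<le> react_bound"
proof -
  obtain B where "AE x in M. \<bar>\<zeta> x\<bar> \<le> B" using \<zeta> by (auto simp: Linfty_def)
  then have "AE x in M. \<bar>\<zeta> x\<bar> \<le> max B 0" by eventually_elim simp
  then have "\<exists>B. 0 \<le> B \<and> (AE x in M. \<bar>\<zeta> x\<bar> \<le> B)" by (intro exI[of _ "max B 0"]) simp
  from someI_ex[OF this] show "0 \<le> react_bound" "AE x in M. \<bar>\<zeta> x\<bar> \<le> react_bound" by (auto simp: react_bound_def)
qed

lemma react_L2:
  assumes u: "u \<in> L2 M" shows "react u \<in> L2 M" "l2_norm M (react u) \<le> react_bound * l2_norm M u"
proof -
  have [measurable]: "\<zeta> \<in> borel_measurable M" "u \<in> borel_measurable M"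
    using \<zeta> L2_D(1)[OF u] by (auto simp: Linfty_def)
  have "(\<integral>\<^sup>+x. ennreal ((norm (react u x))\<^sup>2) \<partial>M) \<le> (\<integral>\<^sup>+x. ennreal (react_bound\<^sup>2) * ennreal ((norm (u x))\<^sup>2) \<partial>M)"
  proof (rule nn_integral_mono_AE)
    show "AE x in M. ennreal ((norm (react u x))\<^sup>2) \<le> ennreal (react_bound\<^sup>2) * ennreal ((norm (u x))\<^sup>2)"
      using react_bound(2)
    proof eventually_elim
      fix x assume "\<bar>\<zeta> x\<bar> \<le> react_bound"
      then have "\<bar>\<zeta> x\<bar>\<^sup>2 \<le> react_bound\<^sup>2" by (rule power_mono) simp
      then have "\<bar>\<zeta> x\<bar>\<^sup>2 * (norm (u x))\<^sup>2 \<le> react_bound\<^sup>2 * (norm (u x))\<^sup>2" by (rule mult_right_mono) simp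
      then show "ennreal ((norm (react u x))\<^sup>2) \<le> ennreal (react_bound\<^sup>2) * ennreal ((norm (u x))\<^sup>2)"
        by (simp add: react_def abs_mult power_mult_distrib flip: ennreal_mult)
    qed
  qed
  also have "\<dots> = ennreal (react_bound\<^sup>2) * ennreal ((l2_norm M u)\<^sup>2)"
    by (subst nn_integral_cmult) (simp_all only: nn_integral_L2[OF u], measurable)
  also have "\<dots> = ennreal ((react_bound * l2_norm M u)\<^sup>2)" by (simp add: power_mult_distrib ennreal_mult)
  finally have *: "(\<integral>\<^sup>+x. ennreal ((norm (react u x))\<^sup>2) \<partial>M) \<le> ennreal ((react_bound * l2_norm M u)\<^sup>2)" .
  have "react u \<in> borel_measurable M" unfolding react_def by measurable
  from L2I_nn[OF this *] react_bound(1) l2_norm_nonneg[of M u]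
  show "react u \<in> L2 M" "l2_norm M (react u) \<le> react_bound * l2_norm M u" by simp_all
qed

lemma react_lincomb: "react (lincomb a u b v) = lincomb a (react u) b (react v)"
  by (auto simp: react_def algebra_simps)

lemma react_symmetric: "l2_inner M (react u) v = l2_inner M (react v) u"
  by (simp add: react_def l2_inner_def mult_ac)

lemma dirichlet_V: "semi_inner_space V lincomb dirichlet_form"
proof
  fix u v w :: "'a \<Rightarrow> real" and a b assume u: "u \<in> V" and v: "v \<in> V"
  show "lincomb a u b v \<in> V" using u v by (rule H1_zero_on_lincomb)
  show "dirichlet_form u v = dirichlet_form v u" using u v by (intro dirichlet.p_sym V_H1)
  assume w: "w \<in> V"
  show "dirichlet_form (lincomb a u b v) w = a * dirichlet_form u w + b * dirichlet_form v w"
    using u v w by (intro dirichlet.p_lc V_H1)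
next
  fix u assume "u \<in> V" then show "0 \<le> dirichlet_form u u" by (intro dirichlet.p_nonneg V_H1)
qed

lemma dirichlet_solve:
  assumes "\<And>a b u v. u \<in> V \<Longrightarrow> v \<in> V \<Longrightarrow> F (lincomb a u b v) = a * F u + b * F v"
    and "0 \<le> B" "\<And>v. v \<in> V \<Longrightarrow> \<bar>F v\<bar> \<le> B * l2_norm M (grad \<Omega> v)"
  shows "\<exists>u\<in>V. \<forall>v\<in>V. dirichlet_form u v = F v"
  by (rule V_riesz[where K = 1 and F = F and B = B, OF dirichlet_V _ _ assms]) auto

lemma l2_inner_V_le:
  assumes g: "g \<in> L2 M" and v: "v \<in> V"
  shows "\<bar>l2_inner M g v\<bar> \<le> (l2_norm M g * C) * l2_norm M (grad \<Omega> v)"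
proof -
  have "\<bar>l2_inner M g v\<bar> \<le> l2_norm M g * l2_norm M v" by (intro l2_Cauchy_Schwarz g V_L2 v)
  also have "\<dots> \<le> l2_norm M g * (C * l2_norm M (grad \<Omega> v))"
    by (intro mult_left_mono friedrichs v l2_norm_nonneg)
  finally show ?thesis by (simp add: mult.assoc)
qed

lemma l2_inner_grad_lincomb_right:
  assumes "u \<in> V" "v \<in> V" "g \<in> L2 M"
  shows "l2_inner M g (grad \<Omega> (lincomb a u b v)) = a * l2_inner M g (grad \<Omega> u) + b * l2_inner M g (grad \<Omega> v)"
  using l2_inner_grad_lincomb[OF V_H1[OF assms(1)] V_H1[OF assms(2)] assms(3), of a b]
  by (simp only: l2_inner_commute[of M g])

text \<open>Multiplication by \<open>\<zeta>\<close> followed by the inverse of the weak Laplacian: \<open>lift u\<close> represents the functional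
  \<open>v \<mapsto> (\<zeta>u, v)\<close> in the Dirichlet form.\<close>

definition lift :: "('a \<Rightarrow> real) \<Rightarrow> 'a \<Rightarrow> real" where
  "lift u = (SOME w. w \<in> V \<and> (\<forall>v\<in>V. dirichlet_form w v = l2_inner M (react u) v))"

lemma lift:
  assumes u: "u \<in> V" shows lift_V: "lift u \<in> V" and lift_eq: "v \<in> V \<Longrightarrow> dirichlet_form (lift u) v = l2_inner M (react u) v"
proof -
  have Zu: "react u \<in> L2 M" by (intro react_L2 V_L2 u)
  have "\<exists>w\<in>V. \<forall>v\<in>V. dirichlet_form w v = l2_inner M (react u) v"
    by (rule dirichlet_solve[where B = "l2_norm M (react u) * C"])
      (auto intro!: l2_inner_lincomb_right V_L2 Zu l2_inner_V_le mult_nonneg_nonneg l2_norm_nonneg C_nonneg)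
  then have "\<exists>w. w \<in> V \<and> (\<forall>v\<in>V. dirichlet_form w v = l2_inner M (react u) v)" by blast
  from someI_ex[OF this] show "lift u \<in> V" "v \<in> V \<Longrightarrow> dirichlet_form (lift u) v = l2_inner M (react u) v"
    by (auto simp: lift_def)
qed

text \<open>The form of the Schur complement that remains for \<open>u\<close> after elimination of \<open>\<lambda>\<close>. Its second term is
  \<open>\<kappa> (\<zeta> (lift u), v)\<close>; written symmetrically it is visibly nonnegative.\<close>

definition schur_form :: "('a \<Rightarrow> real) \<Rightarrow> ('a \<Rightarrow> real) \<Rightarrow> real" where
  "schur_form u v = dirichlet_form u v + \<kappa> * dirichlet_form (lift u) (lift v)"

lemma schur_form_V: "semi_inner_space V lincomb schur_form"
proof
  fix u v w :: "'a \<Rightarrow> real" and a b assume u: "u \<in> V" and v: "v \<in> V"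
  show lc: "lincomb a u b v \<in> V" using u v by (rule H1_zero_on_lincomb)
  show "schur_form u v = schur_form v u"
    using dirichlet.p_sym[OF V_H1[OF u] V_H1[OF v]] dirichlet.p_sym[OF V_H1[OF lift_V[OF u]] V_H1[OF lift_V[OF v]]]
    by (simp add: schur_form_def)
  assume w: "w \<in> V"
  have "dirichlet_form (lift (lincomb a u b v)) (lift w) = a * dirichlet_form (lift u) (lift w) + b * dirichlet_form (lift v) (lift w)"
    unfolding lift_eq[OF lc lift_V[OF w]] lift_eq[OF u lift_V[OF w]] lift_eq[OF v lift_V[OF w]] react_lincomb
    by (intro l2_inner_lincomb react_L2 V_L2 u v lift_V w)
  then show "schur_form (lincomb a u b v) w = a * schur_form u w + b * schur_form v w"
    by (simp add: schur_form_def dirichlet.p_lc V_H1 u v w algebra_simps)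
next
  fix u assume "u \<in> V" then show "0 \<le> schur_form u u"
    using \<kappa> by (simp add: schur_form_def dirichlet.p_nonneg V_H1 lift_V)
qed

lemma schur_form_bounds:
  assumes u: "u \<in> V"
  shows "dirichlet_form u u \<le> schur_form u u"
    "schur_form u u \<le> (1 + \<kappa> * (react_bound * C * C)\<^sup>2) * dirichlet_form u u"
proof -
  show "dirichlet_form u u \<le> schur_form u u"
    using \<kappa> dirichlet.p_nonneg[OF V_H1[OF lift_V[OF u]]] by (simp add: schur_form_def)
  let ?t = "l2_norm M (grad \<Omega> (lift u))" and ?g = "l2_norm M (grad \<Omega> u)"
  have "?t * ?t = l2_inner M (react u) (lift u)"
    using lift_eq[OF u lift_V[OF u]] by (simp add: dirichlet_form_self power2_eq_square)
  also have "\<dots> \<le> (l2_norm M (react u) * C) * ?t"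
    using l2_inner_V_le[OF react_L2(1)[OF V_L2(1)[OF u]] lift_V[OF u]] by linarith
  also have "\<dots> \<le> ((react_bound * (C * ?g)) * C) * ?t"
  proof (intro mult_right_mono l2_norm_nonneg C_nonneg)
    have "l2_norm M (react u) \<le> react_bound * l2_norm M u" by (intro react_L2 V_L2 u)
    also have "\<dots> \<le> react_bound * (C * ?g)" by (intro mult_left_mono friedrichs u react_bound)
    finally show "l2_norm M (react u) \<le> react_bound * (C * ?g)" .
  qed
  finally have "?t * ?t \<le> (react_bound * C * C * ?g) * ?t" by (simp add: mult_ac)
  moreover have "0 \<le> react_bound * C * C * ?g"
    using react_bound(1) C_nonneg l2_norm_nonneg by (intro mult_nonneg_nonneg)
  ultimately have "?t \<le> react_bound * C * C * ?g"
    using l2_norm_nonneg[of M "grad \<Omega> (lift u)"] by (cases "?t = 0") auto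
  then have "?t\<^sup>2 \<le> (react_bound * C * C * ?g)\<^sup>2" by (rule power_mono) (rule l2_norm_nonneg)
  then have "\<kappa> * ?t\<^sup>2 \<le> \<kappa> * (react_bound * C * C * ?g)\<^sup>2" using \<kappa> by (intro mult_left_mono) auto
  then show "schur_form u u \<le> (1 + \<kappa> * (react_bound * C * C)\<^sup>2) * dirichlet_form u u"
    by (simp add: schur_form_def dirichlet_form_self power_mult_distrib algebra_simps)
qed

text \<open>The second equation is solved by \<open>l = l0 + \<kappa> lift u\<close>, where \<open>l0\<close> depends only on the data. Inserting
  this into the first one leaves the equation of the Schur complement for \<open>u\<close>.\<close>

lemma reduced_system_solvable:
  assumes q: "q \<in> L2 M" and et: "et \<in> L2 M" and st: "st \<in> L2 M"
  shows "\<exists>u\<in>V. \<exists>l\<in>V.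
    (\<forall>v\<in>V. dirichlet_form u v + l2_inner M (react v) l = l2_inner M et (grad \<Omega> v)) \<and>
    (\<forall>w\<in>V. dirichlet_form l w - \<kappa> * l2_inner M (react u) w = - \<kappa> * (l2_inner M q w + l2_inner M st (grad \<Omega> w)))"
proof -
  have grad_le: "\<bar>l2_inner M g (grad \<Omega> v)\<bar> \<le> l2_norm M g * l2_norm M (grad \<Omega> v)" if "g \<in> L2 M" "v \<in> V" for g v
    using that by (intro l2_Cauchy_Schwarz V_L2)
  have "\<exists>l0\<in>V. \<forall>w\<in>V. dirichlet_form l0 w = - \<kappa> * (l2_inner M q w + l2_inner M st (grad \<Omega> w))"
  proof (rule dirichlet_solve[where B = "\<kappa> * (l2_norm M q * C + l2_norm M st)"])
    fix a b u v assume u: "u \<in> V" and v: "v \<in> V"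
    show "- \<kappa> * (l2_inner M q (lincomb a u b v) + l2_inner M st (grad \<Omega> (lincomb a u b v)))
      = a * (- \<kappa> * (l2_inner M q u + l2_inner M st (grad \<Omega> u))) + b * (- \<kappa> * (l2_inner M q v + l2_inner M st (grad \<Omega> v)))"
      by (simp add: l2_inner_lincomb_right l2_inner_grad_lincomb_right V_L2 u v q st algebra_simps)
  next
    show "0 \<le> \<kappa> * (l2_norm M q * C + l2_norm M st)"
      using \<kappa> C_nonneg by (intro mult_nonneg_nonneg add_nonneg_nonneg l2_norm_nonneg) auto
  next
    fix w assume w: "w \<in> V"
    have "\<bar>l2_inner M q w + l2_inner M st (grad \<Omega> w)\<bar> \<le> (l2_norm M q * C + l2_norm M st) * l2_norm M (grad \<Omega> w)"
      using l2_inner_V_le[OF q w] grad_le[OF st w] by (simp add: distrib_right)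
    then have "\<kappa> * \<bar>l2_inner M q w + l2_inner M st (grad \<Omega> w)\<bar> \<le> \<kappa> * ((l2_norm M q * C + l2_norm M st) * l2_norm M (grad \<Omega> w))"
      using \<kappa> by (intro mult_left_mono) auto
    then show "\<bar>- \<kappa> * (l2_inner M q w + l2_inner M st (grad \<Omega> w))\<bar> \<le> \<kappa> * (l2_norm M q * C + l2_norm M st) * l2_norm M (grad \<Omega> w)"
      using \<kappa> by (simp add: abs_mult mult.assoc)
  qed
  then obtain l0 where l0: "l0 \<in> V" "\<And>w. w \<in> V \<Longrightarrow> dirichlet_form l0 w = - \<kappa> * (l2_inner M q w + l2_inner M st (grad \<Omega> w))"
    by blast
  have Zl0: "react l0 \<in> L2 M" by (intro react_L2 V_L2 l0)
  have "\<exists>u\<in>V. \<forall>v\<in>V. schur_form u v = l2_inner M et (grad \<Omega> v) - l2_inner M (react l0) v"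
  proof (rule V_riesz[OF schur_form_V schur_form_bounds, where B = "l2_norm M et + l2_norm M (react l0) * C"])
    fix a b u v assume u: "u \<in> V" and v: "v \<in> V"
    show "l2_inner M et (grad \<Omega> (lincomb a u b v)) - l2_inner M (react l0) (lincomb a u b v)
      = a * (l2_inner M et (grad \<Omega> u) - l2_inner M (react l0) u) + b * (l2_inner M et (grad \<Omega> v) - l2_inner M (react l0) v)"
      by (simp add: l2_inner_lincomb_right l2_inner_grad_lincomb_right V_L2 u v Zl0 et algebra_simps)
  next
    show "0 \<le> l2_norm M et + l2_norm M (react l0) * C"
      by (intro add_nonneg_nonneg mult_nonneg_nonneg l2_norm_nonneg C_nonneg)
  next
    fix v assume v: "v \<in> V"
    show "\<bar>l2_inner M et (grad \<Omega> v) - l2_inner M (react l0) v\<bar> \<le> (l2_norm M et + l2_norm M (react l0) * C) * l2_norm M (grad \<Omega> v)"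
      using grad_le[OF et v] l2_inner_V_le[OF Zl0 v] by (simp add: distrib_right)
  qed
  then obtain u where u: "u \<in> V" "\<And>v. v \<in> V \<Longrightarrow> schur_form u v = l2_inner M et (grad \<Omega> v) - l2_inner M (react l0) v"
    by blast
  define l where "l = lincomb 1 l0 \<kappa> (lift u)"
  have l: "l \<in> V" unfolding l_def by (intro H1_zero_on_lincomb l0 lift_V u)
  have "dirichlet_form u v + l2_inner M (react v) l = l2_inner M et (grad \<Omega> v)" if v: "v \<in> V" for v
  proof -
    have "l2_inner M (react v) l = l2_inner M (react v) l0 + \<kappa> * l2_inner M (react v) (lift u)"
      unfolding l_def by (subst l2_inner_lincomb_right) (auto intro: react_L2 V_L2 v l0 lift_V u)
    also have "l2_inner M (react v) (lift u) = dirichlet_form (lift u) (lift v)"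
      using lift_eq[OF v lift_V[OF u(1)]] dirichlet.p_sym[OF V_H1[OF lift_V[OF v]] V_H1[OF lift_V[OF u(1)]]] by simp
    also have "l2_inner M (react v) l0 = l2_inner M (react l0) v" by (rule react_symmetric)
    finally show ?thesis using u(2)[OF v] by (simp add: schur_form_def)
  qed
  moreover have "dirichlet_form l w - \<kappa> * l2_inner M (react u) w = - \<kappa> * (l2_inner M q w + l2_inner M st (grad \<Omega> w))" if w: "w \<in> V" for w
  proof -
    have "dirichlet_form l w = 1 * dirichlet_form l0 w + \<kappa> * dirichlet_form (lift u) w"
      unfolding l_def by (intro dirichlet.p_lc V_H1 l0(1) lift_V u(1) w)
    then show ?thesis using l0(2)[OF w] lift_eq[OF u(1) w] by simp
  qed
  ultimately show ?thesis using u(1) l by blast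
qed

lemma lagrangian_expand:
  assumes "q \<in> L2 M" "et \<in> L2 M" "st \<in> L2 M" "u \<in> V" "e \<in> L2 M" "s \<in> L2 M" "l \<in> V" "m \<in> L2 M"
  shows "lagrangian \<Omega> \<zeta> \<kappa> (q, et, st) (u, e, s) (l, m) =
    1 / 2 * (l2_inner M e e - 2 * l2_inner M e et + l2_inner M et et)
    + \<kappa> / 2 * (l2_inner M s s - 2 * l2_inner M s st + l2_inner M st st)
    - l2_inner M s (grad \<Omega> l) + (l2_inner M (react u) l - l2_inner M q l)
    + (l2_inner M e m - l2_inner M (grad \<Omega> u) m)"
proof -
  have "(\<lambda>x. \<zeta> x * u x - q x) = react u - q" by (auto simp: react_def fun_eq_iff)
  then show ?thesis using assms
    by (simp add: l2_norm_diff_sq l2_inner_diff_left react_L2 V_L2)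
qed

text \<open>The optimality conditions, obtained by varying \<open>u\<close>, \<open>e\<close>, \<open>s\<close>, \<open>l\<close> and \<open>m\<close> in turn.\<close>

definition optimal :: "'a data \<Rightarrow> 'a primal \<Rightarrow> 'a dual \<Rightarrow> bool" where
  "optimal = (\<lambda>(q, et, st) (u, e, s) (l, m).
     u \<in> V \<and> e \<in> L2 M \<and> s \<in> L2 M \<and> l \<in> V \<and> m \<in> L2 M \<and>
     (\<forall>v\<in>V. l2_inner M (react v) l = l2_inner M (grad \<Omega> v) m) \<and>
     (\<forall>f\<in>L2 M. l2_inner M f e + l2_inner M f m = l2_inner M f et) \<and>
     (\<forall>f\<in>L2 M. \<kappa> * l2_inner M f s - l2_inner M f (grad \<Omega> l) = \<kappa> * l2_inner M f st) \<and>
     (\<forall>w\<in>V. l2_inner M (react u) w - l2_inner M s (grad \<Omega> w) = l2_inner M q w) \<and>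
     (\<forall>f\<in>L2 M. l2_inner M e f = l2_inner M (grad \<Omega> u) f))"

text \<open>Along a line through the saddle point the Lagrangian is a polynomial of degree at most two in the
  parameter \<open>t\<close>, with an extremum at \<open>t = 0\<close>; so its linear coefficient vanishes.\<close>

lemma saddle_point_imp_optimal:
  assumes d: "q \<in> L2 M" "et \<in> L2 M" "st \<in> L2 M" and sol: "P2_solution \<Omega> \<Gamma> \<zeta> \<kappa> (q, et, st) (u, e, s) (l, m)"
  shows "optimal (q, et, st) (u, e, s) (l, m)"
proof -
  let ?L = "lagrangian \<Omega> \<zeta> \<kappa> (q, et, st)"
  have mem: "u \<in> V" "e \<in> L2 M" "s \<in> L2 M" "l \<in> V" "m \<in> L2 M"
    using sol by (auto simp: P2_solution_def space_X_def space_Y_def)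
  have max: "?L (u, e, s) (l', m') \<le> ?L (u, e, s) (l, m)" if "l' \<in> V" "m' \<in> L2 M" for l' m'
    using sol that by (auto simp: P2_solution_def space_Y_def)
  have min: "?L (u, e, s) (l, m) \<le> ?L (u', e', s') (l, m)" if "u' \<in> V" "e' \<in> L2 M" "s' \<in> L2 M" for u' e' s'
    using sol that by (auto simp: P2_solution_def space_X_def)
  have lc: "(\<lambda>x. 1 *\<^sub>R f x + t *\<^sub>R g x) \<in> L2 M" if "f \<in> L2 M" "g \<in> L2 M" for f g :: "'a \<Rightarrow> 'a" and t
    using that by (rule L2_lincomb)
  have "l2_inner M (react v) l = l2_inner M (grad \<Omega> v) m" if v: "v \<in> V" for v
  proof -
    have "l2_inner M (react v) l - l2_inner M (grad \<Omega> v) m = 0"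
    proof (rule linear_term_zero)
      fix t :: real
      have V': "lincomb 1 u t v \<in> V" by (intro H1_zero_on_lincomb mem v)
      have "l2_inner M (react (lincomb 1 u t v)) l = 1 * l2_inner M (react u) l + t * l2_inner M (react v) l"
        unfolding react_lincomb by (intro l2_inner_lincomb react_L2 V_L2 mem v)
      moreover have "l2_inner M (grad \<Omega> (lincomb 1 u t v)) m = 1 * l2_inner M (grad \<Omega> u) m + t * l2_inner M (grad \<Omega> v) m"
        by (intro l2_inner_grad_lincomb V_H1 mem v)
      ultimately have "0 \<le> t * (l2_inner M (react v) l - l2_inner M (grad \<Omega> v) m)"
        using min[OF V' mem(2,3)] unfolding lagrangian_expand[OF d V' mem(2-5)] lagrangian_expand[OF d mem]
        by (simp add: algebra_simps)
      then show "0 \<le> 2 * t * (l2_inner M (react v) l - l2_inner M (grad \<Omega> v) m) + t\<^sup>2 * 0" by simp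
    qed simp
    then show ?thesis by simp
  qed
  moreover have "l2_inner M f e + l2_inner M f m = l2_inner M f et" if f: "f \<in> L2 M" for f
  proof -
    have "l2_inner M f e + l2_inner M f m - l2_inner M f et = 0"
    proof (rule linear_term_zero)
      fix t :: real
      let ?e = "\<lambda>x. 1 *\<^sub>R e x + t *\<^sub>R f x"
      show "0 \<le> 2 * t * (l2_inner M f e + l2_inner M f m - l2_inner M f et) + t\<^sup>2 * l2_inner M f f"
        using min[OF mem(1) lc[OF mem(2) f, of t] mem(3)]
        unfolding lagrangian_expand[OF d mem(1) lc[OF mem(2) f] mem(3-5)] lagrangian_expand[OF d mem]
          L2.p_lc_lc[OF mem(2) f] L2.p_lc[OF mem(2) f d(2)] L2.p_lc[OF mem(2) f mem(5)] l2_inner_commute[of M e f]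
        by (simp add: field_simps)
    qed (rule l2_inner_self_nonneg)
    then show ?thesis by simp
  qed
  moreover have "\<kappa> * l2_inner M f s - l2_inner M f (grad \<Omega> l) = \<kappa> * l2_inner M f st" if f: "f \<in> L2 M" for f
  proof -
    have "\<kappa> * l2_inner M f s - l2_inner M f (grad \<Omega> l) - \<kappa> * l2_inner M f st = 0"
    proof (rule linear_term_zero)
      fix t :: real
      show "0 \<le> 2 * t * (\<kappa> * l2_inner M f s - l2_inner M f (grad \<Omega> l) - \<kappa> * l2_inner M f st) + t\<^sup>2 * (\<kappa> * l2_inner M f f)"
        using min[OF mem(1,2) lc[OF mem(3) f, of t]]
        unfolding lagrangian_expand[OF d mem(1,2) lc[OF mem(3) f] mem(4,5)] lagrangian_expand[OF d mem]
          L2.p_lc_lc[OF mem(3) f] L2.p_lc[OF mem(3) f d(3)] L2.p_lc[OF mem(3) f V_L2(2)[OF mem(4)]] l2_inner_commute[of M s f]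
        by (simp add: field_simps)
    qed (use \<kappa> l2_inner_self_nonneg in \<open>auto intro!: mult_nonneg_nonneg\<close>)
    then show ?thesis by simp
  qed
  moreover have "l2_inner M (react u) w - l2_inner M s (grad \<Omega> w) = l2_inner M q w" if w: "w \<in> V" for w
  proof -
    have "l2_inner M q w - l2_inner M (react u) w + l2_inner M s (grad \<Omega> w) = 0"
    proof (rule linear_term_zero)
      fix t :: real
      have V': "lincomb 1 l t w \<in> V" by (intro H1_zero_on_lincomb mem w)
      have "l2_inner M g (lincomb 1 l t w) = 1 * l2_inner M g l + t * l2_inner M g w" if "g \<in> L2 M" for g
        by (intro l2_inner_lincomb_right V_L2 mem w that)
      moreover have "l2_inner M s (grad \<Omega> (lincomb 1 l t w)) = 1 * l2_inner M s (grad \<Omega> l) + t * l2_inner M s (grad \<Omega> w)"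
        by (intro l2_inner_grad_lincomb_right mem w)
      ultimately have "0 \<le> t * (l2_inner M q w - l2_inner M (react u) w + l2_inner M s (grad \<Omega> w))"
        using max[OF V' mem(5)] unfolding lagrangian_expand[OF d mem(1-3) V' mem(5)] lagrangian_expand[OF d mem]
        by (simp add: d(1) react_L2(1)[OF V_L2(1)[OF mem(1)]] algebra_simps)
      then show "0 \<le> 2 * t * (l2_inner M q w - l2_inner M (react u) w + l2_inner M s (grad \<Omega> w)) + t\<^sup>2 * 0" by simp
    qed simp
    then show ?thesis by simp
  qed
  moreover have "l2_inner M e f = l2_inner M (grad \<Omega> u) f" if f: "f \<in> L2 M" for f
  proof -
    have "l2_inner M (grad \<Omega> u) f - l2_inner M e f = 0"
    proof (rule linear_term_zero)
      fix t :: real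
      have "0 \<le> t * (l2_inner M (grad \<Omega> u) f - l2_inner M e f)"
        using max[OF mem(4) lc[OF mem(5) f, of t]]
        unfolding lagrangian_expand[OF d mem(1-4) lc[OF mem(5) f]] lagrangian_expand[OF d mem]
          L2.p_lc_right[OF mem(5) f mem(2)] L2.p_lc_right[OF mem(5) f V_L2(2)[OF mem(1)]]
        by (simp add: algebra_simps)
      then show "0 \<le> 2 * t * (l2_inner M (grad \<Omega> u) f - l2_inner M e f) + t\<^sup>2 * 0" by simp
    qed simp
    then show ?thesis by simp
  qed
  ultimately show ?thesis using mem by (simp add: optimal_def)
qed

text \<open>Under the optimality conditions the Lagrangian is constant in the dual variable, and in the primal
  variable it exceeds its value at the solution by the quadratic terms alone.\<close>

lemma optimal_imp_saddle_point:
  assumes d: "q \<in> L2 M" "et \<in> L2 M" "st \<in> L2 M" and opt: "optimal (q, et, st) (u, e, s) (l, m)"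
  shows "P2_solution \<Omega> \<Gamma> \<zeta> \<kappa> (q, et, st) (u, e, s) (l, m)"
proof -
  have mem: "u \<in> V" "e \<in> L2 M" "s \<in> L2 M" "l \<in> V" "m \<in> L2 M"
    and o1: "\<And>v. v \<in> V \<Longrightarrow> l2_inner M (react v) l = l2_inner M (grad \<Omega> v) m"
    and o2: "\<And>f. f \<in> L2 M \<Longrightarrow> l2_inner M f e + l2_inner M f m = l2_inner M f et"
    and o3: "\<And>f. f \<in> L2 M \<Longrightarrow> \<kappa> * l2_inner M f s - l2_inner M f (grad \<Omega> l) = \<kappa> * l2_inner M f st"
    and o4: "\<And>w. w \<in> V \<Longrightarrow> l2_inner M (react u) w - l2_inner M s (grad \<Omega> w) = l2_inner M q w"
    and o5: "\<And>f. f \<in> L2 M \<Longrightarrow> l2_inner M e f = l2_inner M (grad \<Omega> u) f"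
    using opt by (auto simp: optimal_def)
  let ?L = "lagrangian \<Omega> \<zeta> \<kappa> (q, et, st)"
  have "?L (u, e, s) (l', m') \<le> ?L (u, e, s) (l, m)" if "l' \<in> V" "m' \<in> L2 M" for l' m'
    unfolding lagrangian_expand[OF d mem(1-3) that] lagrangian_expand[OF d mem]
    using o4[OF that(1)] o4[OF mem(4)] o5[OF that(2)] o5[OF mem(5)] by simp
  moreover have "?L (u, e, s) (l, m) \<le> ?L (u', e', s') (l, m)" if t: "u' \<in> V" "e' \<in> L2 M" "s' \<in> L2 M" for u' e' s'
  proof -
    have "?L (u', e', s') (l, m) - ?L (u, e, s) (l, m) = 1 / 2 * (l2_norm M (e' - e))\<^sup>2 + \<kappa> / 2 * (l2_norm M (s' - s))\<^sup>2"
      unfolding lagrangian_expand[OF d t mem(4,5)] lagrangian_expand[OF d mem] l2_norm_diff_sq[OF t(2) mem(2)] l2_norm_diff_sq[OF t(3) mem(3)]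
      using o1[OF t(1)] o1[OF mem(1)] o2[OF t(2)] o2[OF mem(2)] o3[OF t(3)] o3[OF mem(3)]
      by (simp add: algebra_simps) (simp add: field_simps)
    moreover have "0 \<le> 1 / 2 * (l2_norm M (e' - e))\<^sup>2 + \<kappa> / 2 * (l2_norm M (s' - s))\<^sup>2"
      using \<kappa> by (intro add_nonneg_nonneg mult_nonneg_nonneg) auto
    ultimately show ?thesis by linarith
  qed
  ultimately show ?thesis using mem by (auto simp: P2_solution_def space_X_def space_Y_def)
qed

lemma saddle_point_exists:
  assumes d: "q \<in> L2 M" "et \<in> L2 M" "st \<in> L2 M"
  shows "\<exists>x y. P2_solution \<Omega> \<Gamma> \<zeta> \<kappa> (q, et, st) x y"
proof -
  obtain u l where u: "u \<in> V" and l: "l \<in> V"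
    and r1: "\<And>v. v \<in> V \<Longrightarrow> dirichlet_form u v + l2_inner M (react v) l = l2_inner M et (grad \<Omega> v)"
    and r2: "\<And>w. w \<in> V \<Longrightarrow> dirichlet_form l w - \<kappa> * l2_inner M (react u) w = - \<kappa> * (l2_inner M q w + l2_inner M st (grad \<Omega> w))"
    using reduced_system_solvable[OF d] by blast
  define m where "m = (\<lambda>x. 1 *\<^sub>R et x + (- 1) *\<^sub>R grad \<Omega> u x)"
  define s where "s = (\<lambda>x. 1 *\<^sub>R st x + (1 / \<kappa>) *\<^sub>R grad \<Omega> l x)"
  have m: "m \<in> L2 M" and s: "s \<in> L2 M" unfolding m_def s_def by (intro L2_lincomb d V_L2 u l)+
  have im: "l2_inner M f m = l2_inner M f et - l2_inner M f (grad \<Omega> u)" if "f \<in> L2 M" for f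
    unfolding m_def using L2.p_lc_right[OF d(2) V_L2(2)[OF u] that, of 1 "- 1"] by simp
  have is_: "l2_inner M f s = l2_inner M f st + 1 / \<kappa> * l2_inner M f (grad \<Omega> l)" if "f \<in> L2 M" for f
    unfolding s_def using L2.p_lc_right[OF d(3) V_L2(2)[OF l] that, of 1 "1 / \<kappa>"] by simp
  have "optimal (q, et, st) (u, grad \<Omega> u, s) (l, m)"
    unfolding optimal_def
  proof (simp, intro conjI ballI)
    fix v assume v: "v \<in> V"
    show "l2_inner M (react v) l = l2_inner M (grad \<Omega> v) m"
      using r1[OF v] im[OF V_L2(2)[OF v]] l2_inner_commute[of M "grad \<Omega> u" "grad \<Omega> v"]
        l2_inner_commute[of M et "grad \<Omega> v"] unfolding dirichlet_form_def by linarith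
    show "l2_inner M (react u) v - l2_inner M s (grad \<Omega> v) = l2_inner M q v"
    proof -
      have "dirichlet_form l v = \<kappa> * (l2_inner M (react u) v - l2_inner M q v - l2_inner M st (grad \<Omega> v))"
        using r2[OF v] by (simp add: algebra_simps)
      then have "1 / \<kappa> * l2_inner M (grad \<Omega> v) (grad \<Omega> l) = l2_inner M (react u) v - l2_inner M q v - l2_inner M st (grad \<Omega> v)"
        using \<kappa> by (simp add: dirichlet_form_def l2_inner_commute[of M "grad \<Omega> l" "grad \<Omega> v"])
      then show ?thesis
        using is_[OF V_L2(2)[OF v]] l2_inner_commute[of M s "grad \<Omega> v"] l2_inner_commute[of M st "grad \<Omega> v"] by linarith
    qed
  next
    fix f :: "'a \<Rightarrow> 'a" assume f: "f \<in> L2 M"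
    show "l2_inner M f (grad \<Omega> u) + l2_inner M f m = l2_inner M f et" by (simp add: im f)
    show "\<kappa> * l2_inner M f s - l2_inner M f (grad \<Omega> l) = \<kappa> * l2_inner M f st"
      using \<kappa> by (simp add: is_ f algebra_simps)
  qed (use u l m s V_L2 in auto)
  from optimal_imp_saddle_point[OF d this] show ?thesis by blast
qed

lemma optimal_diff:
  assumes "optimal (q, et, st) (u, e, s) (l, m)" "optimal (q', et', st') (u', e', s') (l', m')"
    and d: "q \<in> L2 M" "et \<in> L2 M" "st \<in> L2 M" "q' \<in> L2 M" "et' \<in> L2 M" "st' \<in> L2 M"
  shows "optimal (q - q', et - et', st - st') (u - u', e - e', s - s') (l - l', m - m')"
proof -
  have mem: "u \<in> V" "e \<in> L2 M" "s \<in> L2 M" "l \<in> V" "m \<in> L2 M" "u' \<in> V" "e' \<in> L2 M" "s' \<in> L2 M" "l' \<in> V" "m' \<in> L2 M"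
    using assms by (auto simp: optimal_def)
  have dV: "u - u' \<in> V" "l - l' \<in> V" unfolding diff_eq_lincomb by (intro H1_zero_on_lincomb mem)+
  have r: "l2_inner M h (f - g) = l2_inner M h f - l2_inner M h g"
    if "f \<in> L2 M" "g \<in> L2 M" "h \<in> L2 M" for f g h :: "'a \<Rightarrow> 'c::euclidean_space"
    using l2_inner_diff_left[OF that] by (simp only: l2_inner_commute[of M h])
  have gr: "l2_inner M (grad \<Omega> (f - g)) h = l2_inner M (grad \<Omega> f) h - l2_inner M (grad \<Omega> g) h"
    if "f \<in> V" "g \<in> V" "h \<in> L2 M" for f g h
    using l2_inner_grad_lincomb[OF V_H1[OF that(1)] V_H1[OF that(2)] that(3), of 1 "- 1"]
    unfolding diff_eq_lincomb by simp
  have gr': "l2_inner M h (grad \<Omega> (f - g)) = l2_inner M h (grad \<Omega> f) - l2_inner M h (grad \<Omega> g)"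
    if "f \<in> V" "g \<in> V" "h \<in> L2 M" for f g h
    using gr[OF that] by (simp only: l2_inner_commute[of M h])
  have Zd: "react (u - u') = react u - react u'" by (auto simp: react_def fun_eq_iff algebra_simps)
  note L = L2_diff V_L2 react_L2(1) mem d
  show ?thesis
    unfolding optimal_def
  proof (simp, intro conjI ballI)
    show "u - u' \<in> V" "l - l' \<in> V" by (rule dV)+
    show "e - e' \<in> L2 M" "s - s' \<in> L2 M" "m - m' \<in> L2 M" by (intro L2_diff mem)+
  next
    fix v assume v: "v \<in> V"
    show "l2_inner M (react v) (l - l') = l2_inner M (grad \<Omega> v) (m - m')"
      using assms(1,2) v by (simp add: optimal_def r L)
    show "l2_inner M (react (u - u')) v - l2_inner M (s - s') (grad \<Omega> v) = l2_inner M (q - q') v"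
      using assms(1,2) v by (simp add: optimal_def Zd l2_inner_diff_left L, (smt (verit))?)
  next
    fix f :: "'a \<Rightarrow> 'a" assume f: "f \<in> L2 M"
    show "l2_inner M f (e - e') + l2_inner M f (m - m') = l2_inner M f (et - et')"
      using assms(1,2) f by (simp add: optimal_def r L, (smt (verit))?)
    show "\<kappa> * l2_inner M f (s - s') - l2_inner M f (grad \<Omega> (l - l')) = \<kappa> * l2_inner M f (st - st')"
      using assms(1,2) f by (simp add: optimal_def r gr' L algebra_simps, (smt (verit))?)
    show "l2_inner M (e - e') f = l2_inner M (grad \<Omega> (u - u')) f"
      using assms(1,2) f by (simp add: optimal_def gr l2_inner_diff_left L)
  qed
qed

text \<open>Testing the two reduced equations with \<open>u\<close> and \<open>l\<close>, the terms with \<open>\<zeta>\<close> cancel in the sum, which gives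
  the identity named \<open>energy\<close>. The bounds of \<open>m\<close> and \<open>s\<close> follow from those of the gradients, and the
  constant only collects the contributions of the five components.\<close>

lemma optimal_bound:
  assumes opt: "optimal (q, et, st) (u, e, s) (l, m)" and d: "q \<in> L2 M" "et \<in> L2 M" "st \<in> L2 M"
  shows "norm_XY \<Omega> \<kappa> ((u, e, s), (l, m)) \<le> sqrt (7 * (1 + \<kappa> * (C + 1)\<^sup>2) + 2 * \<kappa> + 2) * data_norm \<Omega> (q, et, st)"
proof -
  have mem: "u \<in> V" "e \<in> L2 M" "s \<in> L2 M" "l \<in> V" "m \<in> L2 M"
    and o1: "\<And>v. v \<in> V \<Longrightarrow> l2_inner M (react v) l = l2_inner M (grad \<Omega> v) m"
    and o2: "\<And>f. f \<in> L2 M \<Longrightarrow> l2_inner M f e + l2_inner M f m = l2_inner M f et"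
    and o3: "\<And>f. f \<in> L2 M \<Longrightarrow> \<kappa> * l2_inner M f s - l2_inner M f (grad \<Omega> l) = \<kappa> * l2_inner M f st"
    and o4: "\<And>w. w \<in> V \<Longrightarrow> l2_inner M (react u) w - l2_inner M s (grad \<Omega> w) = l2_inner M q w"
    and o5: "\<And>f. f \<in> L2 M \<Longrightarrow> l2_inner M e f = l2_inner M (grad \<Omega> u) f"
    using opt by (auto simp: optimal_def)
  note gu = V_L2(2)[OF mem(1)] and gl = V_L2(2)[OF mem(4)]
  define A where "A = l2_norm M (grad \<Omega> u)"
  define B where "B = l2_norm M (grad \<Omega> l)"
  define D where "D = data_norm \<Omega> (q, et, st)"
  have A0: "0 \<le> A" and B0: "0 \<le> B" by (simp_all add: A_def B_def l2_norm_nonneg)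
  have D_ge: "l2_norm M q \<le> D" "l2_norm M et \<le> D" "l2_norm M st \<le> D" "0 \<le> D"
    unfolding D_def by (auto intro!: real_le_rsqrt)
  have AA: "l2_inner M (grad \<Omega> u) (grad \<Omega> u) = A\<^sup>2" and BB: "l2_inner M (grad \<Omega> l) (grad \<Omega> l) = B\<^sup>2"
    by (simp_all add: A_def B_def l2_norm_sq)
  have ee: "l2_inner M e e = A\<^sup>2"
    using o5[OF mem(2)] o5[OF gu] by (simp add: AA l2_inner_commute[of M "grad \<Omega> u" e])
  have energy: "A\<^sup>2 + 1 / \<kappa> * B\<^sup>2 = l2_inner M (grad \<Omega> u) et - l2_inner M q l - l2_inner M st (grad \<Omega> l)"
  proof -
    have "l2_inner M (react u) l = l2_inner M (grad \<Omega> u) et - A\<^sup>2"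
      using o1[OF mem(1)] o2[OF gu] o5[OF gu] by (simp add: AA l2_inner_commute[of M "grad \<Omega> u" e])
    moreover have "l2_inner M s (grad \<Omega> l) = l2_inner M st (grad \<Omega> l) + 1 / \<kappa> * B\<^sup>2"
    proof -
      have "\<kappa> * l2_inner M s (grad \<Omega> l) = \<kappa> * l2_inner M st (grad \<Omega> l) + B\<^sup>2"
        using o3[OF gl] by (simp add: BB l2_inner_commute[of M "grad \<Omega> l" s] l2_inner_commute[of M "grad \<Omega> l" st])
      then show ?thesis using \<kappa> by (simp add: field_simps)
    qed
    ultimately show ?thesis using o4[OF mem(4)] by simp
  qed
  have "l2_inner M (grad \<Omega> u) et \<le> A * D"
  proof -
    have "l2_inner M (grad \<Omega> u) et \<le> A * l2_norm M et"
      using l2_Cauchy_Schwarz[OF gu d(2)] by (simp add: A_def)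
    also have "\<dots> \<le> A * D" using D_ge A0 by (intro mult_left_mono)
    finally show ?thesis .
  qed
  moreover have "- l2_inner M q l \<le> (D * C) * B"
  proof -
    have "- l2_inner M q l \<le> (l2_norm M q * C) * B" using l2_inner_V_le[OF d(1) mem(4)] by (simp add: B_def)
    also have "\<dots> \<le> (D * C) * B" using D_ge B0 C_nonneg by (intro mult_right_mono)
    finally show ?thesis .
  qed
  moreover have "- l2_inner M st (grad \<Omega> l) \<le> D * B"
  proof -
    have "- l2_inner M st (grad \<Omega> l) \<le> l2_norm M st * B" using l2_Cauchy_Schwarz[OF d(3) gl] by (simp add: B_def)
    also have "\<dots> \<le> D * B" using D_ge B0 by (intro mult_right_mono)
    finally show ?thesis .
  qed
  ultimately have 1: "A\<^sup>2 + 1 / \<kappa> * B\<^sup>2 \<le> A * D + (C + 1) * D * B"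
    unfolding energy by (simp add: algebra_simps)
  define K where "K = 1 + \<kappa> * (C + 1)\<^sup>2"
  (* Absorb half of each square on the left by Young's inequality. *)
  have K: "A\<^sup>2 + 1 / \<kappa> * B\<^sup>2 \<le> K * D\<^sup>2"
  proof -
    have "2 * (A * D) \<le> A\<^sup>2 + D\<^sup>2" using sum_squares_bound[of A D] by simp
    moreover have "2 * ((C + 1) * D * B) \<le> \<kappa> * (C + 1)\<^sup>2 * D\<^sup>2 + 1 / \<kappa> * B\<^sup>2"
    proof -
      have "0 \<le> (\<kappa> * (C + 1) * D - B)\<^sup>2 / \<kappa>" using \<kappa> by simp
      also have "\<dots> = \<kappa> * (C + 1)\<^sup>2 * D\<^sup>2 + 1 / \<kappa> * B\<^sup>2 - 2 * ((C + 1) * D * B)"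
        using \<kappa> by (simp add: power2_eq_square field_simps)
      finally show ?thesis by simp
    qed
    ultimately show ?thesis using 1 by (simp add: K_def algebra_simps)
  qed
  have A2: "A\<^sup>2 \<le> K * D\<^sup>2" and B2: "1 / \<kappa> * B\<^sup>2 \<le> K * D\<^sup>2"
    using K \<kappa> by (auto intro: order_trans[rotated])
  have mm: "(l2_norm M m)\<^sup>2 \<le> 2 * D\<^sup>2 + 2 * A\<^sup>2"
  proof -
    have "l2_inner M m m = l2_inner M m et - l2_inner M m (grad \<Omega> u)"
      using o2[OF mem(5)] o5[OF mem(5)] by (simp add: l2_inner_commute[of M m e] l2_inner_commute[of M m "grad \<Omega> u"])
    also have "\<dots> \<le> l2_norm M m * D + l2_norm M m * A"
    proof -
      have "l2_inner M m et \<le> l2_norm M m * l2_norm M et" using l2_Cauchy_Schwarz[OF mem(5) d(2)] by simp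
      moreover have "l2_norm M m * l2_norm M et \<le> l2_norm M m * D" using D_ge l2_norm_nonneg by (intro mult_left_mono)
      moreover have "- l2_inner M m (grad \<Omega> u) \<le> l2_norm M m * A" using l2_Cauchy_Schwarz[OF mem(5) gu] by (simp add: A_def)
      ultimately show ?thesis by linarith
    qed
    finally have "(l2_norm M m)\<^sup>2 \<le> l2_norm M m * D + l2_norm M m * A" by (simp add: l2_norm_sq)
    moreover have "0 \<le> (l2_norm M m - 2 * D)\<^sup>2" "0 \<le> (l2_norm M m - 2 * A)\<^sup>2" by simp_all
    ultimately show ?thesis by (simp add: power2_eq_square algebra_simps)
  qed
  have ss: "\<kappa> * (l2_norm M s)\<^sup>2 \<le> 2 * \<kappa> * D\<^sup>2 + 2 * (1 / \<kappa> * B\<^sup>2)"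
  proof -
    let ?s = "l2_norm M s"
    have "\<kappa> * ?s\<^sup>2 = \<kappa> * l2_inner M s st + l2_inner M s (grad \<Omega> l)"
      using o3[OF mem(3)] by (simp add: l2_norm_sq)
    also have "\<dots> \<le> \<kappa> * (?s * D) + ?s * B"
    proof (intro add_mono mult_left_mono)
      have "l2_inner M s st \<le> ?s * l2_norm M st" using l2_Cauchy_Schwarz[OF mem(3) d(3)] by simp
      also have "\<dots> \<le> ?s * D" using D_ge l2_norm_nonneg by (intro mult_left_mono)
      finally show "l2_inner M s st \<le> ?s * D" .
      show "l2_inner M s (grad \<Omega> l) \<le> ?s * B" using l2_Cauchy_Schwarz[OF mem(3) gl] by (simp add: B_def)
    qed (use \<kappa> in simp)
    finally have a: "\<kappa> * ?s\<^sup>2 \<le> \<kappa> * (?s * D) + ?s * B" .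
    have b: "4 * (?s * D) \<le> ?s\<^sup>2 + 4 * D\<^sup>2"
      using zero_le_power2[of "?s - 2 * D"] by (simp add: power2_eq_square algebra_simps)
    have "\<kappa> * (4 * (?s * D)) \<le> \<kappa> * (?s\<^sup>2 + 4 * D\<^sup>2)" using b \<kappa> by (intro mult_left_mono) auto
    moreover have "4 * (?s * B) \<le> \<kappa> * ?s\<^sup>2 + 4 * (1 / \<kappa> * B\<^sup>2)"
    proof -
      have "0 \<le> (\<kappa> * ?s - 2 * B)\<^sup>2 / \<kappa>" using \<kappa> by simp
      also have "\<dots> = \<kappa> * ?s\<^sup>2 + 4 * (1 / \<kappa> * B\<^sup>2) - 4 * (?s * B)"
        using \<kappa> by (simp add: power2_eq_square field_simps)
      finally show ?thesis by simp
    qed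
    ultimately show ?thesis using a by (simp add: algebra_simps)
  qed
  have "(norm_XY \<Omega> \<kappa> ((u, e, s), (l, m)))\<^sup>2
      = A\<^sup>2 + A\<^sup>2 + \<kappa> * (l2_norm M s)\<^sup>2 + (1 / \<kappa> * B\<^sup>2 + (l2_norm M m)\<^sup>2)"
    using \<kappa> by (simp add: A_def[symmetric] B_def[symmetric] l2_norm_sq[of M e] ee)
  also have "\<dots> \<le> (7 * K + 2 * \<kappa> + 2) * D\<^sup>2"
    using A2 B2 mm ss by (simp add: algebra_simps)
  finally have "(norm_XY \<Omega> \<kappa> ((u, e, s), (l, m)))\<^sup>2 \<le> (7 * K + 2 * \<kappa> + 2) * D\<^sup>2" .
  then have "norm_XY \<Omega> \<kappa> ((u, e, s), (l, m)) \<le> sqrt ((7 * K + 2 * \<kappa> + 2) * D\<^sup>2)"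
    by (rule real_le_rsqrt)
  also have "\<dots> = sqrt (7 * K + 2 * \<kappa> + 2) * D" using D_ge(4) by (simp add: real_sqrt_mult)
  finally show ?thesis unfolding K_def D_def .
qed

lemma solution_difference_bound:
  assumes d: "d \<in> data_space \<Omega>" "d' \<in> data_space \<Omega>"
    and sol: "P2_solution \<Omega> \<Gamma> \<zeta> \<kappa> d x y" "P2_solution \<Omega> \<Gamma> \<zeta> \<kappa> d' x' y'"
  shows "norm_XY \<Omega> \<kappa> ((x, y) - (x', y')) \<le> sqrt (7 * (1 + \<kappa> * (C + 1)\<^sup>2) + 2 * \<kappa> + 2) * data_norm \<Omega> (d - d')"
proof -
  obtain q et st where 1: "d = (q, et, st)" by (cases d)
  obtain q' et' st' where 2: "d' = (q', et', st')" by (cases d')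
  obtain u e s l m where 3: "x = (u, e, s)" "y = (l, m)" by (cases x, cases y)
  obtain u' e' s' l' m' where 4: "x' = (u', e', s')" "y' = (l', m')" by (cases x', cases y')
  have mem: "q \<in> L2 M" "et \<in> L2 M" "st \<in> L2 M" "q' \<in> L2 M" "et' \<in> L2 M" "st' \<in> L2 M"
    using d by (auto simp: 1 2 data_space_def)
  have "optimal (q, et, st) (u, e, s) (l, m)" "optimal (q', et', st') (u', e', s') (l', m')"
    using saddle_point_imp_optimal[OF mem(1-3)] saddle_point_imp_optimal[OF mem(4-6)] sol by (simp_all add: 1 2 3 4)
  from optimal_bound[OF optimal_diff[OF this mem] L2_diff L2_diff L2_diff]
  show ?thesis using mem by (simp add: 1 2 3 4 del: norm_XY.simps data_norm.simps)
qed

lemma ae_equal_if_norm_XY_zero: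
  assumes "x \<in> space_X \<Omega> \<Gamma>" "y \<in> space_Y \<Omega> \<Gamma>" "x' \<in> space_X \<Omega> \<Gamma>" "y' \<in> space_Y \<Omega> \<Gamma>"
    and zero: "norm_XY \<Omega> \<kappa> ((x, y) - (x', y')) \<le> 0"
  shows "ae_equal \<Omega> (x, y) (x', y')"
proof -
  obtain u e s l m where 3: "x = (u, e, s)" "y = (l, m)" by (cases x, cases y)
  obtain u' e' s' l' m' where 4: "x' = (u', e', s')" "y' = (l', m')" by (cases x', cases y')
  have mem: "u \<in> V" "e \<in> L2 M" "s \<in> L2 M" "l \<in> V" "m \<in> L2 M" "u' \<in> V" "e' \<in> L2 M" "s' \<in> L2 M" "l' \<in> V" "m' \<in> L2 M"
    using assms(1-4) by (auto simp: 3 4 space_X_def space_Y_def)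
  define a where "a = (l2_norm M (grad \<Omega> (u - u')))\<^sup>2"
  define b where "b = (l2_norm M (e - e'))\<^sup>2"
  define c where "c = \<kappa> * (l2_norm M (s - s'))\<^sup>2"
  define f where "f = 1 / \<kappa> * (l2_norm M (grad \<Omega> (l - l')))\<^sup>2"
  define g where "g = (l2_norm M (m - m'))\<^sup>2"
  have nn: "0 \<le> a" "0 \<le> b" "0 \<le> c" "0 \<le> f" "0 \<le> g" using \<kappa> by (simp_all add: a_def b_def c_def f_def g_def)
  have "norm_XY \<Omega> \<kappa> ((x, y) - (x', y')) = sqrt ((sqrt (a + b + c))\<^sup>2 + (sqrt (f + g))\<^sup>2)"
    by (simp add: 3 4 a_def b_def c_def f_def g_def)
  then have "sqrt (a + b + c + (f + g)) \<le> 0" using zero nn by simp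
  then have "a + b + c + (f + g) \<le> 0" by simp
  then have "a = 0" "b = 0" "c = 0" "f = 0" "g = 0" using nn by linarith+
  then have 0: "l2_norm M (grad \<Omega> (u - u')) = 0" "l2_norm M (e - e') = 0" "l2_norm M (s - s') = 0"
    "l2_norm M (grad \<Omega> (l - l')) = 0" "l2_norm M (m - m') = 0"
    using \<kappa> by (simp_all add: a_def b_def c_def f_def g_def)
  have V0: "l2_norm M (v - v') = 0" if "v \<in> V" "v' \<in> V" "l2_norm M (grad \<Omega> (v - v')) = 0" for v v'
  proof -
    have "v - v' \<in> V" unfolding diff_eq_lincomb by (intro H1_zero_on_lincomb that)
    from friedrichs[OF this] show ?thesis using that(3) l2_norm_nonneg[of M "v - v'"] by simp
  qed
  have ae: "AE t in M. f t = g t" if "f \<in> L2 M" "g \<in> L2 M" "l2_norm M (f - g) = 0" for f g :: "'a \<Rightarrow> 'c::euclidean_space"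
    using l2_norm_eq_0_iff[OF L2_diff[OF that(1,2)]] that(3) by simp
  have "AE t in M. u t = u' t" "AE t in M. e t = e' t" "AE t in M. s t = s' t" "AE t in M. l t = l' t" "AE t in M. m t = m' t"
    by (intro ae V0 V_L2 mem 0)+
  then show ?thesis unfolding 3 4 ae_equal.simps by eventually_elim simp
qed

lemma well_posed: "P2_well_posed \<Omega> \<Gamma> \<zeta> \<kappa>"
  unfolding P2_well_posed_def
proof (intro conjI ballI)
  fix d assume d: "d \<in> data_space \<Omega>"
  obtain q et st where 1: "d = (q, et, st)" by (cases d)
  have "q \<in> L2 M" "et \<in> L2 M" "st \<in> L2 M" using d by (auto simp: 1 data_space_def)
  from saddle_point_exists[OF this] obtain x y where xy: "P2_solution \<Omega> \<Gamma> \<zeta> \<kappa> d x y" unfolding 1 by blast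
  have "ae_equal \<Omega> (x', y') (x, y)" if s: "P2_solution \<Omega> \<Gamma> \<zeta> \<kappa> d x' y'" for x' y'
  proof (rule ae_equal_if_norm_XY_zero)
    have "data_norm \<Omega> (d - d) = 0"
      by (simp add: 1 l2_norm_def l2_inner_def)
    then show "norm_XY \<Omega> \<kappa> ((x', y') - (x, y)) \<le> 0" using solution_difference_bound[OF d d s xy] by simp
  qed (use xy s in \<open>auto simp: P2_solution_def\<close>)
  with xy show "\<exists>x y. P2_solution \<Omega> \<Gamma> \<zeta> \<kappa> d x y \<and> (\<forall>x' y'. P2_solution \<Omega> \<Gamma> \<zeta> \<kappa> d x' y' \<longrightarrow> ae_equal \<Omega> (x', y') (x, y))"
    by blast
next
  fix d0 assume d0: "d0 \<in> data_space \<Omega>"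
  define K where "K = sqrt (7 * (1 + \<kappa> * (C + 1)\<^sup>2) + 2 * \<kappa> + 2)"
  have K: "K > 0" unfolding K_def using \<kappa> by (simp add: add_pos_nonneg)
  show "\<forall>x0 y0. P2_solution \<Omega> \<Gamma> \<zeta> \<kappa> d0 x0 y0 \<longrightarrow>
        (\<forall>\<epsilon>>0. \<exists>\<delta>>0. \<forall>d\<in>data_space \<Omega>. \<forall>x y. P2_solution \<Omega> \<Gamma> \<zeta> \<kappa> d x y \<longrightarrow>
           data_norm \<Omega> (d - d0) < \<delta> \<longrightarrow> norm_XY \<Omega> \<kappa> ((x, y) - (x0, y0)) < \<epsilon>)"
  proof (intro allI impI)
    fix x0 y0 and \<epsilon> :: real
    assume s0: "P2_solution \<Omega> \<Gamma> \<zeta> \<kappa> d0 x0 y0" and \<epsilon>: "\<epsilon> > 0"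
    have "norm_XY \<Omega> \<kappa> ((x, y) - (x0, y0)) < \<epsilon>"
      if d: "d \<in> data_space \<Omega>" and s: "P2_solution \<Omega> \<Gamma> \<zeta> \<kappa> d x y" and small: "data_norm \<Omega> (d - d0) < \<epsilon> / K" for d x y
    proof -
      have "norm_XY \<Omega> \<kappa> ((x, y) - (x0, y0)) \<le> K * data_norm \<Omega> (d - d0)"
        unfolding K_def by (rule solution_difference_bound[OF d d0 s s0])
      also have "\<dots> < K * (\<epsilon> / K)" using small K by (rule mult_strict_left_mono)
      also have "\<dots> = \<epsilon>" using K by simp
      finally show ?thesis .
    qed
    then show "\<exists>\<delta>>0. \<forall>d\<in>data_space \<Omega>. \<forall>x y. P2_solution \<Omega> \<Gamma> \<zeta> \<kappa> d x y \<longrightarrow>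
           data_norm \<Omega> (d - d0) < \<delta> \<longrightarrow> norm_XY \<Omega> \<kappa> ((x, y) - (x0, y0)) < \<epsilon>"
      using \<epsilon> K by (intro exI[of _ "\<epsilon> / K"]) auto
  qed
qed

end

theorem theorem2p1:
  fixes \<Omega> \<Gamma>D \<Gamma>N :: "'a::euclidean_space set" and \<zeta> :: "'a \<Rightarrow> real" and \<kappa> :: real
  assumes "regular_domain \<Omega>"
    and "\<Gamma>D \<in> sets (surface_measure \<Omega>)" and "\<Gamma>N \<in> sets (surface_measure \<Omega>)"
    and "\<Gamma>D \<union> \<Gamma>N = frontier \<Omega>" and "\<Gamma>D \<inter> \<Gamma>N = {}"
    and "emeasure (surface_measure \<Omega>) \<Gamma>D > 0"
    and "\<zeta> \<in> Linfty (lebesgue_on \<Omega>)"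
    and "\<kappa> > 0"
  shows "P2_well_posed \<Omega> \<Gamma>D \<zeta> \<kappa>"
proof -
  interpret bounded_open \<Omega>
    by standard (use assms(1) in \<open>auto simp: regular_domain_def\<close>)
  obtain C where "0 \<le> C" "\<And>u. u \<in> H1_zero_on \<Omega> \<Gamma>D \<Longrightarrow> l2_norm (lebesgue_on \<Omega>) u \<le> C * l2_norm (lebesgue_on \<Omega>) (grad \<Omega> u)"
    using friedrichs_inequality[OF assms(1,2,6)] by blast
  then interpret reaction_problem \<Omega> \<Gamma>D C \<zeta> \<kappa>
    by unfold_locales (use assms(7,8) in auto)
  show ?thesis by (rule well_posed)
qed

end
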